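(* Let $n\ge2$, let $\mathbf a=(a_0,\dots,a_n)$ be a tuple of positive integers, and write $[n]=\{1,\dots,n\}$. Consider the $\mathbb C$-algebra homomorphism $$\Psi_{\mathbf a}:\mathbb C[x_j,P_\tau,P_{0,\tau'}]\to\mathbb C[t_j^{\pm1},y_{ij}],$$ where the source has variables $x_j$ ($0\le j\le n$), $P_\tau$ ($\tau\subset[n]$, $1\le|\tau|\le n-1$) and $P_{0,\tau'}$ ($\tau'\subset[n]$, $0\le|\tau'|\le n-2$), the target has variables $t_j$ ($0\le j\le n$) and $y_{ij}$ ($1\le i\le n-1$, $1\le j\le n$), and $$\Psi_{\mathbf a}(x_j)=t_j^{-1},\qquad \Psi_{\mathbf a}(P_\tau)=\det[y(\tau)]\,t^{\mathbf a_\tau},\qquad \Psi_{\mathbf a}(P_{0,\tau'})=-\sum_{j=1}^n\det[y(j,\tau')]\,t_0^{a_0}t^{\mathbf a_{\tau'}}.$$ Then $\ker(\Psi_{\mathbf a})$ is generated by the Plücker relations among the $P_\tau$ and $P_{0,\tau'}$ together with the polynomials $$\sum_{j\in\{0,\dots,n\}\setminus\tau}x_j^{a_j}P_{j\tau},\qquad \tau\subset\{0,\dots,n\},\ |\tau|\le n-2.$$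
   Context: For $\tau\subset[n]$, $y(\tau)$ is the submatrix of $[y_{ij}]$ on the first $|\tau|$ rows and the columns in $\tau$ taken in increasing order; $y(j,\tau)$ is the square submatrix on the first $|\tau|+1$ rows whose columns are column $j$ followed by the columns of $\tau$ in increasing order (so $\det[y(j,\tau)]=0$ if $j\in\tau$). Also $t^{\mathbf a_\tau}=\prod_{j\in\tau}t_j^{a_j}$. For an increasing index set $\{0\}\cup\tau'$ with $\tau'\subset[n]$ the symbol $P_{\{0\}\cup\tau'}$ means $P_{0,\tau'}$; for a sequence of indices in $\{0,\dots,n\}$, $P$ with that sequence as subscript is understood to be antisymmetric in its subscripts (zero if an index repeats). $P_{j\tau}$ has as subscript $j$ followed by the elements of $\tau$ in increasing order. The Plücker relations are the standard quadratic relations among the top-justified minors of sizes $1,\dots,n-1$ of a generic $(n-1)\times(n+1)$ matrix with columns indexed by $0,\dots,n$: for $n-1\ge p\ge q\ge k\ge1$ and indices $i_1,\dots,i_p,j_1,\dots,j_q\in\{0,\dots,n\}$, $$P_{i_1\cdots i_p}P_{j_1\cdots j_q}-\sum P_{i'_1\cdots i'_p}P_{j'_1\cdots j'_q},$$ the sum being over all pairs obtained by exchanging $j_1,\dots,j_k$ with $k$ of the subscripts $i_1,\dots,i_p$, preserving the order in each. These generate the ideal of all polynomial relations among these minors. (The image of $\Psi_{\mathbf a}$ is the Cox ring of the full flag bundle of the cokernel $\mathcal E_{\mathbf a}$ of $\mathcal O\to\bigoplus_{j=0}^n\mathcal O(a_j)$, $1\mapsto(x_0^{a_0},\dots,x_n^{a_n})$,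 on $\mathbb P^n$.) *)

theory Defs
  imports
    "HOL-Algebra.Ideal"
    "HOL-Library.Poly_Mapping"
    "HOL-Library.Product_Plus"
    Complex_Main
    "Jordan_Normal_Form.Determinant"
begin

section \<open>Monoid algebras over the complex numbers\<close>

text \<open>
  The ring \<open>\<complex>[M]\<close> for a submonoid \<open>M\<close> of a commutative additive monoid.
  With exponent vectors \<open>'v \<Rightarrow>\<^sub>0 nat\<close> it is a polynomial ring, and with exponent vectors
  \<open>'v \<Rightarrow>\<^sub>0 int\<close> a Laurent polynomial ring.
\<close>

definition monoid_algebra :: "'m::comm_monoid_add set \<Rightarrow> ('m \<Rightarrow>\<^sub>0 complex) ring" where
  "monoid_algebra M =
     \<lparr>carrier = {p. Poly_Mapping.keys p \<subseteq> M}, monoid.mult = (*), one = 1,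
      ring.zero = 0, add = (+)\<rparr>"

definition const :: "complex \<Rightarrow> ('m::comm_monoid_add \<Rightarrow>\<^sub>0 complex)" where
  "const c = Poly_Mapping.single 0 c"

text \<open>Substitution of \<open>f v\<close> for every variable \<open>v\<close>.\<close>

definition subst_monomial :: "('v \<Rightarrow> 'r) \<Rightarrow> ('v \<Rightarrow>\<^sub>0 nat) \<Rightarrow> 'r::comm_monoid_mult" where
  "subst_monomial f m = (\<Prod>v\<in>Poly_Mapping.keys m. f v ^ Poly_Mapping.lookup m v)"

definition subst_poly ::
  "('v \<Rightarrow> ('m::comm_monoid_add \<Rightarrow>\<^sub>0 complex)) \<Rightarrow> (('v \<Rightarrow>\<^sub>0 nat) \<Rightarrow>\<^sub>0 complex) \<Rightarrow> ('m \<Rightarrow>\<^sub>0 complex)" where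
  "subst_poly f p =
     (\<Sum>m\<in>Poly_Mapping.keys p. const (Poly_Mapping.lookup p m) * subst_monomial f m)"


section \<open>The source ring\<close>

text \<open>
  \<open>PVar \<sigma>\<close> with \<open>0 \<notin> \<sigma>\<close> is the variable \<open>P\<^sub>\<sigma>\<close>, and \<open>PVar (insert 0 \<tau>')\<close> with \<open>0 \<notin> \<tau>'\<close> is
  the variable \<open>P\<^bsub>0,\<tau>'\<^esub>\<close>.
\<close>

datatype cox_var = XVar nat | PVar "nat set"

type_synonym cox_poly = "(cox_var \<Rightarrow>\<^sub>0 nat) \<Rightarrow>\<^sub>0 complex"

definition cox_vars :: "nat \<Rightarrow> cox_var set" where
  "cox_vars n =
     {XVar j | j. j \<le> n}
     \<union> {PVar \<tau> | \<tau>. \<tau> \<subseteq> {1..n} \<and> 1 \<le> card \<tau> \<and> card \<tau> \<le> n - 1}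
     \<union> {PVar (insert 0 \<tau>') | \<tau>'. \<tau>' \<subseteq> {1..n} \<and> card \<tau>' \<le> n - 2}"

definition source_ring :: "nat \<Rightarrow> cox_poly ring" where
  "source_ring n = monoid_algebra {m. Poly_Mapping.keys m \<subseteq> cox_vars n}"

definition var :: "cox_var \<Rightarrow> cox_poly" where
  "var v = Poly_Mapping.single (Poly_Mapping.single v 1) 1"


section \<open>The target ring\<close>

text \<open>
  The exponent \<open>(e, d)\<close> stands for \<open>(\<Prod>j. t\<^sub>j powi e\<^sub>j) * (\<Prod>i j. y\<^sub>i\<^sub>j ^ d\<^sub>i\<^sub>j)\<close>.
\<close>

type_synonym target_poly = "((nat \<Rightarrow>\<^sub>0 int) \<times> (nat \<times> nat \<Rightarrow>\<^sub>0 nat)) \<Rightarrow>\<^sub>0 complex"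

definition target_ring :: "nat \<Rightarrow> target_poly ring" where
  "target_ring n = monoid_algebra
     {(e, d). Poly_Mapping.keys e \<subseteq> {0..n} \<and> Poly_Mapping.keys d \<subseteq> {1..n - 1} \<times> {1..n}}"

definition tvar :: "nat \<Rightarrow> target_poly" where
  "tvar j = Poly_Mapping.single (Poly_Mapping.single j 1, 0) 1"

definition tvar_inv :: "nat \<Rightarrow> target_poly" where
  "tvar_inv j = Poly_Mapping.single (Poly_Mapping.single j (- 1), 0) 1"

definition yvar :: "nat \<Rightarrow> nat \<Rightarrow> target_poly" where
  "yvar i j = Poly_Mapping.single (0, Poly_Mapping.single (i, j) 1) 1"

text \<open>
  The top-justified square submatrix of \<open>[y\<^sub>i\<^sub>j]\<close> whose columns are listed in \<open>cs\<close>; matrix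
  entries are indexed from \<open>0\<close>, the variables from \<open>1\<close>.
\<close>

definition ymat :: "nat list \<Rightarrow> target_poly mat" where
  "ymat cs = mat (length cs) (length cs) (\<lambda>(r, c). yvar (r + 1) (cs ! c))"

definition t_monomial :: "(nat \<Rightarrow> nat) \<Rightarrow> nat set \<Rightarrow> target_poly" where
  "t_monomial a \<tau> = (\<Prod>j\<in>\<tau>. tvar j ^ a j)"


section \<open>The homomorphism\<close>

fun Psi_var :: "nat \<Rightarrow> (nat \<Rightarrow> nat) \<Rightarrow> cox_var \<Rightarrow> target_poly" where
  "Psi_var n a (XVar j) = tvar_inv j"
| "Psi_var n a (PVar \<sigma>) =
     (if 0 \<notin> \<sigma> then det (ymat (sorted_list_of_set \<sigma>)) * t_monomial a \<sigma>
      else (let \<tau>' = \<sigma> - {0} in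
        - (\<Sum>j=1..n. det (ymat (j # sorted_list_of_set \<tau>')) * tvar 0 ^ a 0 * t_monomial a \<tau>')))"

definition Psi :: "nat \<Rightarrow> (nat \<Rightarrow> nat) \<Rightarrow> cox_poly \<Rightarrow> target_poly" where
  "Psi n a = subst_poly (Psi_var n a)"


section \<open>The generators of the kernel\<close>

fun inversions :: "nat list \<Rightarrow> nat" where
  "inversions [] = 0"
| "inversions (i # is) = length (filter (\<lambda>j. j < i) is) + inversions is"

text \<open>The antisymmetric symbol \<open>P\<close> with a sequence of indices as subscript.\<close>

definition bracket :: "nat list \<Rightarrow> cox_poly" where
  "bracket is = (if distinct is then (- 1) ^ inversions is * var (PVar (set is)) else 0)"

text \<open>
  Exchanging the first \<open>card S\<close> entries of \<open>js\<close> with the entries of \<open>is\<close> at the positions in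
  \<open>S\<close> (counted from \<open>0\<close>), preserving the order in each: \<open>exchange_fst\<close> is what becomes of
  \<open>is\<close>, and \<open>exchange_snd\<close> what becomes of \<open>js\<close>.
\<close>

definition exchange_fst :: "nat set \<Rightarrow> nat list \<Rightarrow> nat list \<Rightarrow> nat list" where
  "exchange_fst S is js =
     map (\<lambda>r. if r \<in> S then js ! card {s \<in> S. s < r} else is ! r) [0..<length is]"

definition exchange_snd :: "nat set \<Rightarrow> nat list \<Rightarrow> nat list \<Rightarrow> nat list" where
  "exchange_snd S is js = nths is S @ drop (card S) js"

definition pluecker_poly :: "nat \<Rightarrow> nat list \<Rightarrow> nat list \<Rightarrow> cox_poly" where
  "pluecker_poly k is js =
     bracket is * bracket js
     - (\<Sum>S | S \<subseteq> {..<length is} \<and> card S = k.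
          bracket (exchange_fst S is js) * bracket (exchange_snd S is js))"

definition pluecker_relations :: "nat \<Rightarrow> cox_poly set" where
  "pluecker_relations n =
     {pluecker_poly k is js | k is js.
        n - 1 \<ge> length is \<and> length is \<ge> length js \<and> length js \<ge> k \<and> k \<ge> 1 \<and>
        set is \<subseteq> {0..n} \<and> set js \<subseteq> {0..n}}"

definition linear_relations :: "nat \<Rightarrow> (nat \<Rightarrow> nat) \<Rightarrow> cox_poly set" where
  "linear_relations n a =
     {\<Sum>j\<in>{0..n} - \<tau>. var (XVar j) ^ a j * bracket (j # sorted_list_of_set \<tau>) | \<tau>.
        \<tau> \<subseteq> {0..n} \<and> card \<tau> \<le> n - 2}"


section \<open>Basic properties\<close>

lemma keys_uminus_eq: "Poly_Mapping.keys (- p) = Poly_Mapping.keys (p :: 'a \<Rightarrow>\<^sub>0 'b::ab_group_add)"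
  by (auto simp: in_keys_iff)

locale submonoid_add =
  fixes M :: "'m::comm_monoid_add set"
  assumes zero_mem: "0 \<in> M" and add_mem: "x \<in> M \<Longrightarrow> y \<in> M \<Longrightarrow> x + y \<in> M"
begin

abbreviation (input) C :: "('m \<Rightarrow>\<^sub>0 complex) set" where
  "C \<equiv> carrier (monoid_algebra M)"

lemma single_mem: "m \<in> M \<Longrightarrow> Poly_Mapping.single m c \<in> C"
  by (simp add: monoid_algebra_def)

lemma const_mem: "const c \<in> C"
  unfolding const_def by (intro single_mem zero_mem)

lemma zero_closed: "0 \<in> C" and one_closed: "1 \<in> C"
  using zero_mem by (simp_all add: monoid_algebra_def)

lemma plus_closed: "p \<in> C \<Longrightarrow> q \<in> C \<Longrightarrow> p + q \<in> C"
  using Poly_Mapping.keys_add[of p q] by (auto simp: monoid_algebra_def)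

lemma uminus_closed: "p \<in> C \<Longrightarrow> - p \<in> C"
  by (simp add: monoid_algebra_def keys_uminus_eq)

lemma minus_closed: "p \<in> C \<Longrightarrow> q \<in> C \<Longrightarrow> p - q \<in> C"
  using plus_closed[of p "- q"] uminus_closed by simp

lemma times_closed: "p \<in> C \<Longrightarrow> q \<in> C \<Longrightarrow> p * q \<in> C"
  using keys_mult[of p q] add_mem by (fastforce simp: monoid_algebra_def)

lemma power_closed: "p \<in> C \<Longrightarrow> p ^ k \<in> C"
  by (induction k) (auto intro: one_closed times_closed)

lemma sum_closed: "(\<And>i. i \<in> I \<Longrightarrow> f i \<in> C) \<Longrightarrow> sum f I \<in> C"
  by (induction I rule: infinite_finite_induct) (auto intro: zero_closed plus_closed)

lemma prod_closed: "(\<And>i. i \<in> I \<Longrightarrow> f i \<in> C) \<Longrightarrow> prod f I \<in> C"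
  by (induction I rule: infinite_finite_induct) (auto intro: one_closed times_closed)

lemma signof_closed: "of_int (sign p) \<in> C"
  by (auto simp: sign_def intro: one_closed uminus_closed)

lemma det_closed:
  assumes "\<And>i j. i < dim_row A \<Longrightarrow> j < dim_col A \<Longrightarrow> A $$ (i, j) \<in> C"
  shows "det A \<in> C"
  unfolding det_def
  using assms
  by (auto intro!: zero_closed sum_closed times_closed signof_closed prod_closed
      simp: permutes_in_image)

lemma cring_monoid_algebra: "cring (monoid_algebra M)"
proof (intro cringI abelian_groupI comm_monoidI)
  fix x assume "x \<in> C"
  then show "\<exists>y\<in>C. y \<oplus>\<^bsub>monoid_algebra M\<^esub> x = \<zero>\<^bsub>monoid_algebra M\<^esub>"
    using uminus_closed[of x] by (intro bexI[of _ "- x"]) (auto simp: monoid_algebra_def)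
qed (use plus_closed times_closed zero_closed one_closed in
      \<open>simp_all add: monoid_algebra_def algebra_simps\<close>)

lemma subst_poly_closed:
  assumes "\<And>v. v \<in> V \<Longrightarrow> f v \<in> C"
    and "p \<in> carrier (monoid_algebra {m. Poly_Mapping.keys m \<subseteq> V})"
  shows "subst_poly f p \<in> C"
  unfolding subst_poly_def subst_monomial_def
  using assms
  by (intro sum_closed times_closed const_mem prod_closed power_closed)
     (auto simp: monoid_algebra_def)

end

lemma submonoid_keys:
  "submonoid_add {m :: 'v \<Rightarrow>\<^sub>0 'b::comm_monoid_add. Poly_Mapping.keys m \<subseteq> V}"
  by unfold_locales (use Poly_Mapping.keys_add in fastforce)+

lemma submonoid_target:
  "submonoid_add {(e :: 'v \<Rightarrow>\<^sub>0 'b::comm_monoid_add, d :: 'w \<Rightarrow>\<^sub>0 'c::comm_monoid_add).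
     Poly_Mapping.keys e \<subseteq> V \<and> Poly_Mapping.keys d \<subseteq> W}"
proof
  show "0 \<in> {(e :: 'v \<Rightarrow>\<^sub>0 'b, d :: 'w \<Rightarrow>\<^sub>0 'c). Poly_Mapping.keys e \<subseteq> V \<and> Poly_Mapping.keys d \<subseteq> W}"
    by (simp add: zero_prod_def)
next
  fix x y :: "('v \<Rightarrow>\<^sub>0 'b) \<times> ('w \<Rightarrow>\<^sub>0 'c)"
  assume "x \<in> {(e, d). Poly_Mapping.keys e \<subseteq> V \<and> Poly_Mapping.keys d \<subseteq> W}"
    and "y \<in> {(e, d). Poly_Mapping.keys e \<subseteq> V \<and> Poly_Mapping.keys d \<subseteq> W}"
  then show "x + y \<in> {(e, d). Poly_Mapping.keys e \<subseteq> V \<and> Poly_Mapping.keys d \<subseteq> W}"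
    using Poly_Mapping.keys_add[of "fst x" "fst y"] Poly_Mapping.keys_add[of "snd x" "snd y"]
    by (cases x; cases y) (simp; blast)
qed

lemma submonoid_source_exponents:
  "submonoid_add {m :: cox_var \<Rightarrow>\<^sub>0 nat. Poly_Mapping.keys m \<subseteq> cox_vars n}"
  by (rule submonoid_keys)

lemma submonoid_target_exponents:
  "submonoid_add {(e :: nat \<Rightarrow>\<^sub>0 int, d :: nat \<times> nat \<Rightarrow>\<^sub>0 nat).
     Poly_Mapping.keys e \<subseteq> {0..n} \<and> Poly_Mapping.keys d \<subseteq> {1..n - 1} \<times> {1..n}}"
  by (rule submonoid_target)

lemmas source_closed =
  submonoid_add.zero_closed[OF submonoid_source_exponents, folded source_ring_def]
  submonoid_add.one_closed[OF submonoid_source_exponents, folded source_ring_def]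
  submonoid_add.uminus_closed[OF submonoid_source_exponents, folded source_ring_def]
  submonoid_add.minus_closed[OF submonoid_source_exponents, folded source_ring_def]
  submonoid_add.times_closed[OF submonoid_source_exponents, folded source_ring_def]
  submonoid_add.power_closed[OF submonoid_source_exponents, folded source_ring_def]
  submonoid_add.sum_closed[OF submonoid_source_exponents, folded source_ring_def]

lemmas target_closed =
  submonoid_add.uminus_closed[OF submonoid_target_exponents, folded target_ring_def]
  submonoid_add.times_closed[OF submonoid_target_exponents, folded target_ring_def]
  submonoid_add.power_closed[OF submonoid_target_exponents, folded target_ring_def]
  submonoid_add.sum_closed[OF submonoid_target_exponents, folded target_ring_def]
  submonoid_add.prod_closed[OF submonoid_target_exponents, folded target_ring_def]

lemma cring_source_ring: "cring (source_ring n)"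
  unfolding source_ring_def by (intro submonoid_add.cring_monoid_algebra submonoid_source_exponents)

lemma cring_target_ring: "cring (target_ring n)"
  unfolding target_ring_def by (intro submonoid_add.cring_monoid_algebra submonoid_target_exponents)

lemma const_add: "const (c + d) = const c + const d"
  and const_mult: "const (c * d) = const c * const d"
  and const_0: "const 0 = 0" and const_1: "const 1 = 1"
  by (simp_all add: const_def single_add mult_single)

lemma subst_monomial_superset:
  "finite A \<Longrightarrow> Poly_Mapping.keys m \<subseteq> A \<Longrightarrow>
     subst_monomial f m = (\<Prod>v\<in>A. f v ^ Poly_Mapping.lookup m v)"
  unfolding subst_monomial_def by (rule prod.mono_neutral_left) (auto simp: in_keys_iff)

lemma subst_monomial_add: "subst_monomial f (m + m') = subst_monomial f m * subst_monomial f m'"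
  using subst_monomial_superset[of "Poly_Mapping.keys m \<union> Poly_Mapping.keys m'" _ f]
    Poly_Mapping.keys_add[of m m']
  by (simp add: lookup_add power_add prod.distrib)

lemma subst_poly_superset:
  "finite A \<Longrightarrow> Poly_Mapping.keys p \<subseteq> A \<Longrightarrow>
     subst_poly f p = (\<Sum>m\<in>A. const (Poly_Mapping.lookup p m) * subst_monomial f m)"
  unfolding subst_poly_def by (rule sum.mono_neutral_left) (auto simp: in_keys_iff const_0)

lemma subst_poly_add: "subst_poly f (p + q) = subst_poly f p + subst_poly f q"
  using subst_poly_superset[of "Poly_Mapping.keys p \<union> Poly_Mapping.keys q" _ f]
    Poly_Mapping.keys_add[of p q]
  by (simp add: lookup_add const_add sum.distrib distrib_right)

lemma subst_poly_0: "subst_poly f 0 = 0"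
  by (simp add: subst_poly_def)

lemma subst_poly_sum: "subst_poly f (sum g I) = (\<Sum>i\<in>I. subst_poly f (g i))"
  by (induction I rule: infinite_finite_induct) (simp_all add: subst_poly_0 subst_poly_add)

lemma subst_poly_single: "subst_poly f (Poly_Mapping.single m c) = const c * subst_monomial f m"
  by (cases "c = 0") (simp_all add: subst_poly_def const_0)

lemma poly_mapping_eq_sum_single:
  "p = (\<Sum>m\<in>Poly_Mapping.keys p. Poly_Mapping.single m (Poly_Mapping.lookup p m))"
  by (rule poly_mapping_eqI) (simp add: lookup_sum lookup_single when_def in_keys_iff)

lemma subst_poly_mult: "subst_poly f (p * q) = subst_poly f p * subst_poly f q"
proof -
  let ?s = "\<lambda>p m. Poly_Mapping.single m (Poly_Mapping.lookup p m)"
  have "subst_poly f (p * q) =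
    subst_poly f (\<Sum>m\<in>Poly_Mapping.keys p. \<Sum>m'\<in>Poly_Mapping.keys q. ?s p m * ?s q m')"
    by (subst poly_mapping_eq_sum_single[of p], subst poly_mapping_eq_sum_single[of q])
       (simp add: sum_product)
  also have "\<dots> = subst_poly f p * subst_poly f q"
    unfolding subst_poly_sum mult_single subst_poly_single const_mult subst_monomial_add
    by (simp add: subst_poly_def sum_product ac_simps)
  finally show ?thesis .
qed

lemma subst_poly_const: "subst_poly f (const c) = const c"
  by (simp add: const_def[of c] subst_poly_single subst_monomial_def)

lemma subst_poly_var: "subst_poly f (var v) = f v"
  by (simp add: var_def subst_poly_single const_1 subst_monomial_def)

lemma tvar_inv: "tvar j * tvar_inv j = 1"
proof -
  have "(Poly_Mapping.single j 1, 0) + (Poly_Mapping.single j (- 1), 0)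
      = (0 :: (nat \<Rightarrow>\<^sub>0 int) \<times> (nat \<times> nat \<Rightarrow>\<^sub>0 nat))"
    unfolding plus_prod_def zero_prod_def by (simp flip: single_add)
  then show ?thesis
    by (simp add: tvar_def tvar_inv_def mult_single)
qed

lemma target_gens:
  "j \<le> n \<Longrightarrow> tvar j \<in> carrier (target_ring n)"
  "j \<le> n \<Longrightarrow> tvar_inv j \<in> carrier (target_ring n)"
  "i \<in> {1..n - 1} \<Longrightarrow> j \<in> {1..n} \<Longrightarrow> yvar i j \<in> carrier (target_ring n)"
  by (simp_all add: target_ring_def monoid_algebra_def tvar_def tvar_inv_def yvar_def)

lemma det_ymat_closed:
  assumes "length cs \<le> n - 1" "set cs \<subseteq> {1..n}"
  shows "det (ymat cs) \<in> carrier (target_ring n)"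
proof (rule submonoid_add.det_closed[OF submonoid_target_exponents, folded target_ring_def])
  fix i j assume ij: "i < dim_row (ymat cs)" "j < dim_col (ymat cs)"
  then have "cs ! j \<in> {1..n}"
    using assms(2) nth_mem[of j cs] unfolding ymat_def by fastforce
  with ij assms(1) show "ymat cs $$ (i, j) \<in> carrier (target_ring n)"
    by (auto simp: ymat_def intro!: target_gens)
qed

lemma t_monomial_closed: "\<tau> \<subseteq> {0..n} \<Longrightarrow> t_monomial a \<tau> \<in> carrier (target_ring n)"
  unfolding t_monomial_def by (intro target_closed target_gens) auto

lemma Psi_var_closed:
  assumes "n \<ge> 2" "v \<in> cox_vars n"
  shows "Psi_var n a v \<in> carrier (target_ring n)"
proof -
  consider j where "v = XVar j" "j \<le> n"
    | \<tau> where "v = PVar \<tau>" "\<tau> \<subseteq> {1..n}" "card \<tau> \<le> n - 1"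
    | \<tau> where "v = PVar (insert 0 \<tau>)" "\<tau> \<subseteq> {1..n}" "card \<tau> \<le> n - 2"
    using assms(2) unfolding cox_vars_def by blast
  then show ?thesis
  proof cases
    case 1
    then show ?thesis by (simp add: target_gens)
  next
    case 2
    then have "finite \<tau>" "0 \<notin> \<tau>" "\<tau> \<subseteq> {0..n}" by (auto intro: finite_subset)
    with 2 show ?thesis
      by (auto intro!: target_closed det_ymat_closed t_monomial_closed)
  next
    case 3
    then have *: "finite \<tau>" "insert 0 \<tau> - {0} = \<tau>" "\<tau> \<subseteq> {0..n}" by (auto intro: finite_subset)
    have "det (ymat (j # sorted_list_of_set \<tau>)) \<in> carrier (target_ring n)" if "j \<in> {1..n}" for j
      using that 3 * assms(1) by (intro det_ymat_closed) auto
    then have "- (\<Sum>j=1..n. det (ymat (j # sorted_list_of_set \<tau>)) * tvar 0 ^ a 0 * t_monomial a \<tau>)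
        \<in> carrier (target_ring n)"
      using * by (intro target_closed target_gens t_monomial_closed) auto
    then show ?thesis
      unfolding 3(1) Psi_var.simps Let_def *(2) by simp
  qed
qed

lemma Psi_XVar: "Psi n a (var (XVar j)) = tvar_inv j"
  by (simp add: Psi_def subst_poly_var)

lemma Psi_PVar:
  "\<tau> \<subseteq> {1..n} \<Longrightarrow>
     Psi n a (var (PVar \<tau>)) = det (ymat (sorted_list_of_set \<tau>)) * t_monomial a \<tau>"
  by (auto simp: Psi_def subst_poly_var)

lemma Psi_PVar0:
  assumes "\<tau>' \<subseteq> {1..n}"
  shows "Psi n a (var (PVar (insert 0 \<tau>'))) =
     - (\<Sum>j=1..n. det (ymat (j # sorted_list_of_set \<tau>')) * tvar 0 ^ a 0 * t_monomial a \<tau>')"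
proof -
  have "insert 0 \<tau>' - {0} = \<tau>'" using assms by auto
  then show ?thesis by (simp add: Psi_def subst_poly_var Let_def)
qed

lemma Psi_const: "Psi n a (const c) = const c"
  by (simp add: Psi_def subst_poly_const)

lemma Psi_ring_hom:
  assumes "n \<ge> 2"
  shows "Psi n a \<in> Ring.ring_hom (source_ring n) (target_ring n)"
proof (rule ring_hom_memI)
  fix p assume "p \<in> carrier (source_ring n)"
  then show "Psi n a p \<in> carrier (target_ring n)"
    unfolding Psi_def source_ring_def target_ring_def
    using Psi_var_closed[OF assms]
    by (intro submonoid_add.subst_poly_closed[OF submonoid_target_exponents, of "cox_vars n"])
       (auto simp: target_ring_def)
qed (simp_all add: Psi_def source_ring_def target_ring_def monoid_algebra_def subst_poly_add
    subst_poly_mult subst_poly_const[of _ 1, unfolded const_1])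

lemma bracket_sorted: "sorted_wrt (<) is \<Longrightarrow> bracket is = var (PVar (set is))"
proof -
  assume s: "sorted_wrt (<) is"
  then have "inversions is = 0" by (induction "is") (auto simp: filter_empty_conv)
  with s show ?thesis by (simp add: bracket_def strict_sorted_iff)
qed

lemma bracket_repeated: "\<not> distinct is \<Longrightarrow> bracket is = 0"
  by (simp add: bracket_def)

lemma bracket_swap: "bracket (us @ i # j # vs) = - bracket (us @ j # i # vs)"
proof -
  have lt: "inversions (us @ j # i # vs) = Suc (inversions (us @ i # j # vs))" if "i < j" for i j
    using that by (induction us) auto
  have "inversions (us @ i # j # vs) = Suc (inversions (us @ j # i # vs)) \<or>
      inversions (us @ j # i # vs) = Suc (inversions (us @ i # j # vs))" if "i \<noteq> j"
    using that lt[of i j] lt[of j i] by linarith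
  moreover have "distinct (us @ i # j # vs) \<longleftrightarrow> distinct (us @ j # i # vs)"
    "set (us @ i # j # vs) = set (us @ j # i # vs)"
    by auto
  ultimately show ?thesis
    unfolding bracket_def by (cases "i = j") (auto simp del: set_append inversions.simps)
qed

lemma PVar_mem:
  assumes "n \<ge> 2" "\<sigma> \<subseteq> {0..n}" "1 \<le> card \<sigma>" "card \<sigma> \<le> n - 1"
  shows "PVar \<sigma> \<in> cox_vars n"
proof (cases "0 \<in> \<sigma>")
  case False
  then have "\<sigma> \<subseteq> {1..n}" using assms(2) by (auto simp: Suc_le_eq subset_iff intro!: gr0I)
  then show ?thesis using assms by (auto simp: cox_vars_def)
next
  case True
  have "finite \<sigma>" using assms(2) finite_subset by blast
  then have "card (\<sigma> - {0}) \<le> n - 2" using True assms by simp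
  moreover have "\<sigma> - {0} \<subseteq> {1..n}" using assms(2) by (auto simp: Suc_le_eq subset_iff)
  moreover have "\<sigma> = insert 0 (\<sigma> - {0})" using True by auto
  ultimately show ?thesis unfolding cox_vars_def by blast
qed

lemma var_closed: "v \<in> cox_vars n \<Longrightarrow> var v \<in> carrier (source_ring n)"
  by (simp add: var_def source_ring_def monoid_algebra_def)

lemma bracket_closed:
  assumes "n \<ge> 2" "set is \<subseteq> {0..n}" "1 \<le> length is" "length is \<le> n - 1"
  shows "bracket is \<in> carrier (source_ring n)"
proof (cases "distinct is")
  case True
  then have "PVar (set is) \<in> cox_vars n"
    using assms by (intro PVar_mem) (auto simp: distinct_card)
  then have "var (PVar (set is)) \<in> carrier (source_ring n)" by (rule var_closed)
  then show ?thesis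
    using True unfolding bracket_def by (auto intro!: source_closed)
next
  case False
  then show ?thesis by (simp add: bracket_def source_closed)
qed

lemma linear_relations_closed:
  assumes "n \<ge> 2"
  shows "linear_relations n a \<subseteq> carrier (source_ring n)"
  unfolding linear_relations_def
proof clarify
  fix \<tau> assume "\<tau> \<subseteq> {0..n}" "card \<tau> \<le> n - 2"
  moreover have "finite \<tau>" using \<open>\<tau> \<subseteq> {0..n}\<close> finite_subset by blast
  ultimately show "(\<Sum>j\<in>{0..n} - \<tau>. var (XVar j) ^ a j * bracket (j # sorted_list_of_set \<tau>))
      \<in> carrier (source_ring n)"
    using assms by (intro source_closed var_closed bracket_closed) (auto simp: cox_vars_def)
qed

lemma length_exchange_fst [simp]: "length (exchange_fst S is js) = length is"
  by (simp add: exchange_fst_def)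

lemma set_exchange_fst:
  assumes "S \<subseteq> {..<length is}" "card S \<le> length js"
  shows "set (exchange_fst S is js) \<subseteq> set is \<union> set js"
proof -
  have "finite S" using assms(1) finite_subset by blast
  then have "card {s \<in> S. s < r} < length js" if "r \<in> S" for r
    using that assms(2) psubset_card_mono[of S "{s \<in> S. s < r}"] by fastforce
  then show ?thesis by (auto simp: exchange_fst_def)
qed

lemma length_exchange_snd:
  assumes "S \<subseteq> {..<length is}" "card S \<le> length js"
  shows "length (exchange_snd S is js) = length js"
proof -
  have "{i. i < length is \<and> i \<in> S} = S" using assms(1) by auto
  then show ?thesis using assms(2) by (simp add: exchange_snd_def length_nths)
qed

lemma set_exchange_snd: "set (exchange_snd S is js) \<subseteq> set is \<union> set js"
  unfolding exchange_snd_def using set_nths_subset[of "is" S] set_drop_subset[of "card S" js] by auto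

lemma pluecker_relations_closed:
  assumes "n \<ge> 2"
  shows "pluecker_relations n \<subseteq> carrier (source_ring n)"
  unfolding pluecker_relations_def
proof clarify
  fix k "is" js
  assume *: "length is \<le> n - 1" "length js \<le> length is" "k \<le> length js" "1 \<le> k"
    "set is \<subseteq> {0..n}" "set js \<subseteq> {0..n}"
  show "pluecker_poly k is js \<in> carrier (source_ring n)"
    unfolding pluecker_poly_def
  proof (intro source_closed)
    fix S assume "S \<in> {S. S \<subseteq> {..<length is} \<and> card S = k}"
    then have S: "S \<subseteq> {..<length is}" "card S \<le> length js" using * by auto
    show "bracket (exchange_fst S is js) \<in> carrier (source_ring n)"
      using * assms set_exchange_fst[OF S] by (intro bracket_closed) auto
    show "bracket (exchange_snd S is js) \<in> carrier (source_ring n)"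
      using * assms set_exchange_snd[of S "is" js] length_exchange_snd[OF S]
      by (intro bracket_closed) auto
  qed (use * assms in \<open>intro bracket_closed; auto\<close>)+
qed

end

theory Submission
  imports Defs "HOL-Algebra.RingHom"
begin

text \<open>
  The proof compares leading terms. Let \<open>Y\<close> be the matrix with columns \<open>y\<^sub>1, \<dots>, y\<^sub>n\<close> and the extra
  column \<open>y\<^sub>0 = - (y\<^sub>1 + \<dots> + y\<^sub>n)\<close>. The homomorphism sends \<open>P\<close> with a sequence of indices as subscript
  to the top-justified minor of \<open>Y\<close> on these columns, times a monomial in the \<open>t\<^sub>j\<close>
  (lemma \<open>Psi_bracket\<close>). The linear relations therefore vanish because the columns of \<open>Y\<close> add up
  to zero, and the Pluecker relations because minors satisfy the exchange identities
  (lemma \<open>exchange_subsets\<close>), which follow from Cramer's rule.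

  For the other inclusion, weight the \<open>y\<^sub>i\<^sub>j\<close> so that products with one factor from each of the first
  \<open>p\<close> rows are compared lexicographically, a smaller column index being heavier. The minor on the columns
  \<open>s\<^sub>0 < \<dots> < s\<^bsub>p-1\<^esub>\<close> of \<open>Y\<close> then has a single heaviest term, namely \<open>\<plusminus>\<Prod>\<^sub>r y\<^bsub>r+1, max s\<^sub>r (r+1)\<^esub>\<close>
  (lemma \<open>leads_minor\<close>): if \<open>0\<close> is not among the columns this is the diagonal term, and otherwise,
  among the summands of \<open>y\<^sub>0\<close>, the heaviest contribution is that of the smallest index missing from
  \<open>s\<close>. Consequently the image of a monomial \<open>x\<^sup>b P\<^sub>T\<close>, where \<open>T\<close> is a list of columns, has a single
  heaviest term; its exponent is called the key of \<open>(b, T)\<close>.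

  The central point is that two monomials with the same key agree up to a scalar, modulo the
  relations and modulo lighter monomials (lemma \<open>reduce_to_representative\<close>). Granting this, an
  element of the kernel whose monomials have weight at most \<open>w\<close> is congruent to a combination of one
  representative for each key of weight \<open>w\<close> and of lighter monomials. Distinct keys cannot cancel,
  so the representatives do not occur, and induction on \<open>w\<close> finishes the proof
  (lemma \<open>kernel_low_subset\<close>).

  Two kinds of steps bring a monomial to the representative of its key. Firstly, the Pluecker
  relations rewrite \<open>P\<^sub>T\<close> as a combination of standard tableaux of the same content
  (lemma \<open>straightening\<close>). A standard tableau is determined by its content and its key, so no
  cancellation of heaviest terms is possible in this combination: one of its members has the key of
  the original monomial and all others are lighter (lemma \<open>standard_reduction\<close>).
  Secondly, let \<open>u\<^sub>r\<close> be the number of columns of \<open>T\<close> with entry \<open>r\<close> in row \<open>r\<close>, counting rows from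
  \<open>0\<close>. The key and the numbers \<open>u\<^sub>r\<close> determine the content. If \<open>u\<^sub>r\<close> exceeds the corresponding number
  of another monomial with the same key for \<open>r = p, \<dots>, q - 1\<close>, but neither for \<open>r = p - 1\<close> nor for
  \<open>r = q\<close>, then some column of \<open>T\<close> contains \<open>0, \<dots>, q - 1\<close> but not \<open>q\<close>, and \<open>x\<^sub>p\<close> occurs to at least
  the power \<open>a\<^sub>p\<close>. If this column is \<open>\<tau> \<union> {p}\<close>, then the linear relation of \<open>\<tau>\<close> has exactly two
  heaviest terms, \<open>x\<^sub>p\<close> to the power \<open>a\<^sub>p\<close> times \<open>P\<^bsub>p\<tau>\<^esub>\<close> and \<open>x\<^sub>q\<close> to the power \<open>a\<^sub>q\<close> times \<open>P\<^bsub>q\<tau>\<^esub>\<close>,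
  and exchanging the first for the second lowers \<open>u\<^sub>p, \<dots>, u\<^bsub>q-1\<^esub>\<close> by one (lemma \<open>linear_step\<close>).
  The representative is a standard tableau for which the sum of the \<open>u\<^sub>r\<close> is least.
\<close>

section \<open>Exchange identities for minors of a matrix\<close>

text \<open>
  The determinant of the \<open>p \<times> p\<close> matrix with entry \<open>X c r\<close> in row \<open>r\<close> and column \<open>c\<close>. The matrix
  is a function of its columns, so that a column is replaced by a function update.
\<close>

definition coldet :: "nat \<Rightarrow> (nat \<Rightarrow> nat \<Rightarrow> 'a::comm_ring_1) \<Rightarrow> 'a" where
  "coldet p X = det (mat p p (\<lambda>(r, c). X c r))"

lemma coldet_cong: "(\<And>c r. c < p \<Longrightarrow> r < p \<Longrightarrow> X c r = Y c r) \<Longrightarrow> coldet p X = coldet p Y"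
  unfolding coldet_def by (rule arg_cong[of _ _ det]) (auto intro!: cong_mat)

text \<open>
  Expansion along column \<open>k\<close>; the cofactors do not depend on that column, which gives linearity.
\<close>

lemma coldet_update:
  assumes "k < p"
  shows "coldet p (X(k := z)) = (\<Sum>r<p. z r * cofactor (mat p p (\<lambda>(r, c). X c r)) r k)"
proof -
  let ?B = "mat p p (\<lambda>(r, c). (X(k := z)) c r)" and ?A = "mat p p (\<lambda>(r, c). X c r)"
  have "cofactor ?B r k = cofactor ?A r k" if "r < p" for r
  proof -
    have "mat_delete ?B r k = mat_delete ?A r k"
      using that assms by (intro eq_matI) (auto simp: mat_delete_def)
    then show ?thesis by (simp add: cofactor_def)
  qed
  then show ?thesis
    unfolding coldet_def
    by (subst laplace_expansion_column[of _ p k]) (use assms in auto)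
qed

lemma coldet_identical:
  assumes "i < p" "j < p" "i \<noteq> j" "X i = X j"
  shows "coldet p X = 0"
  unfolding coldet_def
  by (rule det_identical_columns[of _ p i j]) (use assms in \<open>auto intro!: eq_vecI\<close>)

lemma coldet_permute:
  assumes "\<pi> permutes {0..<p}"
  shows "coldet p (\<lambda>c. X (\<pi> c)) = of_int (sign \<pi>) * coldet p X"
proof -
  let ?A = "mat p p (\<lambda>(r, c). X r c)"
  have tr: "coldet p Z = det (mat p p (\<lambda>(r, c). Z r c))" for Z :: "nat \<Rightarrow> nat \<Rightarrow> 'a"
  proof -
    have "mat p p (\<lambda>(r, c). Z c r) = transpose_mat (mat p p (\<lambda>(r, c). Z r c))" by auto
    then show ?thesis unfolding coldet_def by (simp add: det_transpose[of _ p])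
  qed
  have "\<pi> i < p" if "i < p" for i using permutes_in_image[OF assms, of i] that by auto
  then have "mat p p (\<lambda>(r, c). X (\<pi> r) c) = mat p p (\<lambda>(i, j). ?A $$ (\<pi> i, j))"
    by (intro eq_matI) auto
  then show ?thesis
    unfolding tr using det_permute_rows[of ?A p \<pi>] assms by simp
qed

lemma coldet_transpose:
  assumes "i < p" "j < p" "i \<noteq> j"
  shows "coldet p (\<lambda>c. X (Transposition.transpose i j c)) = - coldet p X"
  using coldet_permute[of "Transposition.transpose i j" p X] assms
  by (simp add: permutes_swap_id sign_swap_id)

text \<open>
  Cramer's rule in a form that needs no division: \<open>det X \<cdot> w\<close> is the combination of the columns of
  \<open>X\<close> whose coefficients are the determinants with one column replaced by \<open>w\<close>.
\<close>

lemma cramer_columns: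
  assumes "r < p"
  shows "coldet p X * w r = (\<Sum>i<p. coldet p (X(i := w)) * X i r)"
proof -
  let ?A = "mat p p (\<lambda>(r, c). X c r)"
  have A: "?A \<in> carrier_mat p p" by simp
  have adj: "(\<Sum>i<p. X i r * cofactor ?A r' i) = (if r' = r then coldet p X else 0)" if "r' < p" for r'
  proof -
    have "(?A * adj_mat ?A) $$ (r, r') = (\<Sum>i<p. X i r * cofactor ?A r' i)"
      using assms that by (simp add: adj_mat_def scalar_prod_def atLeast0LessThan)
    then show ?thesis
      using adj_mat(2)[OF A] assms that by (auto simp: coldet_def split: if_splits)
  qed
  have "(\<Sum>i<p. coldet p (X(i := w)) * X i r) = (\<Sum>i<p. \<Sum>r'<p. w r' * (X i r * cofactor ?A r' i))"
    by (intro sum.cong refl) (simp add: coldet_update sum_distrib_left mult_ac)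
  also have "\<dots> = (\<Sum>r'<p. w r' * (\<Sum>i<p. X i r * cofactor ?A r' i))"
    by (subst sum.swap) (simp add: sum_distrib_left)
  also have "\<dots> = (\<Sum>r'<p. if r' = r then w r' * coldet p X else 0)"
    by (intro sum.cong refl) (simp add: adj)
  also have "\<dots> = coldet p X * w r"
    using assms by (simp add: mult.commute)
  finally show ?thesis ..
qed

text \<open>
  Insert Cramer's rule for \<open>w\<close> into column \<open>k\<close> of the second determinant.
\<close>

lemma exchange_one_column:
  assumes "k < p"
  shows "coldet p X * coldet p (Z(k := w)) = (\<Sum>i<p. coldet p (X(i := w)) * coldet p (Z(k := X i)))"
proof -
  let ?c = "\<lambda>r. cofactor (mat p p (\<lambda>(r, c). Z c r)) r k"
  have "coldet p X * coldet p (Z(k := w)) = (\<Sum>r<p. coldet p X * w r * ?c r)"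
    unfolding coldet_update[OF assms] sum_distrib_left mult.assoc by (rule refl)
  also have "\<dots> = (\<Sum>r<p. \<Sum>i<p. coldet p (X(i := w)) * X i r * ?c r)"
  proof (intro sum.cong refl)
    fix r assume "r \<in> {..<p}"
    then show "coldet p X * w r * ?c r = (\<Sum>i<p. coldet p (X(i := w)) * X i r * ?c r)"
      using cramer_columns[of r p X w] by (simp add: sum_distrib_right)
  qed
  also have "\<dots> = (\<Sum>i<p. coldet p (X(i := w)) * (\<Sum>r<p. X i r * ?c r))"
    by (subst sum.swap) (simp add: sum_distrib_left mult.assoc)
  finally show ?thesis by (simp add: coldet_update[OF assms])
qed

text \<open>
  The position of \<open>c\<close> in a list \<open>l\<close> without repetitions that contains \<open>c\<close>.
\<close>

definition list_index :: "'b list \<Rightarrow> 'b \<Rightarrow> nat" where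
  "list_index l c = (THE i. i < length l \<and> l ! i = c)"

lemma list_index_nth: "distinct l \<Longrightarrow> i < length l \<Longrightarrow> list_index l (l ! i) = i"
  unfolding list_index_def by (rule the_equality) (auto simp: nth_eq_iff_index_eq)

text \<open>
  The exchange of columns at the positions \<open>l\<close>: \<open>col_in\<close> is \<open>X\<close> with its columns
  \<open>l ! 0, l ! 1, \<dots>\<close> replaced by the first columns of \<open>w\<close>, and \<open>col_out\<close> is \<open>w\<close> with its first columns
  replaced by those columns of \<open>X\<close>.
\<close>

definition col_in :: "(nat \<Rightarrow> 'b) \<Rightarrow> (nat \<Rightarrow> 'b) \<Rightarrow> nat list \<Rightarrow> nat \<Rightarrow> 'b" where
  "col_in X w l = (\<lambda>c. if c \<in> set l then w (list_index l c) else X c)"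

definition col_out :: "(nat \<Rightarrow> 'b) \<Rightarrow> (nat \<Rightarrow> 'b) \<Rightarrow> nat list \<Rightarrow> nat \<Rightarrow> 'b" where
  "col_out X w l = (\<lambda>c. if c < length l then X (l ! c) else w c)"

text \<open>
  The sequences of \<open>k\<close> distinct positions below \<open>p\<close>, in any order.
\<close>

definition positions :: "nat \<Rightarrow> nat \<Rightarrow> nat list set" where
  "positions p k = {l. set l \<subseteq> {..<p} \<and> length l = k \<and> distinct l}"

lemma finite_positions: "finite (positions p k)"
  unfolding positions_def
  by (rule finite_subset[OF _ finite_lists_length_eq[of "{..<p}" k]]) auto

lemma positions_Suc:
  "positions p (Suc k) = (\<lambda>(l, i). l @ [i]) ` (SIGMA l:positions p k. {..<p} - set l)"
proof (intro equalityI subsetI)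
  fix l assume l: "l \<in> positions p (Suc k)"
  then have "l = butlast l @ [last l]" by (cases l rule: rev_cases) (auto simp: positions_def)
  moreover have "butlast l \<in> positions p k" "last l \<in> {..<p} - set (butlast l)"
    using l by (cases l rule: rev_cases; auto simp: positions_def)+
  ultimately show "l \<in> (\<lambda>(l, i). l @ [i]) ` (SIGMA l:positions p k. {..<p} - set l)"
    by (intro image_eqI[of _ _ "(butlast l, last l)"]) auto
qed (auto simp: positions_def)

lemma col_in_nth: "distinct l \<Longrightarrow> i < length l \<Longrightarrow> col_in X w l (l ! i) = w i"
  by (simp add: col_in_def list_index_nth)

lemma col_in_notin: "c \<notin> set l \<Longrightarrow> col_in X w l c = X c"
  by (simp add: col_in_def)

lemma col_in_snoc:
  assumes "distinct l" "i \<notin> set l"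
  shows "col_in X w (l @ [i]) = (col_in X w l)(i := w (length l))"
proof
  fix c
  have d: "distinct (l @ [i])" using assms by simp
  consider "c = i" | j where "j < length l" "c = l ! j" | "c \<notin> set (l @ [i])"
    by (auto simp: in_set_conv_nth)
  then show "col_in X w (l @ [i]) c = ((col_in X w l)(i := w (length l))) c"
  proof cases
    case 1
    then show ?thesis using col_in_nth[OF d, of "length l" X w] by simp
  next
    case 2
    then have "c \<noteq> i" using assms by auto
    with 2 show ?thesis
      using col_in_nth[OF d, of j X w] col_in_nth[OF assms(1), of j X w] by (simp add: nth_append)
  next
    case 3
    then show ?thesis by (simp add: col_in_notin)
  qed
qed

lemma col_out_snoc: "col_out X w (l @ [i]) = (col_out X w l)(length l := X i)"
  by (auto simp: col_out_def nth_append fun_eq_iff)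

text \<open>
  The exchange identity for square matrices of equal size, summed over all ordered choices of
  positions. In the induction step the column \<open>w k\<close> is exchanged with every column of the first
  matrix. A column that is still a column of \<open>X\<close> yields a term of the sum for \<open>Suc k\<close>. A column that
  came from \<open>w j\<close> yields the term of the sum for \<open>k\<close> with \<open>w j\<close> and \<open>w k\<close> interchanged, and by the
  induction hypothesis each of the \<open>k\<close> values of \<open>j\<close> contributes the negative of the sum for \<open>k\<close>.
\<close>

lemma exchange_positions:
  fixes X w :: "nat \<Rightarrow> nat \<Rightarrow> 'a::comm_ring_1"
  assumes "k \<le> p"
  shows "(\<Sum>l\<in>positions p k. coldet p (col_in X w l) * coldet p (col_out X w l))
       = of_nat (fact k) * (coldet p X * coldet p w)"
  using assms
proof (induction k arbitrary: w)
  case 0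
  have "positions p 0 = {[]}" by (auto simp: positions_def)
  then show ?case by (simp add: col_in_def col_out_def)
next
  case (Suc k)
  let ?P = "positions p k"
  let ?t = "\<lambda>w l. coldet p (col_in X w l) * coldet p (col_out X w l)"
  let ?s = "\<lambda>l i. coldet p ((col_in X w l)(i := w k)) * coldet p ((col_out X w l)(k := col_in X w l i))"
  let ?w = "\<lambda>j. w \<circ> Transposition.transpose j k"
  have D: "distinct l" "length l = k" "set l \<subseteq> {..<p}" if "l \<in> ?P" for l
    using that by (auto simp: positions_def)
  \<comment> \<open>the position \<open>i\<close> receiving \<open>w k\<close> is either new or one of the \<open>l ! j\<close>, where it displaces \<open>w j\<close>\<close>
  have split: "?t w l = (\<Sum>i\<in>{..<p} - set l. ?s l i) + (\<Sum>j<k. ?t (?w j) l)" if l: "l \<in> ?P" for l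
  proof -
    have "(col_out X w l)(k := w k) = col_out X w l" using D[OF l] by (auto simp: col_out_def)
    then have "?t w l = (\<Sum>i<p. ?s l i)"
      using exchange_one_column[of k p "col_in X w l" "col_out X w l" "w k"] Suc.prems by simp
    also have "\<dots> = (\<Sum>i\<in>{..<p} - set l. ?s l i) + (\<Sum>i\<in>set l. ?s l i)"
      using sum.subset_diff[of "set l" "{..<p}" "?s l"] D[OF l] by auto
    also have "(\<Sum>i\<in>set l. ?s l i) = (\<Sum>j<k. ?s l (l ! j))"
      using bij_betw_nth[OF D(1)[OF l], of "{..<k}" "set l"] D[OF l] by (intro sum.reindex_bij_betw[symmetric]) auto
    also have "\<dots> = (\<Sum>j<k. ?t (?w j) l)"
    proof (intro sum.cong refl)
      fix j assume "j \<in> {..<k}"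
      then have j: "j < k" by simp
      have "(col_in X w l)(l ! j := w k) = col_in X (?w j) l"
      proof
        fix c
        consider i where "i < k" "c = l ! i" | "c \<notin> set l"
          using D[OF l] by (auto simp: in_set_conv_nth)
        then show "((col_in X w l)(l ! j := w k)) c = col_in X (?w j) l c"
          using j D[OF l]
          by cases (auto simp: col_in_nth col_in_notin nth_eq_iff_index_eq transpose_def)
      qed
      moreover have "(col_out X w l)(k := col_in X w l (l ! j)) = col_out X (?w j) l"
        using j D[OF l] by (auto simp: col_in_nth col_out_def transpose_def fun_eq_iff)
      ultimately show "?s l (l ! j) = ?t (?w j) l" by simp
    qed
    finally show ?thesis .
  qed
  have IH: "(\<Sum>l\<in>?P. ?t (?w j) l) = - (of_nat (fact k) * (coldet p X * coldet p w))" if "j < k" for j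
  proof -
    have "coldet p (?w j) = - coldet p w"
      using coldet_transpose[of j p k w] that Suc.prems by (simp add: comp_def)
    then show ?thesis using Suc.IH[of "?w j"] Suc.prems by (simp add: comp_def)
  qed
  have "inj_on (\<lambda>(l, i). l @ [i]) (SIGMA l:?P. {..<p} - set l)" by (auto simp: inj_on_def)
  then have "(\<Sum>l\<in>positions p (Suc k). ?t w l)
      = (\<Sum>(l, i)\<in>(SIGMA l:?P. {..<p} - set l). ?t w (l @ [i]))"
    unfolding positions_Suc by (subst sum.reindex) (auto simp: case_prod_unfold)
  also have "\<dots> = (\<Sum>l\<in>?P. \<Sum>i\<in>{..<p} - set l. ?t w (l @ [i]))"
    by (subst sum.Sigma) (auto simp: finite_positions)
  also have "\<dots> = (\<Sum>l\<in>?P. \<Sum>i\<in>{..<p} - set l. ?s l i)"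
    by (intro sum.cong refl) (auto simp: col_in_snoc col_out_snoc D col_in_notin)
  also have "\<dots> = (\<Sum>l\<in>?P. ?t w l) - (\<Sum>l\<in>?P. \<Sum>j<k. ?t (?w j) l)"
    using split by (simp flip: sum_subtractf)
  also have "(\<Sum>l\<in>?P. \<Sum>j<k. ?t (?w j) l) = (\<Sum>j<k. \<Sum>l\<in>?P. ?t (?w j) l)"
    by (rule sum.swap)
  also have "\<dots> = - of_nat k * (of_nat (fact k) * (coldet p X * coldet p w))"
    by (simp add: IH)
  also have "(\<Sum>l\<in>?P. ?t w l) = of_nat (fact k) * (coldet p X * coldet p w)"
    using Suc by simp
  finally show ?case by (simp add: algebra_simps)
qed

text \<open>
  Interchanging two of the chosen positions interchanges two columns in each of the two matrices, so
  the product of the determinants does not change.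
\<close>

lemma exchange_term_map_transpose:
  fixes X w :: "nat \<Rightarrow> nat \<Rightarrow> 'a::comm_ring_1"
  assumes l: "distinct l" "set l \<subseteq> {..<p}" "length l \<le> p" and x: "x \<in> set l" "y \<in> set l"
  defines "l' \<equiv> map (Transposition.transpose x y) l"
  shows "coldet p (col_in X w l') * coldet p (col_out X w l')
       = coldet p (col_in X w l) * coldet p (col_out X w l)"
proof (cases "x = y")
  case True
  then show ?thesis by (simp add: l'_def)
next
  case False
  obtain i j where ij: "i < length l" "l ! i = x" "j < length l" "l ! j = y"
    using x by (auto simp: in_set_conv_nth)
  have ne: "i \<noteq> j" using False ij by auto
  have d': "distinct l'" unfolding l'_def using l(1) by (simp add: distinct_map)
  have in_swap: "col_in X w l' = (\<lambda>c. col_in X w l (Transposition.transpose x y c))"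
  proof
    fix c
    let ?c = "Transposition.transpose x y c"
    show "col_in X w l' c = col_in X w l ?c"
    proof (cases "c \<in> set l'")
      case True
      then obtain m where m: "m < length l" "c = l' ! m" by (auto simp: in_set_conv_nth l'_def)
      then have "?c = l ! m" by (simp add: l'_def)
      then show ?thesis using m col_in_nth[OF d', of m X w] col_in_nth[OF l(1), of m X w]
        by (simp add: l'_def)
    next
      case False
      moreover have "set l' = set l"
        unfolding l'_def using x by (auto simp: transpose_def image_iff)
      ultimately have "c \<noteq> x" "c \<noteq> y" "c \<notin> set l" using x by auto
      then show ?thesis using False by (simp add: col_in_notin)
    qed
  qed
  have out_swap: "col_out X w l' = (\<lambda>c. col_out X w l (Transposition.transpose i j c))"
    using ij l(1) by (auto simp: fun_eq_iff col_out_def l'_def transpose_def nth_eq_iff_index_eq)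
  have "x < p" "y < p" "i < p" "j < p" using l x ij by auto
  then show ?thesis
    using coldet_transpose[of x p y "col_in X w l"] coldet_transpose[of i p j "col_out X w l"] False ne
    by (simp add: in_swap out_swap)
qed

lemma exchange_term_permuted:
  fixes X w :: "nat \<Rightarrow> nat \<Rightarrow> 'a::comm_ring_1"
  assumes "distinct l" "set l \<subseteq> {..<p}" "length l \<le> p" "\<pi> permutes set l"
  shows "coldet p (col_in X w (map \<pi> l)) * coldet p (col_out X w (map \<pi> l))
       = coldet p (col_in X w l) * coldet p (col_out X w l)"
  using assms(4) finite_set[of l]
proof (induction rule: permutes_induct)
  case id
  then show ?case by simp
next
  case (swap a b \<pi>)
  then show ?case
    using exchange_term_map_transpose[of "map \<pi> l" p a b X w] assms
    by (simp add: permutes_image permutes_inj_on distinct_map comp_def)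
qed

text \<open>
  The elements of \<open>S\<close> below \<open>p\<close>, in increasing order.
\<close>

definition increasing_list :: "nat \<Rightarrow> nat set \<Rightarrow> nat list" where
  "increasing_list p S = filter (\<lambda>i. i \<in> S) [0..<p]"

lemma increasing_list:
  assumes "S \<subseteq> {..<p}"
  shows "set (increasing_list p S) = S" "distinct (increasing_list p S)"
    "sorted_wrt (<) (increasing_list p S)" "length (increasing_list p S) = card S"
proof -
  show 1: "set (increasing_list p S) = S" "distinct (increasing_list p S)"
    "sorted_wrt (<) (increasing_list p S)"
    using assms by (auto simp: increasing_list_def sorted_wrt_filter)
  show "length (increasing_list p S) = card S" using distinct_card[OF 1(2)] 1(1) by simp
qed

lemma distinct_same_set_permutes:
  assumes "distinct l" "distinct e" "set l = set e"
  obtains \<pi> where "\<pi> permutes set e" "l = map \<pi> e"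
proof -
  have len: "length l = length e" using assms by (metis distinct_card)
  define \<pi> where "\<pi> = (\<lambda>x. if x \<in> set e then l ! list_index e x else x)"
  have nth: "\<pi> (e ! i) = l ! i" if "i < length e" for i
    using that assms by (simp add: \<pi>_def list_index_nth)
  have m: "l = map \<pi> e" by (rule nth_equalityI) (auto simp: len nth)
  have "\<pi> permutes set e"
  proof (rule bij_imp_permutes)
    have "inj_on \<pi> (set e)" using assms(1) m by (simp add: distinct_map)
    moreover have "\<pi> ` set e = set e" using m assms(3) by (metis set_map)
    ultimately show "bij_betw \<pi> (set e) (set e)" by (simp add: bij_betw_def)
  qed (simp add: \<pi>_def)
  then show ?thesis using m by (rule that)
qed

text \<open>
  Each set of \<open>k\<close> positions arises from \<open>fact k\<close> sequences of positions, all with the same term.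
\<close>

lemma exchange_subsets_fact:
  fixes X w :: "nat \<Rightarrow> nat \<Rightarrow> 'a::comm_ring_1"
  assumes "k \<le> p"
  shows "of_nat (fact k) * (\<Sum>S | S \<subseteq> {..<p} \<and> card S = k.
            coldet p (col_in X w (increasing_list p S)) * coldet p (col_out X w (increasing_list p S)))
       = of_nat (fact k) * (coldet p X * coldet p w)"
proof -
  let ?t = "\<lambda>l. coldet p (col_in X w l) * coldet p (col_out X w l)"
  let ?F = "{S. S \<subseteq> {..<p} \<and> card S = k}"
  have fin: "finite ?F" by simp
  have "(\<Sum>l\<in>positions p k. ?t l) = (\<Sum>S\<in>?F. \<Sum>l | l \<in> positions p k \<and> set l = S. ?t l)"
    by (rule sum.group[symmetric]) (use finite_positions[of p k] fin in \<open>auto simp: positions_def distinct_card\<close>)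
  also have "\<dots> = (\<Sum>S\<in>?F. of_nat (fact k) * ?t (increasing_list p S))"
  proof (intro sum.cong refl)
    fix S assume "S \<in> ?F"
    then have S: "S \<subseteq> {..<p}" "card S = k" "finite S" by (auto intro: finite_subset)
    have eq: "{l. l \<in> positions p k \<and> set l = S} = {l. set l = S \<and> length l = card S \<and> distinct l}"
      using S by (auto simp: positions_def)
    have "?t l = ?t (increasing_list p S)" if l: "set l = S" "distinct l" for l
    proof -
      obtain \<pi> where "\<pi> permutes set (increasing_list p S)" "l = map \<pi> (increasing_list p S)"
        by (rule distinct_same_set_permutes[of l "increasing_list p S"]) (use increasing_list[OF S(1)] l in auto)
      then show ?thesis
        using exchange_term_permuted[of "increasing_list p S" p \<pi> X w] increasing_list[OF S(1)] S assms by simp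
    qed
    moreover have "card {l. set l = S \<and> length l = card S \<and> distinct l} = fact k"
    proof -
      have "{l. set l = S \<and> length l = card S \<and> distinct l}
          = {l. length l = card S \<and> distinct l \<and> set l \<subseteq> S}"
        using S(3) card_subset_eq[of S] by (auto simp: distinct_card) (metis distinct_card)
      then show ?thesis
        using card_lists_distinct_length_eq[of S "card S"] S by (simp add: fact_prod)
    qed
    ultimately show "(\<Sum>l | l \<in> positions p k \<and> set l = S. ?t l) = of_nat (fact k) * ?t (increasing_list p S)"
      unfolding eq by simp
  qed
  finally show ?thesis
    using exchange_positions[OF assms, of X w] by (simp add: sum_distrib_left)
qed

text \<open>
  The first \<open>q\<close> columns of \<open>Z\<close>, continued by unit vectors: this turns a minor on the first \<open>q\<close> rows
  into a determinant of any larger size.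
\<close>

definition pad_columns :: "nat \<Rightarrow> (nat \<Rightarrow> nat \<Rightarrow> 'a) \<Rightarrow> nat \<Rightarrow> nat \<Rightarrow> 'a::comm_ring_1" where
  "pad_columns q Z = (\<lambda>c. if c < q then Z c else (\<lambda>r. if r = c then 1 else 0))"

lemma coldet_pad:
  assumes "q \<le> p"
  shows "coldet p (pad_columns q Z) = coldet q Z"
  using assms
proof (induction p rule: dec_induct)
  case base
  show ?case by (rule coldet_cong) (simp add: pad_columns_def)
next
  case (step p)
  let ?A = "mat (Suc p) (Suc p) (\<lambda>(r, c). pad_columns q Z c r)"
  have "coldet (Suc p) (pad_columns q Z) = (\<Sum>r<Suc p. ?A $$ (r, p) * cofactor ?A r p)"
    unfolding coldet_def by (rule laplace_expansion_column) auto
  also have "\<dots> = cofactor ?A p p"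
    using step.hyps by (simp add: pad_columns_def)
  also have "\<dots> = det (mat_delete ?A p p)" by (simp add: cofactor_def power_add flip: power_mult_distrib)
  also have "mat_delete ?A p p = mat p p (\<lambda>(r, c). pad_columns q Z c r)"
    by (rule eq_matI) (auto simp: mat_delete_def)
  finally show ?case using step.IH by (simp add: coldet_def)
qed

text \<open>
  The exchange identity for the minors on the first \<open>p\<close> rows of \<open>X\<close> and on the first \<open>q \<le> p\<close> rows of
  \<open>w\<close>. The factor \<open>fact k\<close> must be cancelled, hence the inverse \<open>u\<close>.
\<close>

lemma exchange_subsets:
  fixes X w :: "nat \<Rightarrow> nat \<Rightarrow> 'a::comm_ring_1" and u :: 'a
  assumes "k \<le> q" "q \<le> p" and inv: "u * of_nat (fact k) = 1"
  shows "coldet p X * coldet q w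
       = (\<Sum>S | S \<subseteq> {..<p} \<and> card S = k.
            coldet p (col_in X w (increasing_list p S)) * coldet q (col_out X w (increasing_list p S)))"
proof -
  let ?w = "pad_columns q w"
  have terms: "coldet p (col_in X ?w e) = coldet p (col_in X w e)"
    "coldet p (col_out X ?w e) = coldet q (col_out X w e)"
    if "distinct e" "length e = k" for e
  proof -
    have "col_in X ?w e c = col_in X w e c" for c
    proof (cases "c \<in> set e")
      case True
      then obtain i where "i < length e" "c = e ! i" by (auto simp: in_set_conv_nth)
      then show ?thesis using that assms(1) by (simp add: col_in_nth pad_columns_def)
    qed (simp add: col_in_notin)
    then show "coldet p (col_in X ?w e) = coldet p (col_in X w e)" by presburger
    have "col_out X ?w e = pad_columns q (col_out X w e)"
      using that assms(1) by (auto simp: col_out_def pad_columns_def fun_eq_iff)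
    then show "coldet p (col_out X ?w e) = coldet q (col_out X w e)"
      using coldet_pad[OF assms(2)] by simp
  qed
  let ?s = "\<lambda>w q. \<Sum>S | S \<subseteq> {..<p} \<and> card S = k.
      coldet p (col_in X w (increasing_list p S)) * coldet q (col_out X w (increasing_list p S))"
  have "?s ?w p = ?s w q"
    by (intro sum.cong refl) (simp add: terms increasing_list)
  moreover have "of_nat (fact k) * ?s ?w p = of_nat (fact k) * (coldet p X * coldet p ?w)"
    using assms by (intro exchange_subsets_fact) simp
  ultimately have eq: "of_nat (fact k) * ?s w q = of_nat (fact k) * (coldet p X * coldet q w)"
    by (simp only: coldet_pad[OF assms(2), of w])
  have "x = y" if "of_nat (fact k) * x = of_nat (fact k) * y" for x y :: 'a
    using arg_cong[OF that, of "\<lambda>z. u * z"] inv by (simp flip: mult.assoc)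
  from this[OF eq] show ?thesis by (rule sym)
qed

section \<open>The generators lie in the kernel\<close>

lemma Psi_add: "Psi n a (p + q) = Psi n a p + Psi n a q"
  and Psi_mult: "Psi n a (p * q) = Psi n a p * Psi n a q"
  and Psi_zero: "Psi n a 0 = 0"
  and Psi_sum: "Psi n a (sum f A) = (\<Sum>i\<in>A. Psi n a (f i))"
  by (simp_all add: Psi_def subst_poly_add subst_poly_mult subst_poly_0 subst_poly_sum)

lemma Psi_one: "Psi n a 1 = 1"
  using Psi_const[of n a 1] by (simp add: const_1)

lemma Psi_uminus: "Psi n a (- p) = - Psi n a p"
  using Psi_add[of n a p "- p"] by (simp add: Psi_zero eq_neg_iff_add_eq_0 add.commute)

lemma Psi_diff: "Psi n a (p - q) = Psi n a p - Psi n a q"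
  using Psi_add[of n a p "- q"] by (simp add: Psi_uminus)

lemma Psi_power: "Psi n a (p ^ k) = Psi n a p ^ k"
  by (induction k) (simp_all add: Psi_one Psi_mult)

text \<open>
  Column \<open>j\<close> of the matrix \<open>Y\<close>, with rows counted from \<open>0\<close>; the variables \<open>y\<^sub>i\<^sub>j\<close> are indexed from \<open>1\<close>.
\<close>

definition ycol :: "nat \<Rightarrow> nat \<Rightarrow> nat \<Rightarrow> target_poly" where
  "ycol n j r = (if j = 0 then - (\<Sum>l=1..n. yvar (r + 1) l) else yvar (r + 1) j)"

text \<open>
  The top-justified minor of \<open>Y\<close> on the listed columns, in the listed order.
\<close>

definition minor :: "nat \<Rightarrow> nat list \<Rightarrow> target_poly" where
  "minor n is = coldet (length is) (\<lambda>c. ycol n (is ! c))"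

lemma minor_nonzero_columns: "0 \<notin> set is \<Longrightarrow> minor n is = det (ymat is)"
  unfolding minor_def ymat_def coldet_def
  by (intro arg_cong[of _ _ det] cong_mat) (auto simp: ycol_def in_set_conv_nth)

lemma coldet_add_column:
  assumes "k < p"
  shows "coldet p (X(k := (\<lambda>r. \<Sum>j\<in>J. z j r))) = (\<Sum>j\<in>J. coldet p (X(k := z j)))"
  unfolding coldet_update[OF assms] sum_distrib_right by (rule sum.swap)

lemma minor_Cons_update:
  "minor n (j # js) = coldet (Suc (length js)) ((\<lambda>c. ycol n ((0 # js) ! c))(0 := ycol n j))"
  unfolding minor_def by (auto intro!: coldet_cong simp: nth_Cons')

text \<open>
  The columns of \<open>Y\<close> add up to zero.
\<close>

lemma sum_minor_Cons: "(\<Sum>j=0..n. minor n (j # js)) = 0"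
proof -
  let ?X = "\<lambda>c. ycol n ((0 # js) ! c)"
  have "(\<Sum>j=0..n. minor n (j # js)) = coldet (Suc (length js)) (?X(0 := (\<lambda>r. \<Sum>j=0..n. ycol n j r)))"
    unfolding minor_Cons_update by (rule coldet_add_column[symmetric]) simp
  also have "(\<lambda>r. \<Sum>j=0..n. ycol n j r) = (\<lambda>r. 0)"
    by (rule ext) (simp add: sum.atLeast_Suc_atMost ycol_def)
  also have "coldet (Suc (length js)) (?X(0 := (\<lambda>r. 0))) = 0"
    by (subst coldet_update) simp_all
  finally show ?thesis .
qed

lemma minor_zero_Cons: "minor n (0 # js) = - (\<Sum>j=1..n. minor n (j # js))"
  using sum_minor_Cons[where n=n and js=js] by (simp add: sum.atLeast_Suc_atMost eq_neg_iff_add_eq_0)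

lemma minor_repeated:
  assumes "\<not> distinct is"
  shows "minor n is = 0"
proof -
  obtain i j where "i < length is" "j < length is" "i \<noteq> j" "is ! i = is ! j"
    using assms by (auto simp: distinct_conv_nth)
  then show ?thesis unfolding minor_def by (intro coldet_identical[of i _ j]) auto
qed

lemma minor_swap: "minor n (us @ i # j # vs) = - minor n (us @ j # i # vs)"
proof -
  let ?k = "length us" and ?p = "length (us @ i # j # vs)"
  have "minor n (us @ i # j # vs)
      = coldet ?p (\<lambda>c. (\<lambda>c. ycol n ((us @ j # i # vs) ! c)) (Transposition.transpose ?k (Suc ?k) c))"
    unfolding minor_def
    by (intro coldet_cong arg_cong[of _ _ "\<lambda>x. ycol n x _"])
       (auto simp: transpose_def nth_append nth_Cons')
  also have "\<dots> = - minor n (us @ j # i # vs)"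
    unfolding minor_def by (subst coldet_transpose) auto
  finally show ?thesis .
qed

lemma inversions_swap_less: "j < i \<Longrightarrow> inversions (us @ j # i # vs) < inversions (us @ i # j # vs)"
  by (induction us) auto

lemma not_sorted_wrt_adjacent:
  assumes "transp R" "\<not> sorted_wrt R xs"
  obtains us x y vs where "xs = us @ x # y # vs" "\<not> R x y"
proof -
  obtain k where k: "Suc k < length xs" "\<not> R (xs ! k) (xs ! Suc k)"
    using assms by (auto simp: sorted_wrt_iff_nth_Suc_transp)
  then have "xs = take k xs @ xs ! k # xs ! Suc k # drop (Suc (Suc k)) xs"
    by (metis Cons_nth_drop_Suc Suc_lessD append_take_drop_id)
  with k show ?thesis using that[of "take k xs"] by auto
qed

lemma not_increasing_adjacent:
  fixes xs :: "nat list"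
  assumes "\<not> sorted_wrt (<) xs"
  obtains us i j vs where "xs = us @ i # j # vs" "j \<le> i"
proof -
  have "transp ((<) :: nat \<Rightarrow> nat \<Rightarrow> bool)" by (simp add: transp_on_less)
  from not_sorted_wrt_adjacent[OF this assms] show ?thesis using that by (metis not_less)
qed

lemma Psi_bracket_increasing:
  assumes "sorted_wrt (<) is" "set is \<subseteq> {0..n}"
  shows "Psi n a (bracket is) = minor n is * (\<Prod>j\<leftarrow>is. tvar j ^ a j)"
proof -
  have d: "sorted_list_of_set (set is) = is" "distinct is"
    using assms(1) by (simp_all add: sorted_list_of_set.idem_if_sorted_distinct strict_sorted_iff)
  have t: "t_monomial a (set js) = (\<Prod>j\<leftarrow>js. tvar j ^ a j)" if "distinct js" for js
    using that by (simp add: t_monomial_def prod.distinct_set_conv_list)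
  show ?thesis
  proof (cases "0 \<in> set is")
    case False
    then have "set is \<subseteq> {1..n}" using assms(2) by (auto simp: Suc_le_eq subset_iff intro!: gr0I)
    then show ?thesis
      using assms False d by (simp add: bracket_sorted Psi_PVar t minor_nonzero_columns)
  next
    case True
    then obtain js where js: "is = 0 # js" using assms(1) by (cases "is") auto
    have s: "sorted_wrt (<) js" "0 \<notin> set js" "set js \<subseteq> {1..n}" "distinct js"
      using assms d js by (auto simp: Suc_le_eq subset_iff)
    have "sorted_list_of_set (set js) = js"
      using s by (simp add: sorted_list_of_set.idem_if_sorted_distinct strict_sorted_iff)
    then have "Psi n a (bracket is) = - (\<Sum>j=1..n. det (ymat (j # js)) * tvar 0 ^ a 0 * t_monomial a (set js))"
      using s js assms(1) by (simp add: bracket_sorted Psi_PVar0)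
    also have "\<dots> = - (\<Sum>j=1..n. minor n (j # js)) * (tvar 0 ^ a 0 * (\<Prod>j\<leftarrow>js. tvar j ^ a j))"
      using s by (simp add: minor_nonzero_columns t sum_distrib_right mult.assoc)
    finally show ?thesis by (simp only: js minor_zero_Cons) simp
  qed
qed

text \<open>
  Both sides change sign when two neighbouring subscripts are interchanged, so the general case
  follows from that of increasing subscripts, which is the definition of the homomorphism.
\<close>

lemma Psi_bracket:
  assumes "set is \<subseteq> {0..n}"
  shows "Psi n a (bracket is) = minor n is * (\<Prod>j\<leftarrow>is. tvar j ^ a j)"
  using assms
proof (induction "inversions is" arbitrary: "is" rule: less_induct)
  case less
  consider "sorted_wrt (<) is" | "\<not> distinct is" | "\<not> sorted_wrt (<) is" "distinct is" by blast
  then show ?case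
  proof cases
    case 1
    then show ?thesis using less.prems by (rule Psi_bracket_increasing)
  next
    case 2
    then show ?thesis by (simp add: bracket_repeated minor_repeated Psi_zero)
  next
    case 3
    then obtain us i j vs where "is": "is = us @ i # j # vs" "j \<le> i"
      using not_increasing_adjacent by blast
    with 3 have "j < i" by auto
    then have "Psi n a (bracket (us @ j # i # vs))
        = minor n (us @ j # i # vs) * (\<Prod>j\<leftarrow>us @ j # i # vs. tvar j ^ a j)"
      using less.prems "is" inversions_swap_less by (intro less.hyps) auto
    then show ?thesis
      unfolding "is" by (subst bracket_swap, subst minor_swap) (simp add: Psi_uminus mult_ac)
  qed
qed

lemma Psi_linear_relation:
  assumes "\<tau> \<subseteq> {0..n}"
  shows "Psi n a (\<Sum>j\<in>{0..n} - \<tau>. var (XVar j) ^ a j * bracket (j # sorted_list_of_set \<tau>)) = 0"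
proof -
  let ?s = "sorted_list_of_set \<tau>"
  have fin: "finite \<tau>" using assms finite_subset by blast
  have inv: "tvar_inv j ^ a j * tvar j ^ a j = 1" for j
    by (metis tvar_inv mult.commute power_mult_distrib power_one)
  have cancel: "tvar_inv j ^ a j * (x * (tvar j ^ a j * y)) = x * y" for j x y
  proof -
    have "tvar_inv j ^ a j * (x * (tvar j ^ a j * y)) = tvar_inv j ^ a j * tvar j ^ a j * (x * y)"
      by (simp only: mult_ac)
    then show ?thesis by (simp add: inv)
  qed
  have "Psi n a (\<Sum>j\<in>{0..n} - \<tau>. var (XVar j) ^ a j * bracket (j # ?s))
      = (\<Sum>j\<in>{0..n} - \<tau>. minor n (j # ?s) * (\<Prod>j\<leftarrow>?s. tvar j ^ a j))"
    unfolding Psi_sum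
  proof (intro sum.cong refl)
    fix j assume "j \<in> {0..n} - \<tau>"
    then have "set (j # ?s) \<subseteq> {0..n}" using assms fin by auto
    then show "Psi n a (var (XVar j) ^ a j * bracket (j # ?s)) = minor n (j # ?s) * (\<Prod>j\<leftarrow>?s. tvar j ^ a j)"
      by (simp only: Psi_mult Psi_power Psi_XVar Psi_bracket list.map prod_list.Cons cancel)
  qed
  also have "\<dots> = (\<Sum>j=0..n. minor n (j # ?s) * (\<Prod>j\<leftarrow>?s. tvar j ^ a j))"
    using assms fin by (intro sum.mono_neutral_left) (auto simp: minor_repeated)
  also have "\<dots> = 0" unfolding sum_distrib_right[symmetric] sum_minor_Cons by simp
  finally show ?thesis .
qed

lemma nths_conv_increasing_list: "nths xs S = map ((!) xs) (increasing_list (length xs) S)"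
proof -
  have "zip xs [0..<length xs] = map (\<lambda>i. (xs ! i, i)) [0..<length xs]"
    by (rule nth_equalityI) auto
  then show ?thesis
    unfolding nths_def increasing_list_def by (simp add: filter_map comp_def)
qed

lemma list_index_increasing_list:
  assumes "S \<subseteq> {..<p}" "c \<in> S"
  shows "list_index (increasing_list p S) c = card {s \<in> S. s < c}"
proof -
  let ?e = "increasing_list p S"
  note e = increasing_list[OF assms(1)]
  obtain i where i: "i < length ?e" "c = ?e ! i" using assms(2) e(1) by (metis in_set_conv_nth)
  have mono: "?e ! j < ?e ! i \<longleftrightarrow> j < i" if "j < length ?e" for j
    using sorted_wrt_nth_less[OF e(3)] i that by (metis less_asym less_irrefl linorder_neqE_nat)
  have "{s \<in> S. s < c} = (!) ?e ` {..<i}"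
  proof (intro equalityI subsetI)
    fix s assume s: "s \<in> {s \<in> S. s < c}"
    then obtain j where j: "j < length ?e" "s = ?e ! j" using e(1) by (metis in_set_conv_nth mem_Collect_eq)
    then show "s \<in> (!) ?e ` {..<i}" using s i mono by auto
  next
    fix s assume "s \<in> (!) ?e ` {..<i}"
    then obtain j where "j < i" "s = ?e ! j" by auto
    then show "s \<in> {s \<in> S. s < c}" using i mono[of j] e(1) nth_mem[of j ?e] by auto
  qed
  moreover have "inj_on ((!) ?e) {..<i}"
    using e(2) i(1) by (auto simp: inj_on_def nth_eq_iff_index_eq)
  ultimately have "card {s \<in> S. s < c} = i" by (simp add: card_image)
  then show ?thesis using list_index_nth[OF e(2) i(1)] i(2) by simp
qed

lemma exchange_lists_nth:
  assumes S: "S \<subseteq> {..<length is}" "card S = k" and k: "k \<le> length js"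
  shows "c < length is \<Longrightarrow> Y (exchange_fst S is js ! c)
      = col_in (\<lambda>c. Y (is ! c)) (\<lambda>c. Y (js ! c)) (increasing_list (length is) S) c"
    and "c < length js \<Longrightarrow> Y (exchange_snd S is js ! c)
      = col_out (\<lambda>c. Y (is ! c)) (\<lambda>c. Y (js ! c)) (increasing_list (length is) S) c"
proof -
  note e = increasing_list[OF S(1)]
  show "Y (exchange_fst S is js ! c)
      = col_in (\<lambda>c. Y (is ! c)) (\<lambda>c. Y (js ! c)) (increasing_list (length is) S) c" if "c < length is"
    using that e list_index_increasing_list[OF S(1)] by (auto simp: exchange_fst_def col_in_def)
  show "Y (exchange_snd S is js ! c)
      = col_out (\<lambda>c. Y (is ! c)) (\<lambda>c. Y (js ! c)) (increasing_list (length is) S) c" if "c < length js"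
    using that e S k
    by (auto simp: exchange_snd_def col_out_def nths_conv_increasing_list nth_append)
qed

text \<open>
  An exchange only redistributes the subscripts; hence all terms of a Pluecker relation have the same
  monomial in the \<open>t\<^sub>j\<close>, and the same content.
\<close>

lemma mset_exchange:
  assumes S: "S \<subseteq> {..<length is}" "card S \<le> length js"
  shows "mset (exchange_fst S is js) + mset (exchange_snd S is js) = mset is + mset js"
proof -
  let ?p = "length is" and ?e = "increasing_list (length is) S" and ?rk = "\<lambda>r. card {s \<in> S. s < r}"
  note e = increasing_list[OF S(1)]
  let ?f = "\<lambda>r. if r \<in> S then js ! ?rk r else is ! r"
  have fin: "finite S" using S(1) finite_subset by blast
  have "mset (exchange_fst S is js) = image_mset ?f (mset_set {..<?p})"
    by (simp add: exchange_fst_def lessThan_atLeast0)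
  also have "mset_set {..<?p} = mset_set ({..<?p} - S) + mset_set S"
    using mset_set_Union[of "{..<?p} - S" S] S(1) fin by (simp add: Un_absorb1 Diff_disjoint Int_commute Un_commute)
  also have "image_mset ?f (mset_set ({..<?p} - S) + mset_set S)
      = image_mset ((!) is) (mset_set ({..<?p} - S)) + image_mset (\<lambda>r. js ! ?rk r) (mset_set S)"
    using fin by (auto intro!: arg_cong2[of _ _ _ _ "(+)"] image_mset_cong)
  also have "image_mset (\<lambda>r. js ! ?rk r) (mset_set S) = mset (take (card S) js)"
  proof -
    have "mset_set S = mset ?e" using e by (metis mset_set_set)
    then have "image_mset (\<lambda>r. js ! ?rk r) (mset_set S) = mset (map (\<lambda>r. js ! ?rk r) ?e)" by simp
    also have "map (\<lambda>r. js ! ?rk r) ?e = take (card S) js"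
    proof (rule nth_equalityI)
      fix i assume "i < length (map (\<lambda>r. js ! ?rk r) ?e)"
      then have i: "i < length ?e" by simp
      then have "?rk (?e ! i) = i"
        using list_index_increasing_list[OF S(1), of "?e ! i"] list_index_nth[OF e(2) i] e(1) nth_mem[OF i] by auto
      then show "map (\<lambda>r. js ! ?rk r) ?e ! i = take (card S) js ! i" using i e(4) by simp
    qed (use e(4) S(2) in simp)
    finally show ?thesis .
  qed
  finally have fst: "mset (exchange_fst S is js)
      = image_mset ((!) is) (mset_set ({..<?p} - S)) + mset (take (card S) js)" .
  have snd: "mset (exchange_snd S is js) = image_mset ((!) is) (mset_set S) + mset (drop (card S) js)"
    using e by (simp add: exchange_snd_def nths_conv_increasing_list) (metis mset_set_set)
  have "mset is = image_mset ((!) is) (mset_set {..<?p})"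
    by (metis lessThan_atLeast0 map_nth mset_map mset_upt)
  also have "mset_set {..<?p} = mset_set ({..<?p} - S) + mset_set S"
    using mset_set_Union[of "{..<?p} - S" S] S(1) fin by (simp add: Un_absorb1 Diff_disjoint Int_commute Un_commute)
  finally have "mset is = image_mset ((!) is) (mset_set ({..<?p} - S)) + image_mset ((!) is) (mset_set S)" by simp
  moreover have "mset js = mset (take (card S) js) + mset (drop (card S) js)"
    by (metis append_take_drop_id mset_append)
  ultimately show ?thesis unfolding fst snd by (simp add: ac_simps)
qed

lemma of_nat_eq_const: "(of_nat m :: 'm::comm_monoid_add \<Rightarrow>\<^sub>0 complex) = const (of_nat m)"
  by (induction m) (simp_all add: const_0 const_1 const_add)

lemma Psi_pluecker_poly:
  assumes k: "k \<le> length js" "length js \<le> length is" and sub: "set is \<subseteq> {0..n}" "set js \<subseteq> {0..n}"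
  shows "Psi n a (pluecker_poly k is js) = 0"
proof -
  let ?t = "\<lambda>l. \<Prod>j\<leftarrow>l. tvar j ^ a j :: target_poly"
  let ?F = "{S. S \<subseteq> {..<length is} \<and> card S = k}"
  let ?f = "\<lambda>S. exchange_fst S is js" and ?s = "\<lambda>S. exchange_snd S is js"
  have t: "?t l = prod_mset (image_mset (\<lambda>j. tvar j ^ a j) (mset l))" for l
    by (simp flip: prod_mset_prod_list)
  have exch: "Psi n a (bracket (?f S) * bracket (?s S)) = minor n (?f S) * minor n (?s S) * (?t is * ?t js)"
    if "S \<in> ?F" for S
  proof -
    have S: "S \<subseteq> {..<length is}" "card S \<le> length js" using that k by auto
    have "set (?f S) \<subseteq> {0..n}" "set (?s S) \<subseteq> {0..n}"
      using set_exchange_fst[OF S] set_exchange_snd[of S "is" js] sub by auto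
    moreover have "?t (?f S) * ?t (?s S) = ?t is * ?t js"
      unfolding t prod_mset_Un[symmetric] image_mset_union[symmetric] mset_exchange[OF S] by (rule refl)
    ultimately show ?thesis by (simp add: Psi_mult Psi_bracket mult_ac)
  qed
  have "const (1 / fact k) * (of_nat (fact k) :: target_poly) = 1"
    by (simp add: of_nat_eq_const const_1 flip: const_mult)
  then have "minor n is * minor n js = (\<Sum>S\<in>?F.
      coldet (length is) (col_in (\<lambda>c. ycol n (is ! c)) (\<lambda>c. ycol n (js ! c)) (increasing_list (length is) S)) *
      coldet (length js) (col_out (\<lambda>c. ycol n (is ! c)) (\<lambda>c. ycol n (js ! c)) (increasing_list (length is) S)))"
    unfolding minor_def by (rule exchange_subsets[OF k])
  also have "\<dots> = (\<Sum>S\<in>?F. minor n (?f S) * minor n (?s S))"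
  proof (intro sum.cong refl)
    fix S assume "S \<in> ?F"
    then have S: "S \<subseteq> {..<length is}" "card S = k" by auto
    then have len: "length (?s S) = length js" using k by (simp add: length_exchange_snd)
    then show "coldet (length is) (col_in (\<lambda>c. ycol n (is ! c)) (\<lambda>c. ycol n (js ! c)) (increasing_list (length is) S)) *
      coldet (length js) (col_out (\<lambda>c. ycol n (is ! c)) (\<lambda>c. ycol n (js ! c)) (increasing_list (length is) S))
      = minor n (?f S) * minor n (?s S)"
      unfolding minor_def len length_exchange_fst
      by (intro arg_cong2[of _ _ _ _ "(*)"] coldet_cong)
         (simp_all add: exchange_lists_nth[OF S k(1), of _ "ycol n"])
  qed
  finally have "minor n is * minor n js = (\<Sum>S\<in>?F. minor n (?f S) * minor n (?s S))" .
  moreover have "Psi n a (pluecker_poly k is js)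
      = minor n is * minor n js * (?t is * ?t js) - (\<Sum>S\<in>?F. minor n (?f S) * minor n (?s S) * (?t is * ?t js))"
    unfolding pluecker_poly_def Psi_diff Psi_sum
    by (intro arg_cong2[of _ _ _ _ "(-)"] sum.cong refl exch)
       (simp_all add: Psi_mult Psi_bracket sub mult_ac)
  ultimately show ?thesis by (simp add: sum_distrib_right)
qed

text \<open>
  The ideal generated by the Pluecker relations and the linear relations.
\<close>

definition rel_ideal :: "nat \<Rightarrow> (nat \<Rightarrow> nat) \<Rightarrow> cox_poly set" where
  "rel_ideal n a = genideal (source_ring n) (pluecker_relations n \<union> linear_relations n a)"

abbreviation source :: "nat \<Rightarrow> cox_poly set" where
  "source n \<equiv> carrier (source_ring n)"

lemma source_ring_ops [simp]:
  "x \<oplus>\<^bsub>source_ring n\<^esub> y = x + y" "x \<otimes>\<^bsub>source_ring n\<^esub> y = x * y" "\<zero>\<^bsub>source_ring n\<^esub> = 0"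
  by (simp_all add: source_ring_def monoid_algebra_def)

lemma relations_closed:
  "n \<ge> 2 \<Longrightarrow> pluecker_relations n \<union> linear_relations n a \<subseteq> source n"
  using pluecker_relations_closed linear_relations_closed by blast

lemma ideal_rel_ideal: "n \<ge> 2 \<Longrightarrow> ideal (rel_ideal n a) (source_ring n)"
  unfolding rel_ideal_def
  by (intro ring.genideal_ideal relations_closed cring.axioms(1) cring_source_ring)

lemma rel_ideal_subset_kernel:
  assumes "n \<ge> 2"
  shows "rel_ideal n a \<subseteq> a_kernel (source_ring n) (target_ring n) (Psi n a)"
proof -
  interpret ring_hom_ring "source_ring n" "target_ring n" "Psi n a"
    by (intro ring_hom_ringI2 cring.axioms(1) cring_source_ring cring_target_ring Psi_ring_hom assms)
  have "pluecker_relations n \<union> linear_relations n a \<subseteq> a_kernel (source_ring n) (target_ring n) (Psi n a)"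
  proof
    fix x assume x: "x \<in> pluecker_relations n \<union> linear_relations n a"
    then have "Psi n a x = 0"
      unfolding pluecker_relations_def linear_relations_def
      using Psi_pluecker_poly Psi_linear_relation by blast
    moreover have "x \<in> source n" using x relations_closed[OF assms, of a] by (rule rev_subsetD)
    ultimately show "x \<in> a_kernel (source_ring n) (target_ring n) (Psi n a)"
      unfolding a_kernel_def' by (simp add: target_ring_def monoid_algebra_def)
  qed
  then show ?thesis
    unfolding rel_ideal_def by (intro R.genideal_minimal kernel_is_ideal)
qed

section \<open>Leading terms of minors\<close>

text \<open>
  An exponent of the target ring, the exponents of the \<open>t\<^sub>j\<close> first.
\<close>

type_synonym tkey = "(nat \<Rightarrow>\<^sub>0 int) \<times> (nat \<times> nat \<Rightarrow>\<^sub>0 nat)"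

text \<open>
  The variable \<open>y\<^sub>i\<^sub>j\<close> has weight \<open>(n + 2) ^ (n - i) * (n + 1 - j)\<close>, and the \<open>t\<^sub>j\<close> have weight \<open>0\<close>. As
  \<open>n + 1 - j\<close> is a digit in base \<open>n + 2\<close>, weights of products with one factor from each of the first
  rows compare lexicographically, from the first row on.
\<close>

definition key_weight :: "nat \<Rightarrow> tkey \<Rightarrow> nat" where
  "key_weight n \<kappa> = (\<Sum>i=1..n - 1. \<Sum>j=1..n.
     Poly_Mapping.lookup (snd \<kappa>) (i, j) * ((n + 2) ^ (n - i) * (n + 1 - j)))"

lemma key_weight_add: "key_weight n (\<kappa> + \<mu>) = key_weight n \<kappa> + key_weight n \<mu>"
  by (simp add: key_weight_def lookup_add distrib_right sum.distrib)

lemma key_weight_zero: "key_weight n (e, 0) = 0"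
  by (simp add: key_weight_def)

lemma key_weight_snd: "key_weight n (e, d) = key_weight n (0, d)"
  by (simp add: key_weight_def)

text \<open>
  The monomial \<open>\<kappa>\<close> occurs in \<open>g\<close>, and all other monomials of \<open>g\<close> are strictly lighter.
\<close>

definition leads :: "nat \<Rightarrow> target_poly \<Rightarrow> tkey \<Rightarrow> bool" where
  "leads n g \<kappa> \<longleftrightarrow> (\<exists>c h. c \<noteq> 0 \<and> g = Poly_Mapping.single \<kappa> c + h \<and>
     (\<forall>k\<in>Poly_Mapping.keys h. key_weight n k < key_weight n \<kappa>))"

lemma leadsI:
  "c \<noteq> 0 \<Longrightarrow> g = Poly_Mapping.single \<kappa> c + h \<Longrightarrow>
     (\<And>k. k \<in> Poly_Mapping.keys h \<Longrightarrow> key_weight n k < key_weight n \<kappa>) \<Longrightarrow> leads n g \<kappa>"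
  unfolding leads_def by blast

lemma leads_single: "c \<noteq> 0 \<Longrightarrow> leads n (Poly_Mapping.single \<kappa> c) \<kappa>"
  by (rule leadsI[of c _ _ 0]) auto

lemma leads_one: "leads n 1 0"
  using leads_single[of 1 n 0] by simp

lemma leads_uminus: "leads n g \<kappa> \<Longrightarrow> leads n (- g) \<kappa>"
  unfolding leads_def
proof clarify
  fix c :: complex and h :: target_poly
  assume "c \<noteq> 0" "\<forall>k\<in>Poly_Mapping.keys h. key_weight n k < key_weight n \<kappa>"
  then show "\<exists>c' (h' :: target_poly). c' \<noteq> 0 \<and> - (Poly_Mapping.single \<kappa> c + h) = Poly_Mapping.single \<kappa> c' + h' \<and>
     (\<forall>k\<in>Poly_Mapping.keys h'. key_weight n k < key_weight n \<kappa>)"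
    by (intro exI[of _ "- c"] exI[of _ "- h"]) (auto simp: keys_uminus_eq single_uminus)
qed

lemma leads_add_lower:
  assumes "leads n g \<kappa>" "\<And>k. k \<in> Poly_Mapping.keys h \<Longrightarrow> key_weight n k < key_weight n \<kappa>"
  shows "leads n (g + h) \<kappa>"
proof -
  obtain c h' where *: "c \<noteq> 0" "g = Poly_Mapping.single \<kappa> c + h'"
    "\<forall>k\<in>Poly_Mapping.keys h'. key_weight n k < key_weight n \<kappa>"
    using assms(1) unfolding leads_def by blast
  have "key_weight n k < key_weight n \<kappa>" if "k \<in> Poly_Mapping.keys (h' + h)" for k
    using that * assms(2) Poly_Mapping.keys_add[of h' h] by blast
  then show ?thesis using * by (intro leadsI[of c _ _ "h' + h"]) (auto simp: add.assoc)
qed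

lemma leads_lookup: "leads n g \<kappa> \<Longrightarrow> Poly_Mapping.lookup g \<kappa> \<noteq> 0"
  unfolding leads_def by (auto simp: lookup_add in_keys_iff)

lemma leads_keys:
  assumes "leads n g \<kappa>" "k \<in> Poly_Mapping.keys g"
  shows "k = \<kappa> \<or> key_weight n k < key_weight n \<kappa>"
proof -
  obtain c h where "g = Poly_Mapping.single \<kappa> c + h"
    "\<forall>k\<in>Poly_Mapping.keys h. key_weight n k < key_weight n \<kappa>"
    using assms(1) unfolding leads_def by blast
  then show ?thesis
    using assms(2) Poly_Mapping.keys_add[of "Poly_Mapping.single \<kappa> c" h] by (auto split: if_splits)
qed

lemma leads_keys_le: "leads n g \<kappa> \<Longrightarrow> k \<in> Poly_Mapping.keys g \<Longrightarrow> key_weight n k \<le> key_weight n \<kappa>"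
  using leads_keys by fastforce

lemma leads_mult:
  assumes "leads n g \<kappa>" "leads n h \<mu>"
  shows "leads n (g * h) (\<kappa> + \<mu>)"
proof -
  obtain c g' where g: "c \<noteq> 0" "g = Poly_Mapping.single \<kappa> c + g'"
    "\<forall>k\<in>Poly_Mapping.keys g'. key_weight n k < key_weight n \<kappa>"
    using assms(1) unfolding leads_def by blast
  obtain d h' where h: "d \<noteq> 0" "h = Poly_Mapping.single \<mu> d + h'"
    "\<forall>k\<in>Poly_Mapping.keys h'. key_weight n k < key_weight n \<mu>"
    using assms(2) unfolding leads_def by blast
  let ?r = "Poly_Mapping.single \<kappa> c * h' + g' * h"
  have "key_weight n k < key_weight n (\<kappa> + \<mu>)" if k: "k \<in> Poly_Mapping.keys ?r" for k
  proof -
    consider "k \<in> Poly_Mapping.keys (Poly_Mapping.single \<kappa> c * h')" | "k \<in> Poly_Mapping.keys (g' * h)"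
      using k Poly_Mapping.keys_add[of "Poly_Mapping.single \<kappa> c * h'" "g' * h"] by blast
    then show ?thesis
    proof cases
      case 1
      then obtain x y where "x \<in> Poly_Mapping.keys (Poly_Mapping.single \<kappa> c)" "y \<in> Poly_Mapping.keys h'" "k = x + y"
        using keys_mult[of "Poly_Mapping.single \<kappa> c" h'] by blast
      then show ?thesis using h g by (auto simp: key_weight_add)
    next
      case 2
      then obtain x y where "x \<in> Poly_Mapping.keys g'" "y \<in> Poly_Mapping.keys h" "k = x + y"
        using keys_mult[of g' h] by blast
      then show ?thesis using g(3) leads_keys_le[OF assms(2), of y] by (auto simp: key_weight_add intro: add_less_le_mono)
    qed
  qed
  moreover have "g * h = Poly_Mapping.single (\<kappa> + \<mu>) (c * d) + ?r"
    unfolding g(2) h(2) by (simp add: mult_single algebra_simps)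
  ultimately show ?thesis using g(1) h(1) by (intro leadsI[of "c * d"]) auto
qed

lemma leads_prod_list:
  "(\<And>x. x \<in> set xs \<Longrightarrow> leads n (f x) (k x)) \<Longrightarrow> leads n (\<Prod>x\<leftarrow>xs. f x) (\<Sum>x\<leftarrow>xs. k x)"
  by (induction xs) (auto intro: leads_one leads_mult)

lemma leads_prod:
  "finite A \<Longrightarrow> (\<And>x. x \<in> A \<Longrightarrow> leads n (f x) (k x)) \<Longrightarrow> leads n (\<Prod>x\<in>A. f x) (\<Sum>x\<in>A. k x)"
  by (induction A rule: finite_induct) (auto intro: leads_one leads_mult)

text \<open>
  The exponent of \<open>\<Prod>r<p. y\<^bsub>r+1, f r\<^esub>\<close>.
\<close>

definition seqkey :: "nat \<Rightarrow> (nat \<Rightarrow> nat) \<Rightarrow> nat \<times> nat \<Rightarrow>\<^sub>0 nat" where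
  "seqkey p f = (\<Sum>r<p. Poly_Mapping.single (Suc r, f r) 1)"

lemma seqkey_cong: "(\<And>r. r < p \<Longrightarrow> f r = g r) \<Longrightarrow> seqkey p f = seqkey p g"
  unfolding seqkey_def by (intro sum.cong) auto

lemma key_weight_seqkey:
  assumes "p \<le> n - 1" "\<And>r. r < p \<Longrightarrow> f r \<in> {1..n}"
  shows "key_weight n (e, seqkey p f) = (\<Sum>r<p. (n + 2) ^ (n - Suc r) * (n + 1 - f r))"
  using assms
proof (induction p)
  case 0
  then show ?case by (simp add: seqkey_def key_weight_zero)
next
  case (Suc p)
  have one: "key_weight n (0, Poly_Mapping.single (Suc p, f p) 1) = (n + 2) ^ (n - Suc p) * (n + 1 - f p)"
  proof -
    let ?w = "\<lambda>i j. (n + 2) ^ (n - i) * (n + 1 - j)"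
    have "key_weight n (0, Poly_Mapping.single (Suc p, f p) 1)
        = (\<Sum>i=1..n - 1. \<Sum>j=1..n. if i = Suc p then if j = f p then ?w i j else 0 else 0)"
      unfolding key_weight_def by (intro sum.cong refl) (auto simp: lookup_single when_def)
    also have "\<dots> = (\<Sum>i=1..n - 1. if i = Suc p then ?w i (f p) else 0)"
      using Suc.prems(2)[of p] by (intro sum.cong refl) (auto simp: sum.delta)
    also have "\<dots> = ?w (Suc p) (f p)"
      using Suc.prems(1) by (simp add: sum.delta)
    finally show ?thesis .
  qed
  have "(e, seqkey (Suc p) f) = (e, seqkey p f) + (0, Poly_Mapping.single (Suc p, f p) 1)"
    by (simp add: seqkey_def)
  then have "key_weight n (e, seqkey (Suc p) f)
      = key_weight n (e, seqkey p f) + (n + 2) ^ (n - Suc p) * (n + 1 - f p)"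
    by (simp only: key_weight_add one)
  then show ?case using Suc by simp
qed

lemma digit_tail_less:
  fixes B :: nat
  assumes "m \<le> p" "p \<le> n" "\<And>r. r < p \<Longrightarrow> d r < B" "0 < B"
  shows "(\<Sum>r=m..<p. B ^ (n - Suc r) * d r) < B ^ (n - m)"
  using assms(1)
proof (induction m rule: inc_induct)
  case base
  then show ?case using assms by simp
next
  case (step m)
  have "B ^ (n - Suc m) * d m + B ^ (n - Suc m) \<le> B ^ (n - m)"
  proof -
    have "B ^ (n - m) = B ^ (n - Suc m) * B"
      using step.hyps assms(2) by (metis Suc_diff_Suc le_less_trans less_le_trans power_Suc2 order_refl)
    moreover have "B ^ (n - Suc m) * (d m + 1) \<le> B ^ (n - Suc m) * B"
      using assms(3)[of m] step.hyps by (intro mult_le_mono) auto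
    ultimately show ?thesis by simp
  qed
  moreover have "(\<Sum>r=m..<p. B ^ (n - Suc r) * d r) = B ^ (n - Suc m) * d m + (\<Sum>r=Suc m..<p. B ^ (n - Suc r) * d r)"
    using step.hyps by (simp add: sum.atLeast_Suc_lessThan)
  ultimately show ?case using step.IH by linarith
qed

text \<open>
  At the first row in which two sequences of columns differ, the smaller column wins.
\<close>

lemma seqkey_lex_less:
  assumes "p \<le> n - 1" "\<And>r. r < p \<Longrightarrow> f r \<in> {1..n}" "\<And>r. r < p \<Longrightarrow> g r \<in> {1..n}"
    and "i < p" "\<And>r. r < i \<Longrightarrow> g r = f r" "f i < g i"
  shows "key_weight n (e', seqkey p g) < key_weight n (e, seqkey p f)"
proof -
  let ?B = "n + 2"
  let ?t = "\<lambda>f r. ?B ^ (n - Suc r) * (n + 1 - f r)"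
  have split: "(\<Sum>r<p. ?t f r) = (\<Sum>r<i. ?t f r) + ?t f i + (\<Sum>r=Suc i..<p. ?t f r)" for f
  proof -
    have "sum (?t f) ({..<i} \<union> {i..<p}) = (\<Sum>r<i. ?t f r) + (\<Sum>r=i..<p. ?t f r)"
      by (rule sum.union_disjoint) auto
    moreover have "{..<i} \<union> {i..<p} = {..<p}" using assms(4) by auto
    ultimately have "(\<Sum>r<p. ?t f r) = (\<Sum>r<i. ?t f r) + (\<Sum>r=i..<p. ?t f r)" by (simp only:)
    then show ?thesis using assms(4) by (simp add: sum.atLeast_Suc_lessThan)
  qed
  have "(\<Sum>r=Suc i..<p. ?t g r) < ?B ^ (n - Suc i)"
    using assms(1,3,4) by (intro digit_tail_less) fastforce+
  moreover have "?t g i + ?B ^ (n - Suc i) \<le> ?t f i"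
  proof -
    have "n + 1 - g i + 1 \<le> n + 1 - f i" using assms(3)[OF assms(4)] assms(6) by auto
    then have "?B ^ (n - Suc i) * (n + 1 - g i + 1) \<le> ?t f i" by (intro mult_le_mono) auto
    then show ?thesis by (simp only: distrib_left mult_1_right)
  qed
  moreover have "(\<Sum>r<i. ?t g r) = (\<Sum>r<i. ?t f r)" using assms(5) by simp
  ultimately show ?thesis
    using key_weight_seqkey[of p n f e] key_weight_seqkey[of p n g e'] assms(1,2,3) split[of f] split[of g]
    by simp
qed

lemma prod_yvar: "(\<Prod>r<p. yvar (Suc r) (f r)) = Poly_Mapping.single (0, seqkey p f) 1"
proof (induction p)
  case 0
  then show ?case by (simp add: seqkey_def flip: zero_prod_def)
next
  case (Suc p)
  then show ?case by (simp add: seqkey_def yvar_def mult_single)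
qed

text \<open>
  The heaviest term of a minor with increasing columns is its diagonal term: a permutation \<open>\<pi> \<noteq> id\<close>
  satisfies \<open>i < \<pi> i\<close> for the least \<open>i\<close> that it moves.
\<close>

lemma leads_minor_increasing:
  assumes s: "sorted_wrt (<) s" "set s \<subseteq> {1..n}" "length s \<le> n - 1"
  shows "leads n (minor n s) (0, seqkey (length s) ((!) s))"
proof -
  let ?p = "length s"
  let ?\<kappa> = "\<lambda>\<pi>. (0, seqkey ?p (\<lambda>r. s ! \<pi> r)) :: tkey"
  let ?A = "{\<pi>. \<pi> permutes {0..<?p}}"
  have in_range: "\<pi> r < ?p" if "\<pi> \<in> ?A" "r < ?p" for \<pi> r
    using permutes_in_image[of \<pi> "{0..<?p}" r] that by auto
  have signof: "of_int (sign \<pi>) * Poly_Mapping.single \<kappa> 1 = (Poly_Mapping.single \<kappa> (of_int (sign \<pi>)) :: target_poly)" for \<pi> and \<kappa> :: tkey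
    by (auto simp: sign_def single_uminus)
  have "0 \<notin> set s" using s by auto
  then have "minor n s = (\<Sum>\<pi>\<in>?A. of_int (sign \<pi>) * (\<Prod>r<?p. yvar (Suc r) (s ! \<pi> r)))"
    by (simp add: minor_nonzero_columns det_def ymat_def atLeast0LessThan in_range[unfolded atLeast0LessThan])
  also have "\<dots> = (\<Sum>\<pi>\<in>?A. Poly_Mapping.single (?\<kappa> \<pi>) (of_int (sign \<pi>)))"
    by (simp only: prod_yvar signof)
  also have "\<dots> = Poly_Mapping.single (?\<kappa> id) 1 + (\<Sum>\<pi>\<in>?A - {id}. Poly_Mapping.single (?\<kappa> \<pi>) (of_int (sign \<pi>)))"
    by (subst sum.remove[of _ id]) (auto simp: permutes_id finite_permutations)
  finally have eq: "minor n s = \<dots>" .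
  have lower: "key_weight n (?\<kappa> \<pi>) < key_weight n (?\<kappa> id)" if \<pi>: "\<pi> \<in> ?A - {id}" for \<pi>
  proof -
    have perm: "\<pi> permutes {0..<?p}" "\<pi> \<noteq> id" using \<pi> by auto
    then obtain x where x: "\<pi> x \<noteq> x" by (auto simp: fun_eq_iff)
    define i where "i = (LEAST x. \<pi> x \<noteq> x)"
    have i: "\<pi> i \<noteq> i" unfolding i_def using x by (rule LeastI)
    have below: "\<pi> r = r" if "r < i" for r using that not_less_Least unfolding i_def by blast
    have "i < ?p" using i perm(1) permutes_not_in[of \<pi> "{0..<?p}" i] by auto
    have "\<not> \<pi> i < i" using below[of "\<pi> i"] i permutes_inj[OF perm(1)] by (auto dest: injD)
    then have "i < \<pi> i" using i by simp
    have "\<pi> i < ?p" using in_range \<pi> \<open>i < ?p\<close> by blast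
    have range: "s ! r \<in> {1..n}" if "r < ?p" for r using s(2) that nth_mem by blast
    show ?thesis
    proof (rule seqkey_lex_less[OF s(3) _ _ \<open>i < ?p\<close>])
      show "s ! id i < s ! \<pi> i"
        using sorted_wrt_nth_less[OF s(1) \<open>i < \<pi> i\<close> \<open>\<pi> i < ?p\<close>] by simp
    qed (use range in_range \<pi> below in auto)
  qed
  have "leads n (minor n s) (?\<kappa> id)"
    unfolding eq
  proof (intro leads_add_lower leads_single)
    fix k assume "k \<in> Poly_Mapping.keys (\<Sum>\<pi>\<in>?A - {id}. Poly_Mapping.single (?\<kappa> \<pi>) (of_int (sign \<pi>) :: complex))"
    then obtain \<pi> where "\<pi> \<in> ?A - {id}" "k \<in> Poly_Mapping.keys (Poly_Mapping.single (?\<kappa> \<pi>) (of_int (sign \<pi>) :: complex))"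
      using Poly_Mapping.keys_sum[of "\<lambda>\<pi>. Poly_Mapping.single (?\<kappa> \<pi>) (of_int (sign \<pi>) :: complex)" "?A - {id}"] by blast
    then show "key_weight n k < key_weight n (?\<kappa> id)" using lower by (auto split: if_splits)
  qed simp
  then show ?thesis by simp
qed

lemma sorted_list_of_set_increasing: "sorted_wrt (<) (s :: nat list) \<Longrightarrow> sorted_list_of_set (set s) = s"
  by (simp add: sorted_list_of_set.idem_if_sorted_distinct strict_sorted_iff)

lemma minor_sort:
  assumes "distinct l"
  shows "minor n l = minor n (sorted_list_of_set (set l)) \<or> minor n l = - minor n (sorted_list_of_set (set l))"
  using assms
proof (induction "inversions l" arbitrary: l rule: less_induct)
  case less
  show ?case
  proof (cases "sorted_wrt (<) l")
    case True
    then show ?thesis by (simp add: sorted_list_of_set_increasing)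
  next
    case False
    then obtain us i j vs where l: "l = us @ i # j # vs" "j \<le> i"
      using not_increasing_adjacent by blast
    with less.prems have "j < i" by auto
    moreover have "set (us @ j # i # vs) = set l" using l by auto
    ultimately show ?thesis
      using less.hyps[of "us @ j # i # vs"] inversions_swap_less[of j i us vs] less.prems
        minor_swap[of n us i j vs] unfolding l by auto
  qed
qed

lemma increasing_nth_ge: "sorted_wrt (<) (s :: nat list) \<Longrightarrow> r < length s \<Longrightarrow> r \<le> s ! r"
proof (induction r)
  case (Suc r)
  then show ?case using sorted_wrt_nth_less[of "(<)" s r "Suc r"] by simp
qed simp

text \<open>
  The column of the leading variable in row \<open>r\<close>, for the minor on the increasing columns \<open>s\<close>. An
  initial run \<open>0, \<dots>, q - 1\<close> of \<open>s\<close> is shifted to \<open>1, \<dots>, q\<close>, and all other entries are unchanged.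
\<close>

definition hat :: "nat list \<Rightarrow> nat \<Rightarrow> nat" where
  "hat s r = max (s ! r) (Suc r)"

text \<open>
  The initial run \<open>0, \<dots>, q - 1\<close> of an increasing list; it may be empty.
\<close>

lemma initial_run:
  assumes "sorted_wrt (<) (s :: nat list)"
  obtains q R where "s = [0..<q] @ R" "sorted_wrt (<) R" "\<And>x. x \<in> set R \<Longrightarrow> q < x"
proof -
  define q where "q = (LEAST r. \<not> (r < length s \<and> s ! r = r))"
  have q: "\<not> (q < length s \<and> s ! q = q)"
    unfolding q_def by (rule LeastI[of _ "length s"]) simp
  have below: "r < length s \<and> s ! r = r" if "r < q" for r
    using not_less_Least that unfolding q_def by blast
  have len: "q \<le> length s" using below[of "q - 1"] by (cases q) auto
  have "s = take q s @ drop q s" by simp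
  moreover have "take q s = [0..<q]" using below len by (intro nth_equalityI) auto
  moreover have "sorted_wrt (<) (drop q s)" using assms by (rule sorted_wrt_drop)
  moreover have "q < x" if x: "x \<in> set (drop q s)" for x
  proof -
    obtain i where i: "q + i < length s" "x = s ! (q + i)" using x len by (auto simp: in_set_conv_nth less_diff_conv add.commute)
    have "q < length s" using i by simp
    then have "q < s ! q" using q increasing_nth_ge[OF assms, of q] by auto
    moreover have "s ! q \<le> s ! (q + i)"
      using sorted_wrt_nth_less[OF assms, of q "q + i"] i by (cases "i = 0") auto
    ultimately show ?thesis using i by simp
  qed
  ultimately show ?thesis using that[of q "drop q s"] by metis
qed

lemma hat_initial_run:
  assumes "sorted_wrt (<) R" "\<And>x. x \<in> set R \<Longrightarrow> q < x" "r < q + length R"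
  shows "hat ([0..<q] @ R) r = (if r < q then Suc r else R ! (r - q))"
proof (cases "r < q")
  case False
  have "Suc r \<le> R ! (r - q)"
  proof -
    have "sorted_wrt (<) ([0..<Suc q] @ R)" using assms(1,2) by (fastforce simp: sorted_wrt_append)
    from increasing_nth_ge[OF this, of "Suc r"] show ?thesis
      using False assms(3) by (simp add: nth_append Suc_diff_le)
  qed
  then show ?thesis using False by (simp add: hat_def nth_append)
qed (simp add: hat_def nth_append)

text \<open>
  The exponent of the \<open>y\<close>-variables in the leading term of the minor on the columns \<open>s\<close>.
\<close>

definition ykey :: "nat list \<Rightarrow> nat \<times> nat \<Rightarrow>\<^sub>0 nat" where
  "ykey s = seqkey (length s) (hat s)"

text \<open>
  The increasing lists of indices whose sets are the subscripts of the variables \<open>P\<close>.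
\<close>

definition column :: "nat \<Rightarrow> nat list \<Rightarrow> bool" where
  "column n s \<longleftrightarrow> sorted_wrt (<) s \<and> set s \<subseteq> {0..n} \<and> 1 \<le> length s \<and> length s \<le> n - 1"

lemma hat_range: "column n s \<Longrightarrow> r < length s \<Longrightarrow> hat s r \<in> {1..n}"
  using nth_mem[of r s] by (auto simp: column_def hat_def subset_iff)

text \<open>
  In a column with initial run \<open>0, \<dots>, q - 1\<close>, replacing \<open>p < q\<close> by \<open>q\<close> does not change the
  sequence of leading columns.
\<close>

lemma shifted_run:
  assumes s: "sorted_wrt (<) ([0..<q] @ R)" and R: "\<And>x. x \<in> set R \<Longrightarrow> q < x" and p: "p < q"
  defines "t \<equiv> [0..<p] @ [Suc p..<Suc q] @ R"
  shows "sorted_wrt (<) t" "length t = length ([0..<q] @ R)" "set t = insert q (set ([0..<q] @ R) - {p})"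
    "r < length t \<Longrightarrow> hat t r = hat ([0..<q] @ R) r"
proof -
  have sR: "sorted_wrt (<) R" using s by (simp add: sorted_wrt_append)
  show "sorted_wrt (<) t" using sR R p unfolding t_def by (fastforce simp: sorted_wrt_append)
  show "length t = length ([0..<q] @ R)" using p by (simp add: t_def)
  show "set t = insert q (set ([0..<q] @ R) - {p})" using R p by (fastforce simp: t_def)
  assume "r < length t"
  then show "hat t r = hat ([0..<q] @ R) r"
    using p by (auto simp: t_def hat_def nth_append not_less nth_upt Suc_diff_le simp del: upt_Suc)
qed

text \<open>
  Replacing \<open>p < q\<close> by an index above \<open>q\<close> instead increases that sequence, first in row
  \<open>q - 1\<close>.
\<close>

lemma raised_run:
  assumes s: "sorted_wrt (<) ([0..<q] @ R)" and R: "\<And>x. x \<in> set R \<Longrightarrow> q < x" and p: "p < q"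
    and j: "q < j" "j \<notin> set R"
  defines "t \<equiv> [0..<p] @ [Suc p..<q] @ insort j R"
  shows "sorted_wrt (<) t" "length t = length ([0..<q] @ R)" "set t = insert j (set ([0..<q] @ R) - {p})"
    "r < q - 1 \<Longrightarrow> hat t r = hat ([0..<q] @ R) r"
    "hat ([0..<q] @ R) (q - 1) < hat t (q - 1)"
proof -
  have sR: "sorted_wrt (<) R" using s by (simp add: sorted_wrt_append)
  then have "sorted_wrt (<) (insort j R)" using j by (simp add: strict_sorted_iff sorted_insort distinct_insort)
  then show "sorted_wrt (<) t" using R p j unfolding t_def by (fastforce simp: sorted_wrt_append set_insort_key)
  show len: "length t = length ([0..<q] @ R)" using p by (simp add: t_def)
  show "set t = insert j (set ([0..<q] @ R) - {p})" using R p by (fastforce simp: t_def set_insort_key)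
  show "hat t r = hat ([0..<q] @ R) r" if "r < q - 1"
    using that p by (auto simp: t_def hat_def nth_append)
  have "insort j R ! 0 \<in> set (insort j R)" by (intro nth_mem) simp
  then have "q < insort j R ! 0" using R j by (auto simp: set_insort_key)
  moreover have "t ! (q - 1) = insort j R ! 0" using p nth_append_length_plus[of "[0..<p] @ [Suc p..<q]" "insort j R" 0] by (simp add: t_def)
  ultimately show "hat ([0..<q] @ R) (q - 1) < hat t (q - 1)"
    using p by (simp add: hat_def nth_append)
qed

lemma raised_run_weight:
  assumes s: "column n ([0..<q] @ R)" and R: "\<And>x. x \<in> set R \<Longrightarrow> q < x" and p: "p < q"
    and j: "q < j" "j \<notin> set R" "j \<le> n"
  shows "column n ([0..<p] @ [Suc p..<q] @ insort j R)"
    "key_weight n (e', ykey ([0..<p] @ [Suc p..<q] @ insort j R)) < key_weight n (e, ykey ([0..<q] @ R))"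
proof -
  let ?s = "[0..<q] @ R" and ?t = "[0..<p] @ [Suc p..<q] @ insort j R"
  have inc: "sorted_wrt (<) ?s" using s by (simp add: column_def)
  note t = raised_run[OF inc R p j(1,2)]
  show col: "column n ?t" using s t j(3) unfolding column_def by auto
  have len: "length ?t = length ?s" by (rule t(2))
  show "key_weight n (e', ykey ?t) < key_weight n (e, ykey ?s)"
    unfolding ykey_def len
  proof (rule seqkey_lex_less[of _ _ _ _ "q - 1"])
    show "length ?s \<le> n - 1" using s by (simp add: column_def)
    show "hat ?s r \<in> {1..n}" if "r < length ?s" for r using hat_range[OF s that] .
    show "hat ?t r \<in> {1..n}" if "r < length ?s" for r using hat_range[OF col] that len by metis
  qed (use p t(4,5) in auto)
qed

lemma leads_minor_nonzero:
  assumes s: "column n s" and "0 \<notin> set s"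
  shows "leads n (minor n s) (0, ykey s)"
proof -
  have inc: "sorted_wrt (<) (0 # s)" using assms by (auto simp: column_def intro!: gr0I)
  have "hat s r = s ! r" if "r < length s" for r
    using increasing_nth_ge[OF inc, of "Suc r"] that by (simp add: hat_def)
  then have "ykey s = seqkey (length s) ((!) s)" unfolding ykey_def by (rule seqkey_cong)
  moreover have "set s \<subseteq> {1..n}" using inc s by (auto simp: column_def Suc_le_eq)
  ultimately show ?thesis using leads_minor_increasing[of s n] s by (simp add: column_def)
qed

text \<open>
  If \<open>0\<close> is a column, expand \<open>y\<^sub>0\<close>: the summand \<open>y\<^sub>q\<close>, where \<open>q\<close> is the length of the initial run, has the
  claimed leading term, the summands whose index is already a column vanish, and the remaining ones
  have an index above \<open>q\<close> and are lighter.
\<close>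

lemma leads_minor:
  assumes s: "column n s"
  shows "leads n (minor n s) (0, ykey s)"
proof (cases "0 \<in> set s")
  case False
  with s show ?thesis by (rule leads_minor_nonzero)
next
  case True
  have inc: "sorted_wrt (<) s" using s by (simp add: column_def)
  obtain q R where R: "s = [0..<q] @ R" "sorted_wrt (<) R" "\<And>x. x \<in> set R \<Longrightarrow> q < x"
    by (rule initial_run[OF inc]) blast
  have q: "0 < q" using True R(3)[of 0] unfolding R(1) by (cases q) auto
  define js where "js = [1..<q] @ R"
  have s_js: "s = 0 # js" using q by (simp add: R(1) js_def upt_conv_Cons)
  let ?J = "{1..n} - set js"
  have "q + length R \<le> n - 1" using s unfolding R(1) column_def by simp
  then have "q \<le> n" by linarith
  moreover have "q \<notin> set js" using R(3)[of q] by (auto simp: js_def)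
  ultimately have qJ: "q \<in> ?J" using q by simp
  have "distinct js" using inc s_js by (simp add: strict_sorted_iff)
  have s0: "set s - {0} = set js" using inc s_js by auto
  have "minor n s = - (\<Sum>j=1..n. minor n (j # js))" unfolding s_js by (rule minor_zero_Cons)
  also have "(\<Sum>j=1..n. minor n (j # js)) = (\<Sum>j\<in>?J. minor n (j # js))"
    by (intro sum.mono_neutral_right) (auto simp: minor_repeated)
  also have "\<dots> = minor n (q # js) + (\<Sum>j\<in>?J - {q}. minor n (j # js))"
    using qJ by (intro sum.remove) auto
  finally have eq: "minor n s = - (minor n (q # js) + (\<Sum>j\<in>?J - {q}. minor n (j # js)))" .
  have main: "leads n (minor n (q # js)) (0, ykey s)"
  proof -
    let ?t = "[0..<0] @ [Suc 0..<Suc q] @ R"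
    note t = shifted_run[OF inc[unfolded R(1)] R(3) q, folded R(1)]
    have col: "column n ?t" using s t(1,2,3) \<open>q \<le> n\<close> unfolding column_def by auto
    have "0 \<notin> set ?t" using t(3) q by auto
    then have lt: "leads n (minor n ?t) (0, ykey ?t)" by (rule leads_minor_nonzero[OF col])
    have "seqkey (length s) (hat ?t) = seqkey (length s) (hat s)"
      by (rule seqkey_cong) (use t(2,4) in auto)
    then have "ykey ?t = ykey s" using t(2) by (simp only: ykey_def)
    moreover have "sorted_list_of_set (set (q # js)) = ?t"
      using sorted_list_of_set_increasing[OF t(1)] t(3) s0 by (simp only: list.set)
    ultimately show ?thesis
      using minor_sort[of "q # js" n] lt leads_uminus[OF lt] \<open>q \<notin> set js\<close> \<open>distinct js\<close> by auto
  qed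
  have low: "key_weight n k < key_weight n (0, ykey s)"
    if j: "j \<in> ?J - {q}" and k: "k \<in> Poly_Mapping.keys (minor n (j # js))" for j k
  proof -
    let ?t = "[0..<0] @ [Suc 0..<q] @ insort j R"
    have j': "q < j" "j \<notin> set R" "j \<le> n" "j \<notin> set js" using j by (auto simp: js_def)
    note t = raised_run[OF inc[unfolded R(1)] R(3) q j'(1,2), folded R(1)]
    note w = raised_run_weight[OF s[unfolded R(1)] R(3) q j'(1,2,3), folded R(1)]
    have col: "column n ?t" using w(1) by simp
    have "0 \<notin> set ?t" using t(3) j' by auto
    then have lt: "leads n (minor n ?t) (0, ykey ?t)" by (rule leads_minor_nonzero[OF col])
    have "sorted_list_of_set (set (j # js)) = ?t"
      using sorted_list_of_set_increasing[OF t(1)] t(3) s0 by (simp only: list.set)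
    then have "k \<in> Poly_Mapping.keys (minor n ?t)"
      using minor_sort[of "j # js" n] k j'(4) \<open>distinct js\<close> by (auto simp: keys_uminus_eq)
    then show ?thesis using leads_keys_le[OF lt] w(2)[of 0 0] by fastforce
  qed
  show ?thesis
    unfolding eq
  proof (intro leads_uminus leads_add_lower main)
    fix k assume "k \<in> Poly_Mapping.keys (\<Sum>j\<in>?J - {q}. minor n (j # js))"
    then show "key_weight n k < key_weight n (0, ykey s)"
      using Poly_Mapping.keys_sum[of "\<lambda>j. minor n (j # js)" "?J - {q}"] low by blast
  qed
qed

text \<open>
  The leading exponent of the image of the variable \<open>P\<close> with subscript \<open>s\<close>.
\<close>

definition ckey :: "(nat \<Rightarrow> nat) \<Rightarrow> nat list \<Rightarrow> tkey" where
  "ckey a s = (\<Sum>j\<leftarrow>s. Poly_Mapping.single j (int (a j)), ykey s)"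

lemma tvar_power: "tvar j ^ k = Poly_Mapping.single (Poly_Mapping.single j (int k), 0) 1"
proof (induction k)
  case 0
  show ?case by (simp flip: zero_prod_def)
next
  case (Suc k)
  then show ?case by (simp add: tvar_def mult_single add.commute flip: single_add)
qed

lemma tvar_inv_power: "tvar_inv j ^ k = Poly_Mapping.single (Poly_Mapping.single j (- int k), 0) 1"
proof (induction k)
  case 0
  show ?case by (simp flip: zero_prod_def)
next
  case (Suc k)
  then show ?case by (simp add: tvar_inv_def mult_single add.commute flip: single_add)
qed

lemma leads_Psi_column:
  assumes "column n s"
  shows "leads n (Psi n a (var (PVar (set s)))) (ckey a s)"
proof -
  have inc: "sorted_wrt (<) s" "set s \<subseteq> {0..n}" using assms by (auto simp: column_def)
  have pair: "(\<Sum>j\<leftarrow>l. (Poly_Mapping.single j (int (a j)), 0)) = ((\<Sum>j\<leftarrow>l. Poly_Mapping.single j (int (a j)), 0) :: tkey)" for l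
    by (induction l) (simp_all add: zero_prod_def)
  have "leads n (\<Prod>j\<leftarrow>s. tvar j ^ a j) (\<Sum>j\<leftarrow>s. (Poly_Mapping.single j (int (a j)), 0))"
    by (rule leads_prod_list) (simp add: tvar_power leads_single)
  then have "leads n (minor n s * (\<Prod>j\<leftarrow>s. tvar j ^ a j))
      ((0, ykey s) + ((\<Sum>j\<leftarrow>s. Poly_Mapping.single j (int (a j))), 0))"
    unfolding pair by (rule leads_mult[OF leads_minor[OF assms]])
  then show ?thesis
    using Psi_bracket[OF inc(2), of a] inc(1) by (simp add: bracket_sorted ckey_def)
qed

section \<open>Linear spans modulo the relations\<close>

text \<open>
  The linear combination of the elements \<open>g i\<close> with the finitely supported coefficients \<open>C\<close>.
\<close>

definition lincomb :: "('i \<Rightarrow> ('m::comm_monoid_add \<Rightarrow>\<^sub>0 complex)) \<Rightarrow> ('i \<Rightarrow>\<^sub>0 complex) \<Rightarrow> ('m \<Rightarrow>\<^sub>0 complex)" where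
  "lincomb g C = (\<Sum>i\<in>Poly_Mapping.keys C. const (Poly_Mapping.lookup C i) * g i)"

lemma lincomb_superset:
  "finite A \<Longrightarrow> Poly_Mapping.keys C \<subseteq> A \<Longrightarrow> lincomb g C = (\<Sum>i\<in>A. const (Poly_Mapping.lookup C i) * g i)"
  unfolding lincomb_def by (rule sum.mono_neutral_left) (auto simp: in_keys_iff const_0)

lemma lincomb_add: "lincomb g (C + D) = lincomb g C + lincomb g D"
  using lincomb_superset[of "Poly_Mapping.keys C \<union> Poly_Mapping.keys D" _ g] Poly_Mapping.keys_add[of C D]
  by (simp add: lookup_add const_add sum.distrib distrib_right)

lemma lincomb_single: "lincomb g (Poly_Mapping.single i c) = const c * g i"
  by (cases "c = 0") (simp_all add: lincomb_def const_0)

text \<open>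
  The linear span of the elements \<open>g i\<close> with \<open>i \<in> X\<close>.
\<close>

definition lspan :: "('i \<Rightarrow> ('m::comm_monoid_add \<Rightarrow>\<^sub>0 complex)) \<Rightarrow> 'i set \<Rightarrow> ('m \<Rightarrow>\<^sub>0 complex) set" where
  "lspan g X = {lincomb g C | C. Poly_Mapping.keys C \<subseteq> X}"

lemma lspan_add:
  assumes "f \<in> lspan g X" "h \<in> lspan g X"
  shows "f + h \<in> lspan g X"
proof -
  obtain C D where "f = lincomb g C" "Poly_Mapping.keys C \<subseteq> X" "h = lincomb g D" "Poly_Mapping.keys D \<subseteq> X"
    using assms unfolding lspan_def by blast
  moreover have "Poly_Mapping.keys (C + D) \<subseteq> Poly_Mapping.keys C \<union> Poly_Mapping.keys D"
    by (rule Poly_Mapping.keys_add)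
  ultimately show ?thesis unfolding lspan_def by (auto simp: lincomb_add intro!: exI[of _ "C + D"])
qed

lemma lspan_scaled_base: "i \<in> X \<Longrightarrow> const c * g i \<in> lspan g X"
  unfolding lspan_def by (auto intro!: exI[of _ "Poly_Mapping.single i c"] simp: lincomb_single split: if_splits)

lemma lspan_base: "i \<in> X \<Longrightarrow> g i \<in> lspan g X"
  using lspan_scaled_base[of i X 1 g] by (simp add: const_1)

lemma lspan_zero: "0 \<in> lspan g X"
  unfolding lspan_def by (auto intro!: exI[of _ 0] simp: lincomb_def)

lemma lspan_sum: "(\<And>i. i \<in> A \<Longrightarrow> f i \<in> lspan g X) \<Longrightarrow> sum f A \<in> lspan g X"
  by (induction A rule: infinite_finite_induct) (auto intro: lspan_zero lspan_add)

lemma lspan_scale: "f \<in> lspan g X \<Longrightarrow> const c * f \<in> lspan g X"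
proof -
  assume "f \<in> lspan g X"
  then obtain C where C: "f = lincomb g C" "Poly_Mapping.keys C \<subseteq> X" unfolding lspan_def by blast
  have "const c * f = (\<Sum>i\<in>Poly_Mapping.keys C. const (c * Poly_Mapping.lookup C i) * g i)"
    by (simp add: C(1) lincomb_def sum_distrib_left const_mult mult.assoc)
  also have "\<dots> \<in> lspan g X" using C(2) by (intro lspan_sum lspan_scaled_base) auto
  finally show ?thesis .
qed

lemma lspan_mono: "X \<subseteq> Y \<Longrightarrow> lspan g X \<subseteq> lspan g Y"
  unfolding lspan_def by blast

context
  fixes n :: nat and a :: "nat \<Rightarrow> nat"
  assumes n2: "n \<ge> 2"
begin

lemma rel_ideal_add: "x \<in> rel_ideal n a \<Longrightarrow> y \<in> rel_ideal n a \<Longrightarrow> x + y \<in> rel_ideal n a"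
  using additive_subgroup.a_closed[OF ideal.axioms(1)[OF ideal_rel_ideal[OF n2]], of x a y] by simp

lemma rel_ideal_mult: "x \<in> rel_ideal n a \<Longrightarrow> s \<in> source n \<Longrightarrow> s * x \<in> rel_ideal n a"
  using ideal.I_l_closed[OF ideal_rel_ideal[OF n2], of x a s] by simp

lemma rel_ideal_zero: "0 \<in> rel_ideal n a"
  using additive_subgroup.zero_closed[OF ideal.axioms(1)[OF ideal_rel_ideal[OF n2]], of a] by simp

lemma const_closed: "const c \<in> source n"
  unfolding source_ring_def by (rule submonoid_add.const_mem[OF submonoid_source_exponents])

lemma rel_ideal_scale: "x \<in> rel_ideal n a \<Longrightarrow> const c * x \<in> rel_ideal n a"
  by (rule rel_ideal_mult[OF _ const_closed])

lemma relations_in_rel_ideal: "pluecker_relations n \<union> linear_relations n a \<subseteq> rel_ideal n a"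
  unfolding rel_ideal_def using relations_closed[OF n2]
  by (intro ring.genideal_self cring.axioms(1) cring_source_ring)

lemma Psi_rel_ideal: "x \<in> rel_ideal n a \<Longrightarrow> Psi n a x = 0"
  using rel_ideal_subset_kernel[OF n2, of a]
  by (auto simp: a_kernel_def' target_ring_def monoid_algebra_def)

end

text \<open>
  The polynomials that are congruent, modulo the relations, to an element of the span.
\<close>

definition mod_span :: "nat \<Rightarrow> (nat \<Rightarrow> nat) \<Rightarrow> ('i \<Rightarrow> cox_poly) \<Rightarrow> 'i set \<Rightarrow> cox_poly set" where
  "mod_span n a g X = {p. \<exists>f\<in>lspan g X. p - f \<in> rel_ideal n a}"

lemma mod_spanI: "f \<in> lspan g X \<Longrightarrow> p - f \<in> rel_ideal n a \<Longrightarrow> p \<in> mod_span n a g X"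
  unfolding mod_span_def by blast

context
  fixes n :: nat and a :: "nat \<Rightarrow> nat"
  assumes n2: "n \<ge> 2"
begin

lemma mod_span_lspan: "f \<in> lspan g X \<Longrightarrow> f \<in> mod_span n a g X"
  by (rule mod_spanI[of f]) (simp_all add: rel_ideal_zero[OF n2])

lemma mod_span_add:
  assumes "p \<in> mod_span n a g X" "q \<in> mod_span n a g X"
  shows "p + q \<in> mod_span n a g X"
proof -
  obtain f h where "f \<in> lspan g X" "p - f \<in> rel_ideal n a" "h \<in> lspan g X" "q - h \<in> rel_ideal n a"
    using assms unfolding mod_span_def by blast
  then show ?thesis
    using rel_ideal_add[OF n2, of "p - f" a "q - h"] lspan_add
    by (intro mod_spanI[of "f + h"]) (auto simp: algebra_simps)
qed

lemma mod_span_zero: "0 \<in> mod_span n a g X"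
  by (rule mod_span_lspan[OF lspan_zero])

lemma mod_span_sum: "(\<And>i. i \<in> A \<Longrightarrow> f i \<in> mod_span n a g X) \<Longrightarrow> sum f A \<in> mod_span n a g X"
  by (induction A rule: infinite_finite_induct) (auto intro: mod_span_zero mod_span_add)

lemma mod_span_scale:
  assumes "p \<in> mod_span n a g X"
  shows "const c * p \<in> mod_span n a g X"
proof -
  obtain f where "f \<in> lspan g X" "p - f \<in> rel_ideal n a" using assms unfolding mod_span_def by blast
  then show ?thesis
    using rel_ideal_scale[OF n2, of "p - f" a c] lspan_scale[of f g X c]
    by (intro mod_spanI[of "const c * f"]) (auto simp: algebra_simps)
qed

lemma mod_span_congruent:
  assumes "q \<in> mod_span n a g X" "p - q \<in> rel_ideal n a"
  shows "p \<in> mod_span n a g X"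
proof -
  obtain f where "f \<in> lspan g X" "q - f \<in> rel_ideal n a" using assms(1) unfolding mod_span_def by blast
  then show ?thesis
    using rel_ideal_add[OF n2 assms(2), of "q - f"] by (intro mod_spanI[of f]) auto
qed

lemma mod_span_uminus: "p \<in> mod_span n a g X \<Longrightarrow> - p \<in> mod_span n a g X"
  using mod_span_scale[of p g X "-1"] by (simp add: const_def single_uminus)

end

section \<open>Straightening by the Pluecker relations\<close>

text \<open>
  A product of variables \<open>P\<close> is represented by the list of the columns that are its subscripts.
\<close>

definition tableau :: "nat \<Rightarrow> nat list list \<Rightarrow> bool" where
  "tableau n T \<longleftrightarrow> (\<forall>s\<in>set T. column n s)"

text \<open>
  The product \<open>P\<^sub>T\<close> of the variables \<open>P\<close> whose subscripts are the columns of \<open>T\<close>.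
\<close>

definition tab_prod :: "nat list list \<Rightarrow> cox_poly" where
  "tab_prod T = (\<Prod>s\<leftarrow>T. var (PVar (set s)))"

text \<open>
  The order in which the columns of a standard tableau appear: lengths weakly decrease, and entries
  weakly increase along each row.
\<close>

definition col_le :: "nat list \<Rightarrow> nat list \<Rightarrow> bool" where
  "col_le s t \<longleftrightarrow> length t \<le> length s \<and> (\<forall>r<length t. s ! r \<le> t ! r)"

text \<open>
  Semistandard tableaux for the index order \<open>0 < 1 < \<dots> < n\<close>: columns increase strictly, rows weakly.
\<close>

definition standard :: "nat \<Rightarrow> nat list list \<Rightarrow> bool" where
  "standard n T \<longleftrightarrow> tableau n T \<and> sorted_wrt col_le T"

text \<open>
  The number with binary digits at the entries of \<open>s\<close>. For sets it orders columns lexicographically,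
  from the largest entry down.
\<close>

definition binary :: "nat list \<Rightarrow> nat" where
  "binary s = (\<Sum>x\<leftarrow>s. 2 ^ x)"

text \<open>
  The sum of \<open>i\<close> times the number of the column in position \<open>i\<close>, counted from \<open>0\<close>. It increases when
  binary digits move to the right, and it is bounded in terms of the length and content of the list.
\<close>

fun binary_rank :: "nat list list \<Rightarrow> nat" where
  "binary_rank [] = 0"
| "binary_rank (s # T) = binary (concat T) + binary_rank T"

lemma binary_append: "binary (s @ t) = binary s + binary t"
  by (simp add: binary_def)

lemma binary_mset: "mset s = mset t \<Longrightarrow> binary s = binary t"
  unfolding binary_def by (metis mset_map sum_mset_sum_list)

lemma binary_rank_le: "binary_rank T \<le> length T * binary (concat T)"
  by (induction T) (auto simp: binary_append algebra_simps intro: order_trans add_mono)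

lemma binary_rank_replace:
  assumes "mset (\<alpha>' @ \<beta>') = mset (\<alpha> @ \<beta>)" "binary \<beta> < binary \<beta>'"
  shows "binary_rank (U @ \<alpha> # \<beta> # V) < binary_rank (U @ \<alpha>' # \<beta>' # V)"
proof (induction U)
  case Nil
  then show ?case using assms(2) by (simp add: binary_append)
next
  case (Cons u U)
  have "binary (concat (U @ \<alpha> # \<beta> # V)) = binary (concat (U @ \<alpha>' # \<beta>' # V))"
    using assms(1) by (intro binary_mset) (simp add: ac_simps)
  with Cons show ?case by simp
qed

lemma binary_less_power:
  assumes "sorted_wrt (<) s" "\<And>x. x \<in> set s \<Longrightarrow> x < m"
  shows "binary s < 2 ^ m"
proof -
  have "distinct s" using assms(1) by (simp add: strict_sorted_iff)
  then have "binary s = (\<Sum>x\<in>set s. 2 ^ x)" unfolding binary_def by (rule sum_list_distinct_conv_sum_set)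
  also have "\<dots> \<le> (\<Sum>x\<in>{0..<m}. 2 ^ x)" using assms(2) by (intro sum_mono2) auto
  also have "\<dots> < 2 ^ m" by (simp add: sum_power2)
  finally show ?thesis .
qed

lemma binary_member_le: "x \<in> set s \<Longrightarrow> 2 ^ x \<le> binary s"
  unfolding binary_def by (rule member_le_sum_list) auto

text \<open>
  In a Pluecker exchange at a violation \<open>\<beta> ! r < \<alpha> ! r\<close>, the entries up to \<open>\<beta> ! r\<close> leave \<open>\<beta>\<close>, and at
  least one entry not below \<open>\<alpha> ! r\<close> arrives.
\<close>

lemma binary_exchange_less:
  assumes \<alpha>: "sorted_wrt (<) \<alpha>" and \<beta>: "sorted_wrt (<) \<beta>"
    and r: "r < length \<alpha>" "r < length \<beta>" "\<beta> ! r < \<alpha> ! r"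
    and S: "S \<subseteq> {..<length \<alpha>}" "card S = Suc r"
  shows "binary \<beta> < binary (exchange_snd S \<alpha> \<beta>)"
proof -
  have "\<not> S \<subseteq> {..<r}" using S(2) card_mono[of "{..<r}" S] by auto
  then obtain i where i: "i \<in> S" "r \<le> i" by (metis lessThan_iff not_le subsetI)
  have "\<alpha> ! i \<in> set (nths \<alpha> S)" using i S(1) by (auto simp: set_nths)
  then have "2 ^ (\<alpha> ! i) \<le> binary (nths \<alpha> S)" by (rule binary_member_le)
  moreover have "\<alpha> ! r \<le> \<alpha> ! i"
    using sorted_wrt_nth_less[OF \<alpha>, of r i] i S(1) by (cases "r = i") auto
  then have "(2::nat) ^ (\<alpha> ! r) \<le> 2 ^ (\<alpha> ! i)" by simp
  moreover have "binary (take (Suc r) \<beta>) < 2 ^ (\<alpha> ! r)"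
  proof (rule binary_less_power)
    show "sorted_wrt (<) (take (Suc r) \<beta>)" using \<beta> by (rule sorted_wrt_take)
    fix x assume "x \<in> set (take (Suc r) \<beta>)"
    then obtain j where "j \<le> r" "x = \<beta> ! j" using r by (auto simp: in_set_conv_nth less_Suc_eq_le)
    then have "x \<le> \<beta> ! r" using sorted_wrt_nth_less[OF \<beta>, of j r] r by (cases "j = r") auto
    then show "x < \<alpha> ! r" using r by simp
  qed
  moreover have "binary \<beta> = binary (take (Suc r) \<beta>) + binary (drop (Suc r) \<beta>)"
    by (simp flip: binary_append)
  ultimately show ?thesis unfolding exchange_snd_def binary_append S(2) by linarith
qed

lemma transp_col_le: "transp col_le"
proof (rule transpI)
  fix s t u assume "col_le s t" "col_le t u"
  then show "col_le s u" unfolding col_le_def using le_trans less_le_trans by metis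
qed

lemma minus_one_power: "(- 1) ^ k = (const ((- 1) ^ k) :: cox_poly)"
proof (induction k)
  case 0
  show ?case by (simp add: const_1)
next
  case (Suc k)
  then show ?case by (simp add: const_mult) (simp add: const_def single_uminus)
qed

lemma bracket_scaled: "distinct is \<Longrightarrow> bracket is = const ((- 1) ^ inversions is) * var (PVar (set is))"
  by (simp add: bracket_def minus_one_power)

lemma tab_prod_append: "tab_prod (U @ V) = tab_prod U * tab_prod V"
  by (simp add: tab_prod_def)

lemma column_PVar: "n \<ge> 2 \<Longrightarrow> column n s \<Longrightarrow> PVar (set s) \<in> cox_vars n"
  by (intro PVar_mem) (auto simp: column_def strict_sorted_iff distinct_card)

lemma tab_prod_closed: "n \<ge> 2 \<Longrightarrow> tableau n T \<Longrightarrow> tab_prod T \<in> source n"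
  by (induction T) (auto simp: tab_prod_def tableau_def intro!: source_closed var_closed column_PVar)

text \<open>
  Classical straightening. If two neighbouring columns \<open>\<alpha>, \<beta>\<close> violate the order in row \<open>r\<close>, apply the
  Pluecker relation that exchanges the first \<open>r + 1\<close> entries of \<open>\<beta>\<close>; every term has larger
  \<open>binary_rank\<close> and the same content.
\<close>

lemma straightening:
  assumes n2: "n \<ge> 2" and T: "tableau n T" "sorted_wrt (\<lambda>s t. length t \<le> length s) T"
  shows "tab_prod T \<in> mod_span n a tab_prod {T'. standard n T' \<and> mset (concat T') = mset (concat T)}"
  using T
proof (induction "length T * binary (concat T) - binary_rank T" arbitrary: T rule: less_induct)
  case less
  let ?X = "{T'. standard n T' \<and> mset (concat T') = mset (concat T)}"
  show ?case
  proof (cases "sorted_wrt col_le T")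
    case True
    then have "tab_prod T \<in> lspan tab_prod ?X" using less.prems by (intro lspan_base) (simp add: standard_def)
    then show ?thesis by (rule mod_span_lspan[OF n2])
  next
    case False
    obtain U \<alpha> \<beta> V where UV: "T = U @ \<alpha> # \<beta> # V" "\<not> col_le \<alpha> \<beta>"
      by (rule not_sorted_wrt_adjacent[OF transp_col_le False]) blast
    have cols: "column n \<alpha>" "column n \<beta>" "tableau n U" "tableau n V"
      using less.prems(1) by (auto simp: UV tableau_def)
    then have ab: "sorted_wrt (<) \<alpha>" "sorted_wrt (<) \<beta>" "set \<alpha> \<subseteq> {0..n}" "set \<beta> \<subseteq> {0..n}"
      "length \<alpha> \<le> n - 1" "1 \<le> length \<beta>" by (auto simp: column_def)
    have len: "length \<beta> \<le> length \<alpha>" using less.prems(2) by (simp add: UV sorted_wrt_append)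
    then obtain r where r: "r < length \<beta>" "\<beta> ! r < \<alpha> ! r" using UV(2) by (auto simp: col_le_def not_le)
    let ?F = "{S. S \<subseteq> {..<length \<alpha>} \<and> card S = Suc r}"
    let ?f = "\<lambda>S. exchange_fst S \<alpha> \<beta>" and ?s = "\<lambda>S. exchange_snd S \<alpha> \<beta>"
    let ?Q = "\<Sum>S\<in>?F. tab_prod (U @ V) * (bracket (?f S) * bracket (?s S))"
    have "pluecker_poly (Suc r) \<alpha> \<beta> \<in> pluecker_relations n"
      unfolding pluecker_relations_def using ab len r
      by (intro CollectI exI[of _ "Suc r"] exI[of _ \<alpha>] exI[of _ \<beta>] conjI refl) auto
    then have "pluecker_poly (Suc r) \<alpha> \<beta> \<in> rel_ideal n a" using relations_in_rel_ideal[OF n2] by blast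
    then have "tab_prod (U @ V) * pluecker_poly (Suc r) \<alpha> \<beta> \<in> rel_ideal n a"
      using cols by (intro rel_ideal_mult[OF n2] tab_prod_closed[OF n2]) (auto simp: tableau_def)
    moreover have "tab_prod T = tab_prod (U @ V) * (bracket \<alpha> * bracket \<beta>)"
      using ab by (simp add: UV tab_prod_def bracket_sorted mult_ac)
    ultimately have "tab_prod T - ?Q \<in> rel_ideal n a"
      by (simp add: pluecker_poly_def right_diff_distrib sum_distrib_left)
    moreover have "?Q \<in> mod_span n a tab_prod ?X"
    proof (rule mod_span_sum[OF n2])
      fix S assume "S \<in> ?F"
      then have S: "S \<subseteq> {..<length \<alpha>}" "card S = Suc r" "card S \<le> length \<beta>" using r by auto
      show "tab_prod (U @ V) * (bracket (?f S) * bracket (?s S)) \<in> mod_span n a tab_prod ?X"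
      proof (cases "distinct (?f S) \<and> distinct (?s S)")
        case False
        then have "bracket (?f S) * bracket (?s S) = 0" by (auto simp: bracket_repeated)
        then show ?thesis using mod_span_zero[OF n2] by simp
      next
        case True
        define \<alpha>' \<beta>' where "\<alpha>' = sorted_list_of_set (set (?f S))" and "\<beta>' = sorted_list_of_set (set (?s S))"
        have ms: "mset \<alpha>' = mset (?f S)" "mset \<beta>' = mset (?s S)"
          using True unfolding \<alpha>'_def \<beta>'_def by (auto simp: set_eq_iff_mset_eq_distinct[symmetric])
        have sets: "set \<alpha>' = set (?f S)" "set \<beta>' = set (?s S)" unfolding \<alpha>'_def \<beta>'_def by simp_all
        have lens: "length \<alpha>' = length \<alpha>" "length \<beta>' = length \<beta>"
          using ms length_exchange_snd[OF S(1,3)] by (metis length_exchange_fst size_mset, metis size_mset)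
        have "set (?f S) \<subseteq> {0..n}" "set (?s S) \<subseteq> {0..n}"
          using set_exchange_fst[OF S(1,3)] set_exchange_snd[of S \<alpha> \<beta>] ab by auto
        then have cols': "column n \<alpha>'" "column n \<beta>'"
          using cols lens sets unfolding column_def by (auto simp: \<alpha>'_def \<beta>'_def)
        let ?T = "U @ \<alpha>' # \<beta>' # V"
        have mab: "mset (\<alpha>' @ \<beta>') = mset (\<alpha> @ \<beta>)" using ms mset_exchange[OF S(1,3)] by simp
        then have content: "mset (concat ?T) = mset (concat T)" by (simp add: UV ac_simps)
        have "binary \<beta> < binary \<beta>'"
          using binary_exchange_less[OF ab(1,2) _ r(1,2) S(1,2)] r(1) len binary_mset[OF ms(2)] by simp
        then have "binary_rank T < binary_rank ?T" unfolding UV(1) by (rule binary_rank_replace[OF mab])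
        moreover have "length ?T * binary (concat ?T) = length T * binary (concat T)"
          using binary_mset[OF content] by (simp add: UV)
        moreover have "binary_rank ?T \<le> length ?T * binary (concat ?T)" by (rule binary_rank_le)
        ultimately have "length ?T * binary (concat ?T) - binary_rank ?T
            < length T * binary (concat T) - binary_rank T" by linarith
        moreover have "tableau n ?T" using cols cols' by (auto simp: tableau_def)
        moreover have "sorted_wrt (\<lambda>s t. length t \<le> length s) ?T"
          using less.prems(2) by (simp add: UV sorted_wrt_append lens)
        ultimately have "tab_prod ?T \<in> mod_span n a tab_prod ?X"
          using less.hyps[of ?T] unfolding content by blast
        then have "const ((- 1) ^ inversions (?f S) * (- 1) ^ inversions (?s S)) * tab_prod ?T \<in> mod_span n a tab_prod ?X"
          by (rule mod_span_scale[OF n2])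
        also have "const ((- 1) ^ inversions (?f S) * (- 1) ^ inversions (?s S)) * tab_prod ?T
            = tab_prod (U @ V) * (bracket (?f S) * bracket (?s S))"
          using True by (simp add: bracket_scaled tab_prod_def sets const_mult mult_ac)
        finally show ?thesis .
      qed
    qed
    ultimately show ?thesis using mod_span_congruent[OF n2] by blast
  qed
qed

section \<open>Standard tableaux and leading exponents\<close>

text \<open>
  The number of entries \<open>v\<close> in row \<open>r\<close> of \<open>T\<close>.
\<close>

definition entries :: "nat list list \<Rightarrow> nat \<Rightarrow> nat \<Rightarrow> nat" where
  "entries T r v = (\<Sum>s\<leftarrow>T. of_bool (r < length s \<and> s ! r = v))"

text \<open>
  The exponent of \<open>y\<^bsub>r+1, v\<^esub>\<close> in the leading term of the product of the minors on the columns of \<open>T\<close>.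
\<close>

definition hat_entries :: "nat list list \<Rightarrow> nat \<Rightarrow> nat \<Rightarrow> nat" where
  "hat_entries T r v = (\<Sum>s\<leftarrow>T. of_bool (r < length s \<and> hat s r = v))"

text \<open>
  The number of entries \<open>v\<close> of \<open>T\<close>.
\<close>

definition tab_content :: "nat list list \<Rightarrow> nat \<Rightarrow> nat" where
  "tab_content T v = count (mset (concat T)) v"

lemma tableau_simps [simp]:
  "tableau n []" "tableau n (s # T) \<longleftrightarrow> column n s \<and> tableau n T"
  "tableau n (T @ T') \<longleftrightarrow> tableau n T \<and> tableau n T'"
  by (auto simp: tableau_def)

lemma entries_simps [simp]:
  "entries [] r v = 0" "entries (s # T) r v = of_bool (r < length s \<and> s ! r = v) + entries T r v"
  "entries (T @ T') r v = entries T r v + entries T' r v"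
  by (simp_all add: entries_def)

lemma hat_entries_simps [simp]:
  "hat_entries [] r v = 0" "hat_entries (s # T) r v = of_bool (r < length s \<and> hat s r = v) + hat_entries T r v"
  by (simp_all add: hat_entries_def)

lemma column_nth_ge: "column n s \<Longrightarrow> r < length s \<Longrightarrow> r \<le> s ! r"
  by (rule increasing_nth_ge) (simp add: column_def)

lemma entries_below: "tableau n T \<Longrightarrow> v < r \<Longrightarrow> entries T r v = 0"
  by (induction T) (auto dest: column_nth_ge)

lemma entries_beyond: "tableau n T \<Longrightarrow> n - 1 \<le> r \<Longrightarrow> entries T r v = 0"
  by (induction T) (auto simp: column_def)

lemma hat_entries_above: "Suc r < v \<Longrightarrow> hat_entries T r v = entries T r v"
  by (induction T) (auto simp: hat_def)

lemma hat_entries_next: "tableau n T \<Longrightarrow> hat_entries T r (Suc r) = entries T r r + entries T r (Suc r)"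
proof (induction T)
  case (Cons s T)
  have "hat s r = Suc r \<longleftrightarrow> s ! r = r \<or> s ! r = Suc r" if "r < length s"
    using column_nth_ge[of n s r] Cons.prems that by (auto simp: hat_def max_def)
  then show ?case using Cons by (auto simp: of_bool_def)
qed simp

lemma content_eq_sum_entries: "tableau n T \<Longrightarrow> tab_content T v = (\<Sum>r\<le>v. entries T r v)"
proof (induction T)
  case (Cons s T)
  have s: "distinct s" using Cons.prems by (simp add: column_def strict_sorted_iff)
  have "count (mset s) v = (\<Sum>r\<le>v. of_bool (r < length s \<and> s ! r = v))"
  proof (cases "v \<in> set s")
    case True
    then obtain i where i: "i < length s" "s ! i = v" by (auto simp: in_set_conv_nth)
    then have "i \<le> v" using column_nth_ge[of n s i] Cons.prems by simp
    have "r < length s \<and> s ! r = v \<longleftrightarrow> r = i" for r using i s by (auto simp: nth_eq_iff_index_eq)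
    moreover have "count (mset s) v = 1" using True s by (metis distinct_count_atmost_1)
    ultimately show ?thesis using \<open>i \<le> v\<close> by (simp add: of_bool_def)
  next
    case False
    then have "(\<Sum>r\<le>v. of_bool (r < length s \<and> s ! r = v)) = (0 :: nat)" by (intro sum.neutral) auto
    moreover have "count (mset s) v = 0" using False by (simp add: count_mset_0_iff)
    ultimately show ?thesis by simp
  qed
  then show ?case using Cons by (simp add: tab_content_def sum.distrib)
qed (simp add: tab_content_def)

lemma content_0: "tableau n T \<Longrightarrow> tab_content T 0 = entries T 0 0"
  by (simp add: content_eq_sum_entries)

text \<open>
  The leading variables with column index \<open>Suc v\<close> come from the entries \<open>Suc v\<close> in the rows up to \<open>v\<close> and
  from the entries \<open>v\<close> in row \<open>v\<close>; only the entries \<open>Suc v\<close> in row \<open>Suc v\<close> are missing. Hence, for a given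
  leading exponent, the content and the diagonal numbers \<open>entries T r r\<close> determine each other.
\<close>

lemma content_balance:
  assumes "tableau n T"
  shows "tab_content T (Suc v) + entries T v v = (\<Sum>r\<le>v. hat_entries T r (Suc v)) + entries T (Suc v) (Suc v)"
proof -
  have "(\<Sum>r\<le>v. hat_entries T r (Suc v)) = (\<Sum>r<v. entries T r (Suc v)) + hat_entries T v (Suc v)"
    by (simp add: hat_entries_above lessThan_Suc_atMost[symmetric])
  also have "\<dots> = (\<Sum>r\<le>v. entries T r (Suc v)) + entries T v v"
    by (simp add: hat_entries_next[OF assms] lessThan_Suc_atMost[symmetric])
  finally show ?thesis by (simp add: content_eq_sum_entries[OF assms])
qed

text \<open>
  For a fixed leading exponent the content determines the diagonal numbers, starting with row \<open>0\<close>.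
\<close>

lemma diagonal_eqI:
  assumes "tableau n T" "tableau n T'" "\<And>r v. hat_entries T r v = hat_entries T' r v"
    and "\<And>v. tab_content T v = tab_content T' v"
  shows "entries T r r = entries T' r r"
proof (induction r)
  case 0
  show ?case using assms(4)[of 0] content_0 assms(1,2) by simp
next
  case (Suc r)
  then show ?case
    using content_balance[OF assms(1), of r] content_balance[OF assms(2), of r] assms(3,4) by simp
qed

lemma entries_eqI:
  assumes "tableau n T" "tableau n T'" "\<And>r v. hat_entries T r v = hat_entries T' r v"
    and "\<And>r. entries T r r = entries T' r r"
  shows "entries T r v = entries T' r v"
proof -
  consider "v < r" | "v = r" | "v = Suc r" | "Suc r < v" by linarith
  then show ?thesis
  proof cases
    case 3
    then show ?thesis
      using hat_entries_next[OF assms(1), of r] hat_entries_next[OF assms(2), of r] assms(3,4) by simp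
  next
    case 4
    then show ?thesis using hat_entries_above[of r v] assms(3)[of r v] by simp
  qed (use assms entries_below in auto)
qed

lemma standard_Cons:
  "standard n (s # T) \<Longrightarrow> column n s \<and> standard n T \<and> (\<forall>t\<in>set T. col_le s t)"
  by (simp add: standard_def)

text \<open>
  The first column of a standard tableau is the longest one, and it has the least entry in each row.
\<close>

lemma standard_head_minimal:
  assumes "standard n (s # T)" "0 < entries (s # T) r v"
  shows "r < length s \<and> s ! r \<le> v"
proof -
  have "\<exists>t\<in>set (s # T). r < length t \<and> t ! r = v"
  proof (rule ccontr)
    assume "\<not> ?thesis"
    then have "entries (s # T) r v = 0" unfolding entries_def by (auto simp: sum_list_eq_0_iff)
    with assms(2) show False by simp
  qed
  then obtain t where "t \<in> set (s # T)" "r < length t" "t ! r = v" by blast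
  then show ?thesis using standard_Cons[OF assms(1)] by (auto simp: col_le_def)
qed

text \<open>
  The first column can be read off the rows; remove it and proceed by induction.
\<close>

lemma standard_eqI:
  assumes "standard n T" "standard n T'" "\<And>r v. entries T r v = entries T' r v"
  shows "T = T'"
  using assms
proof (induction T arbitrary: T')
  case Nil
  show ?case
  proof (cases T')
    case (Cons s U)
    then have "0 < length s" using Nil.prems(2) by (auto simp: standard_def column_def)
    then show ?thesis using Nil.prems(3)[of 0 "s ! 0"] Cons by simp
  qed simp
next
  case (Cons s T)
  have "0 < length s" using Cons.prems(1) by (auto simp: standard_def column_def)
  then have "T' \<noteq> []" using Cons.prems(3)[of 0 "s ! 0"] by auto
  then obtain s' U where T': "T' = s' # U" by (cases T') auto
  have 1: "r < length s' \<and> s' ! r \<le> s ! r" if "r < length s" for r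
  proof (rule standard_head_minimal)
    show "standard n (s' # U)" using Cons.prems(2) T' by simp
    show "0 < entries (s' # U) r (s ! r)" unfolding T'[symmetric] Cons.prems(3)[symmetric] using that by simp
  qed
  have 2: "r < length s \<and> s ! r \<le> s' ! r" if "r < length s'" for r
  proof (rule standard_head_minimal)
    show "0 < entries (s # T) r (s' ! r)" unfolding Cons.prems(3) using that T' by simp
  qed (rule Cons.prems(1))
  have "length s = length s'" using 1 2 by (metis linorder_neqE_nat order_less_irrefl)
  then have "s = s'" using 1 2 by (intro nth_equalityI) (auto intro: order_antisym)
  moreover have "T = U"
    using Cons.prems \<open>s = s'\<close> T' by (intro Cons.IH) (auto dest: standard_Cons)
  ultimately show ?case using T' by simp
qed

text \<open>
  The monomial with exponents \<open>b\<close> in the variables \<open>x\<^sub>j\<close>; values of \<open>b\<close> beyond \<open>n\<close> are ignored.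
\<close>

definition xprod :: "nat \<Rightarrow> (nat \<Rightarrow> nat) \<Rightarrow> cox_poly" where
  "xprod n b = (\<Prod>j\<in>{0..n}. var (XVar j) ^ b j)"

text \<open>
  The monomial \<open>x\<^sup>b P\<^sub>T\<close> of the source ring. The order of the columns in \<open>T\<close> is irrelevant.
\<close>

definition cox_mon :: "nat \<Rightarrow> (nat \<Rightarrow> nat) \<times> nat list list \<Rightarrow> cox_poly" where
  "cox_mon n = (\<lambda>(b, T). xprod n b * tab_prod T)"

text \<open>
  The exponent of the image of \<open>xprod n b\<close>, which is a single monomial.
\<close>

definition xkey :: "nat \<Rightarrow> (nat \<Rightarrow> nat) \<Rightarrow> tkey" where
  "xkey n b = (\<Sum>j\<in>{0..n}. (Poly_Mapping.single j (- int (b j)), 0))"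

text \<open>
  The key of \<open>(b, T)\<close>: the leading exponent of the image of \<open>x\<^sup>b P\<^sub>T\<close>.
\<close>

definition mon_key :: "nat \<Rightarrow> (nat \<Rightarrow> nat) \<Rightarrow> (nat \<Rightarrow> nat) \<times> nat list list \<Rightarrow> tkey" where
  "mon_key n a = (\<lambda>(b, T). xkey n b + (\<Sum>s\<leftarrow>T. ckey a s))"

lemma xprod_closed: "xprod n b \<in> source n"
proof -
  have "var (XVar j) \<in> source n" if "j \<in> {0..n}" for j
    using that by (intro var_closed) (simp add: cox_vars_def)
  then show ?thesis
    unfolding xprod_def source_ring_def
    by (intro submonoid_add.prod_closed[OF submonoid_source_exponents]
          submonoid_add.power_closed[OF submonoid_source_exponents])
qed

lemma leads_Psi_mon:
  assumes "tableau n T"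
  shows "leads n (Psi n a (cox_mon n (b, T))) (mon_key n a (b, T))"
proof -
  have prod: "Psi n a (prod f A) = (\<Prod>i\<in>A. Psi n a (f i))" for f :: "nat \<Rightarrow> cox_poly" and A
    by (induction A rule: infinite_finite_induct) (simp_all add: Psi_one Psi_mult)
  have "leads n (\<Prod>j\<in>{0..n}. tvar_inv j ^ b j) (xkey n b)"
    unfolding xkey_def by (rule leads_prod) (simp_all add: tvar_inv_power leads_single)
  then have "leads n (Psi n a (xprod n b)) (xkey n b)"
    by (simp add: xprod_def prod Psi_power Psi_XVar)
  moreover have "leads n (Psi n a (tab_prod T)) (\<Sum>s\<leftarrow>T. ckey a s)"
  proof -
    have "Psi n a (tab_prod T) = (\<Prod>s\<leftarrow>T. Psi n a (var (PVar (set s))))"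
      unfolding tab_prod_def by (induction T) (simp_all add: Psi_one Psi_mult)
    then show ?thesis using assms by (auto simp: tableau_def intro: leads_prod_list leads_Psi_column)
  qed
  ultimately show ?thesis unfolding cox_mon_def mon_key_def by (simp add: Psi_mult leads_mult)
qed

lemma lookup_fst_mon_key:
  assumes "j \<le> n"
  shows "Poly_Mapping.lookup (fst (mon_key n a (b, T))) j = int (a j * tab_content T j) - int (b j)"
proof -
  have x: "Poly_Mapping.lookup (fst (xkey n b)) j = - int (b j)"
  proof -
    have "fst (\<Sum>j\<in>A. (Poly_Mapping.single j (- int (b j)), 0) :: tkey) = (\<Sum>j\<in>A. Poly_Mapping.single j (- int (b j)))" for A
      by (induction A rule: infinite_finite_induct) simp_all
    then show ?thesis using assms by (simp add: xkey_def lookup_sum lookup_single when_def)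
  qed
  have s: "Poly_Mapping.lookup (\<Sum>i\<leftarrow>s. Poly_Mapping.single i (int (a i))) j = int (a j * count (mset s) j)" for s
    by (induction s) (simp_all add: lookup_add lookup_single when_def algebra_simps)
  have "Poly_Mapping.lookup (fst (\<Sum>s\<leftarrow>T. ckey a s)) j = int (a j * tab_content T j)"
    by (induction T) (simp_all add: lookup_add ckey_def s tab_content_def algebra_simps)
  then show ?thesis by (simp add: mon_key_def lookup_add x)
qed

lemma lookup_seqkey: "Poly_Mapping.lookup (seqkey p f) (Suc r, v) = of_bool (r < p \<and> f r = v)"
proof (induction p)
  case (Suc p)
  then show ?case by (auto simp: seqkey_def lookup_add lookup_single when_def less_Suc_eq of_bool_def)
qed (simp add: seqkey_def)

lemma snd_xkey: "snd (xkey n b) = 0"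
proof -
  have "snd (\<Sum>j\<in>A. (Poly_Mapping.single j (- int (b j)), 0) :: tkey) = 0" for A
    by (induction A rule: infinite_finite_induct) simp_all
  then show ?thesis by (simp add: xkey_def)
qed

lemma lookup_snd_mon_key: "Poly_Mapping.lookup (snd (mon_key n a (b, T))) (Suc r, v) = hat_entries T r v"
proof -
  have "Poly_Mapping.lookup (snd (\<Sum>s\<leftarrow>T. ckey a s)) (Suc r, v) = hat_entries T r v"
    by (induction T) (simp_all add: lookup_add ckey_def ykey_def lookup_seqkey)
  then show ?thesis by (simp add: mon_key_def snd_xkey)
qed

lemma key_weight_mon_key: "key_weight n (mon_key n a (b, T)) = (\<Sum>s\<leftarrow>T. key_weight n (0, ykey s))"
proof -
  have "key_weight n (xkey n b) = 0" using snd_xkey[of n b] by (simp add: key_weight_def)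
  moreover have "key_weight n (\<Sum>s\<leftarrow>T. ckey a s) = (\<Sum>s\<leftarrow>T. key_weight n (0, ykey s))"
  proof (induction T)
    case Nil
    then show ?case by (simp add: key_weight_def)
  next
    case (Cons s T)
    have "key_weight n (ckey a s) = key_weight n (0, ykey s)" unfolding ckey_def by (rule key_weight_snd)
    with Cons show ?case by (simp add: key_weight_add)
  qed
  ultimately show ?thesis by (simp add: mon_key_def key_weight_add)
qed

lemma mon_key_hat_entries:
  "mon_key n a (b, T) = mon_key n a (b', T') \<Longrightarrow> hat_entries T r v = hat_entries T' r v"
  by (metis lookup_snd_mon_key)

lemma mon_key_degree:
  assumes "mon_key n a (b, T) = mon_key n a (b', T')" "j \<le> n"
  shows "a j * tab_content T j + b' j = a j * tab_content T' j + b j"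
  using lookup_fst_mon_key[OF assms(2), of a b T] lookup_fst_mon_key[OF assms(2), of a b' T'] assms(1)
  by (simp only: of_nat_eq_iff[where 'a = int, symmetric] of_nat_add)

lemma lookup_const_mult: "Poly_Mapping.lookup (const c * p) k = c * Poly_Mapping.lookup p k"
  unfolding const_def by (simp flip: mult_map_scale_conv_mult add: Poly_Mapping.map.rep_eq when_def)

text \<open>
  A heaviest key that belongs to only one member of a linear combination is not cancelled.
\<close>

lemma leading_key_survives:
  assumes i: "i \<in> Poly_Mapping.keys C" "leads n (g i) (k i)"
    and others: "\<And>j. j \<in> Poly_Mapping.keys C \<Longrightarrow> j \<noteq> i \<Longrightarrow>
      leads n (g j) (k j) \<and> k j \<noteq> k i \<and> key_weight n (k j) \<le> key_weight n (k i)"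
  shows "k i \<in> Poly_Mapping.keys (lincomb g C)"
proof -
  have "Poly_Mapping.lookup (g j) (k i) = 0" if "j \<in> Poly_Mapping.keys C - {i}" for j
  proof (rule ccontr)
    assume "Poly_Mapping.lookup (g j) (k i) \<noteq> 0"
    then have "k i \<in> Poly_Mapping.keys (g j)" by (simp add: in_keys_iff)
    then show False using others[of j] that leads_keys[of n "g j" "k j" "k i"] by auto
  qed
  then have "Poly_Mapping.lookup (lincomb g C) (k i) = Poly_Mapping.lookup C i * Poly_Mapping.lookup (g i) (k i)"
    using i(1) by (simp add: lincomb_def lookup_sum lookup_add lookup_const_mult sum.remove[of _ i])
  then show ?thesis using leads_lookup[OF i(2)] i(1) by (simp add: in_keys_iff)
qed

lemma Psi_lincomb: "Psi n a (lincomb g C) = lincomb (\<lambda>i. Psi n a (g i)) C"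
  by (simp add: lincomb_def Psi_sum Psi_mult Psi_const)

text \<open>
  The monomials of weight less than \<open>w\<close>.
\<close>

definition low :: "nat \<Rightarrow> (nat \<Rightarrow> nat) \<Rightarrow> nat \<Rightarrow> ((nat \<Rightarrow> nat) \<times> nat list list) set" where
  "low n a w = {(b, T). tableau n T \<and> key_weight n (mon_key n a (b, T)) < w}"

lemma straightening_any_order:
  assumes n2: "n \<ge> 2" and T: "tableau n T"
  shows "tab_prod T \<in> mod_span n a tab_prod {T'. standard n T' \<and> mset (concat T') = mset (concat T)}"
proof -
  let ?T = "rev (sort_key length T)"
  have ms: "mset ?T = mset T" by simp
  have "tab_prod ?T = tab_prod T"
  proof -
    have "tab_prod l = prod_mset (image_mset (\<lambda>s. var (PVar (set s))) (mset l))" for l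
      by (induction l) (simp_all add: tab_prod_def)
    then show ?thesis by (simp only: ms)
  qed
  moreover have "mset (concat ?T) = mset (concat T)"
  proof -
    have "mset (concat l) = sum_mset (image_mset mset (mset l))" for l :: "nat list list"
      by (induction l) simp_all
    then show ?thesis by (simp only: ms)
  qed
  moreover have "tableau n ?T" using T by (simp add: tableau_def)
  moreover have "sorted_wrt (\<lambda>s t. length t \<le> length s) ?T"
    using sorted_sort_key[of length T] by (simp add: sorted_wrt_rev sorted_map)
  ultimately show ?thesis using straightening[OF n2, of ?T a] by simp
qed

text \<open>
  The standard tableaux obtained by straightening \<open>T\<close> have the same content, so their keys are
  distinct. The heaviest of these keys survive in the image of \<open>P\<^sub>T\<close>, hence are not heavier than the key
  of \<open>T\<close>, and are equal to it if they are as heavy. Since the key of \<open>T\<close> must be attained, exactly one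
  tableau has it and all others are lighter.
\<close>

lemma standard_reduction:
  assumes n2: "n \<ge> 2" and T: "tableau n T"
  obtains T' c where "standard n T'" "mon_key n a (b, T') = mon_key n a (b, T)"
    "\<And>v. tab_content T' v = tab_content T v"
    "cox_mon n (b, T) - const c * cox_mon n (b, T') \<in> mod_span n a (cox_mon n) (low n a (key_weight n (mon_key n a (b, T))))"
proof -
  let ?key = "\<lambda>T. mon_key n a (b, T)" and ?g = "\<lambda>T. cox_mon n (b, T)"
  let ?w = "key_weight n (?key T)"
  obtain C where C: "Poly_Mapping.keys C \<subseteq> {T'. standard n T' \<and> mset (concat T') = mset (concat T)}"
    "tab_prod T - lincomb tab_prod C \<in> rel_ideal n a"
    using straightening_any_order[OF assms, of a] unfolding mod_span_def lspan_def by blast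
  have std: "standard n T'" "tableau n T'" "tab_content T' v = tab_content T v" if "T' \<in> Poly_Mapping.keys C" for T' v
    using C(1) that by (auto simp: standard_def tab_content_def)
  have "xprod n b * (tab_prod T - lincomb tab_prod C) = ?g T - lincomb ?g C"
    by (simp add: cox_mon_def lincomb_def sum_distrib_left algebra_simps)
  then have I: "?g T - lincomb ?g C \<in> rel_ideal n a"
    using rel_ideal_mult[OF n2 C(2) xprod_closed[of n b]] by simp
  have Psi_eq: "Psi n a (?g T) = lincomb (\<lambda>T. Psi n a (?g T)) C"
    using Psi_rel_ideal[OF n2 I] by (simp add: Psi_diff Psi_lincomb)
  \<comment> \<open>equal keys and equal contents give equal diagonals, hence equal rows\<close>
  have inj: "T1 = T2" if "T1 \<in> Poly_Mapping.keys C" "T2 \<in> Poly_Mapping.keys C" "?key T1 = ?key T2" for T1 T2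
  proof -
    have h: "hat_entries T1 r v = hat_entries T2 r v" for r v using that(3) by (rule mon_key_hat_entries)
    have diag: "entries T1 r r = entries T2 r r" for r
      by (rule diagonal_eqI[of n]) (use std that h in auto)
    have "entries T1 r v = entries T2 r v" for r v
      by (rule entries_eqI[of n]) (use std that h diag in auto)
    then show ?thesis using std that by (intro standard_eqI[of n]) auto
  qed
  have bound: "?key T' = ?key T \<or> key_weight n (?key T') < ?w" if T': "T' \<in> Poly_Mapping.keys C" for T'
  proof -
    have top: "?key U = ?key T \<or> key_weight n (?key U) < ?w"
      if U: "U \<in> Poly_Mapping.keys C" "\<forall>V\<in>Poly_Mapping.keys C. key_weight n (?key V) \<le> key_weight n (?key U)" for U
    proof -
      have "?key U \<in> Poly_Mapping.keys (lincomb (\<lambda>T. Psi n a (?g T)) C)"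
        by (rule leading_key_survives[where k = ?key]) (use U std inj leads_Psi_mon in blast)+
      then show ?thesis using leads_keys[OF leads_Psi_mon[OF T]] Psi_eq by metis
    qed
    let ?W = "(\<lambda>V. key_weight n (?key V)) ` Poly_Mapping.keys C"
    have "Max ?W \<in> ?W" using T' by (intro Max_in) auto
    then obtain U where "U \<in> Poly_Mapping.keys C" "key_weight n (?key U) = Max ?W" by auto
    then have U: "U \<in> Poly_Mapping.keys C"
      "\<forall>V\<in>Poly_Mapping.keys C. key_weight n (?key V) \<le> key_weight n (?key U)" by auto
    have "key_weight n (?key T') \<le> key_weight n (?key U)" using U T' by blast
    then consider "key_weight n (?key T') < key_weight n (?key U)"
      | "key_weight n (?key T') = key_weight n (?key U)" by linarith
    then show ?thesis
    proof cases
      case 1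
      then show ?thesis using top[OF U] by auto
    next
      case 2
      then show ?thesis using top[OF T'] U(2) by simp
    qed
  qed
  obtain T' where T': "T' \<in> Poly_Mapping.keys C" "?key T' = ?key T"
  proof -
    have "?key T \<in> Poly_Mapping.keys (Psi n a (?g T))"
      using leads_lookup[OF leads_Psi_mon[OF T]] by (simp add: in_keys_iff)
    then have ne: "Poly_Mapping.lookup (lincomb (\<lambda>T. Psi n a (?g T)) C) (?key T) \<noteq> 0"
      unfolding Psi_eq by (simp add: in_keys_iff)
    have "\<exists>V\<in>Poly_Mapping.keys C. Poly_Mapping.lookup (Psi n a (?g V)) (?key T) \<noteq> 0"
    proof (rule ccontr)
      assume "\<not> ?thesis"
      then have "Poly_Mapping.lookup (lincomb (\<lambda>T. Psi n a (?g T)) C) (?key T) = 0"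
        by (simp add: lincomb_def lookup_sum lookup_const_mult)
      with ne show False by simp
    qed
    then obtain V where V: "V \<in> Poly_Mapping.keys C" "Poly_Mapping.lookup (Psi n a (?g V)) (?key T) \<noteq> 0"
      by blast
    then have "?key T = ?key V \<or> ?w < key_weight n (?key V)"
      using leads_keys[OF leads_Psi_mon[OF std(2)[OF V(1)]], of "?key T" a b] by (simp add: in_keys_iff)
    then have "?key V = ?key T" using bound[OF V(1)] by auto
    then show ?thesis using that V(1) by blast
  qed
  have "(\<Sum>V\<in>Poly_Mapping.keys C - {T'}. const (Poly_Mapping.lookup C V) * ?g V) \<in> lspan (cox_mon n) (low n a ?w)"
  proof (rule lspan_sum)
    fix V assume V: "V \<in> Poly_Mapping.keys C - {T'}"
    then have "key_weight n (?key V) < ?w" using bound[of V] inj[of V T'] T' by auto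
    then have "(b, V) \<in> low n a ?w" using std(2) V by (simp add: low_def)
    then show "const (Poly_Mapping.lookup C V) * ?g V \<in> lspan (cox_mon n) (low n a ?w)" by (rule lspan_scaled_base)
  qed
  moreover have "lincomb ?g C = const (Poly_Mapping.lookup C T') * ?g T'
      + (\<Sum>V\<in>Poly_Mapping.keys C - {T'}. const (Poly_Mapping.lookup C V) * ?g V)"
    unfolding lincomb_def using T'(1) by (intro sum.remove) auto
  ultimately have "?g T - const (Poly_Mapping.lookup C T') * ?g T' \<in> mod_span n a (cox_mon n) (low n a ?w)"
    using I by (intro mod_spanI) (auto simp: algebra_simps)
  then show ?thesis using that std[OF T'(1)] T'(2) by blast
qed

section \<open>Reduction by the linear relations\<close>

lemma diagonal_decreasing: "tableau n T \<Longrightarrow> entries T (Suc r) (Suc r) \<le> entries T r r"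
proof (induction T)
  case (Cons s T)
  have inc: "sorted_wrt (<) s" using Cons.prems by (simp add: column_def)
  have "s ! r = r" if "Suc r < length s" "s ! Suc r = Suc r"
    using sorted_wrt_nth_less[OF inc, of r "Suc r"] increasing_nth_ge[OF inc, of r] that by simp
  then have "of_bool (Suc r < length s \<and> s ! Suc r = Suc r) \<le> (of_bool (r < length s \<and> s ! r = r) :: nat)"
    by auto
  then show ?case using Cons by (simp add: add_mono)
qed simp

lemma xkey_update:
  assumes "j \<le> n"
  shows "xkey n (b(j := b j + k)) = xkey n b + (Poly_Mapping.single j (- int k), 0)"
proof -
  have split: "xkey n c = (Poly_Mapping.single j (- int (c j)), 0)
      + (\<Sum>i\<in>{0..n} - {j}. (Poly_Mapping.single i (- int (c i)), 0))" for c
    unfolding xkey_def using assms by (intro sum.remove) auto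
  have "xkey n (b(j := b j + k)) = (Poly_Mapping.single j (- int (b j + k)), 0)
      + (\<Sum>i\<in>{0..n} - {j}. (Poly_Mapping.single i (- int (b i)), 0))"
    unfolding split[of "b(j := b j + k)"] by simp
  also have "(Poly_Mapping.single j (- int (b j + k)), 0)
      = (Poly_Mapping.single j (- int (b j)), 0) + ((Poly_Mapping.single j (- int k), 0) :: tkey)"
    by (simp add: single_add[symmetric])
  finally show ?thesis unfolding split[of b] by (simp only: ac_simps)
qed

lemma xprod_update:
  assumes "j \<le> n"
  shows "xprod n (b(j := b j + k)) = xprod n b * var (XVar j) ^ k"
proof -
  have "xprod n (b(j := b j + k)) = var (XVar j) ^ (b j + k) * (\<Prod>i\<in>{0..n} - {j}. var (XVar i) ^ b i)"
    unfolding xprod_def using assms by (subst prod.remove[of _ j]) auto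
  moreover have "xprod n b = var (XVar j) ^ b j * (\<Prod>i\<in>{0..n} - {j}. var (XVar i) ^ b i)"
    unfolding xprod_def using assms by (subst prod.remove[of _ j]) auto
  ultimately show ?thesis by (simp add: power_add mult_ac)
qed

lemma ckey_increasing: "sorted_wrt (<) s \<Longrightarrow> ckey a s = (\<Sum>j\<in>set s. Poly_Mapping.single j (int (a j)), ykey s)"
  unfolding ckey_def by (simp add: sum_list_distinct_conv_sum_set strict_sorted_iff)

text \<open>
  A maximal interval \<open>{p..<q}\<close> of rows in which the diagonal numbers of \<open>T\<close> exceed those of \<open>T'\<close>. The
  diagonal numbers of \<open>T'\<close> decrease weakly, so those of \<open>T\<close> drop strictly at \<open>q\<close>.
\<close>

lemma diagonal_interval:
  assumes "tableau n T" "tableau n T'" "entries T' r0 r0 < entries T r0 r0"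
  obtains p q where "p < q" "p < n"
    "entries T' p p < entries T p p" "p = 0 \<or> entries T (p - 1) (p - 1) \<le> entries T' (p - 1) (p - 1)"
    "entries T q q < entries T (q - 1) (q - 1)"
proof -
  let ?D = "\<lambda>r. entries T' r r < entries T r r"
  define p where "p = (LEAST r. ?D r)"
  have p: "?D p" unfolding p_def using assms(3) by (rule LeastI)
  have below: "\<not> ?D r" if "r < p" for r using that not_less_Least unfolding p_def by blast
  have "p < n - 1" using p entries_beyond[OF assms(1), of p] by (metis not_le not_less_zero)
  define q where "q = (LEAST r. p < r \<and> \<not> ?D r)"
  have "p < n \<and> \<not> ?D n" using \<open>p < n - 1\<close> entries_beyond[OF assms(1), of n n] by simp
  then have q: "p < q" "\<not> ?D q" unfolding q_def by (metis (mono_tags, lifting) LeastI)+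
  have "?D (q - 1)"
  proof (cases "q - 1 = p")
    case False
    then have "p < q - 1" "q - 1 < q" using q by auto
    then show ?thesis using not_less_Least[of "q - 1" "\<lambda>r. p < r \<and> \<not> ?D r"] unfolding q_def by blast
  qed (use p in simp)
  then have "entries T q q < entries T (q - 1) (q - 1)"
    using q diagonal_decreasing[OF assms(2), of "q - 1"] by simp
  moreover have "p = 0 \<or> entries T (p - 1) (p - 1) \<le> entries T' (p - 1) (p - 1)"
    using below[of "p - 1"] by (cases p) auto
  ultimately show ?thesis using that p q \<open>p < n - 1\<close> by auto
qed

text \<open>
  A column with initial run \<open>0, \<dots>, q - 1\<close> exactly is one that is counted by the diagonal number of row
  \<open>q - 1\<close> but not by that of row \<open>q\<close>.
\<close>

lemma column_with_run:
  assumes "tableau n T" "entries T q q < entries T (q - 1) (q - 1)" "0 < q"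
  obtains s R where "s \<in> set T" "s = [0..<q] @ R" "\<And>x. x \<in> set R \<Longrightarrow> q < x"
proof -
  have "\<exists>s\<in>set T. q - 1 < length s \<and> s ! (q - 1) = q - 1 \<and> \<not> (q < length s \<and> s ! q = q)"
  proof (rule ccontr)
    assume neg: "\<not> ?thesis"
    have "entries T (q - 1) (q - 1) \<le> entries T q q"
      unfolding entries_def by (rule sum_list_mono) (use neg in auto)
    with assms(2) show False by simp
  qed
  then obtain s where s: "s \<in> set T" "q - 1 < length s" "s ! (q - 1) = q - 1" "\<not> (q < length s \<and> s ! q = q)"
    by blast
  have inc: "sorted_wrt (<) s" using assms(1) s(1) by (simp add: tableau_def column_def)
  obtain q' R where R: "s = [0..<q'] @ R" "sorted_wrt (<) R" "\<And>x. x \<in> set R \<Longrightarrow> q' < x"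
    by (rule initial_run[OF inc]) blast
  have "q \<le> q'"
  proof (rule ccontr)
    assume "\<not> q \<le> q'"
    then have "\<not> q - 1 < q'" by simp
    moreover have "q - 1 < q' + length R" using s(2) R(1) by simp
    ultimately have "hat s (q - 1) = s ! (q - 1)"
      unfolding R(1) using hat_initial_run[OF R(2,3), of "q - 1"] by (simp add: nth_append)
    then show False using s(3) by (simp add: hat_def max_def split: if_splits)
  qed
  moreover have "\<not> q < q'" using s(4) R(1) by (auto simp: nth_append)
  ultimately have "q' = q" by simp
  then show ?thesis using that s(1) R by blast
qed

text \<open>
  The term of index \<open>j\<close> of a linear relation, multiplied by a monomial: up to sign it is again a
  monomial, and its key depends on \<open>j\<close> only through the leading exponent of the new column \<open>t\<close>.
\<close>

lemma linear_relation_terms: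
  fixes b0 :: "nat \<Rightarrow> nat" and js :: "nat list"
  assumes j: "j \<le> n" "j \<notin> set js" and t: "sorted_wrt (<) t" "set t = insert j (set js)"
    and js: "sorted_wrt (<) js"
  shows "xprod n b0 * tab_prod (U @ V) * (var (XVar j) ^ a j * bracket (j # js))
       = const ((- 1) ^ inversions (j # js)) * cox_mon n (b0(j := b0 j + a j), U @ t # V)"
    and "mon_key n a (b0(j := b0 j + a j), U @ t # V)
       = xkey n b0 + (\<Sum>s\<leftarrow>U @ V. ckey a s) + (\<Sum>i\<in>set js. Poly_Mapping.single i (int (a i)), ykey t)"
proof -
  have "distinct (j # js)" using j js by (simp add: strict_sorted_iff)
  then show "xprod n b0 * tab_prod (U @ V) * (var (XVar j) ^ a j * bracket (j # js))
       = const ((- 1) ^ inversions (j # js)) * cox_mon n (b0(j := b0 j + a j), U @ t # V)"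
    by (simp add: bracket_scaled cox_mon_def xprod_update[OF j(1)] tab_prod_def t(2) mult_ac)
  have "(Poly_Mapping.single j (- int (a j)), 0) + ckey a t
      = (\<Sum>i\<in>set js. Poly_Mapping.single i (int (a i)), ykey t)"
    using j by (simp add: ckey_increasing[OF t(1)] t(2) flip: single_add add.assoc)
  note col = this
  have "mon_key n a (b0(j := b0 j + a j), U @ t # V) = xkey n b0 + (\<Sum>s\<leftarrow>U @ V. ckey a s)
      + ((Poly_Mapping.single j (- int (a j)), 0) + ckey a t)"
    unfolding mon_key_def case_prod_conv xkey_update[OF j(1)]
    by (simp only: map_append sum_list_append list.map sum_list.Cons ac_simps)
  then show "mon_key n a (b0(j := b0 j + a j), U @ t # V)
       = xkey n b0 + (\<Sum>s\<leftarrow>U @ V. ckey a s) + (\<Sum>i\<in>set js. Poly_Mapping.single i (int (a i)), ykey t)"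
    by (simp only: col)
qed

text \<open>
  One reduction by a linear relation. The exponent of \<open>x\<^sub>p\<close> is large enough because the two monomials
  have the same degree in \<open>t\<^sub>p\<close>, while the index \<open>p\<close> occurs more often in \<open>T\<close> than in \<open>T'\<close>.
\<close>

lemma linear_step:
  assumes n2: "n \<ge> 2" and T: "tableau n T" "tableau n T'"
    and key: "mon_key n a (b, T) = mon_key n a (b', T')"
    and r0: "entries T' r0 r0 < entries T r0 r0"
  obtains b1 T1 c where "tableau n T1" "mon_key n a (b1, T1) = mon_key n a (b, T)"
    "(\<Sum>r<n. entries T1 r r) < (\<Sum>r<n. entries T r r)"
    "cox_mon n (b, T) - const c * cox_mon n (b1, T1)
       \<in> mod_span n a (cox_mon n) (low n a (key_weight n (mon_key n a (b, T))))"
proof -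
  obtain p q where pq: "p < q" "p < n" "entries T' p p < entries T p p"
    "p = 0 \<or> entries T (p - 1) (p - 1) \<le> entries T' (p - 1) (p - 1)"
    "entries T q q < entries T (q - 1) (q - 1)"
    by (rule diagonal_interval[OF T r0]) blast
  obtain s R where s: "s \<in> set T" "s = [0..<q] @ R" "\<And>x. x \<in> set R \<Longrightarrow> q < x"
    by (rule column_with_run[OF T(1) pq(5)]) (use pq in auto)
  obtain U V where UV: "T = U @ s # V" using s(1) by (meson split_list)
  have col: "column n s" and tUV: "tableau n U" "tableau n V" using T(1) by (auto simp: UV)
  have inc: "sorted_wrt (<) s" using col by (simp add: column_def)
  let ?w = "key_weight n (mon_key n a (b, T))"
  have "tab_content T' p < tab_content T p"
  proof (cases p)
    case 0
    then show ?thesis using pq(3) content_0[OF T(1)] content_0[OF T(2)] by simp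
  next
    case (Suc m)
    have "hat_entries T r v = hat_entries T' r v" for r v using key by (rule mon_key_hat_entries)
    then show ?thesis
      using pq(3,4) content_balance[OF T(1), of m] content_balance[OF T(2), of m] Suc by simp
  qed
  then have "a p * tab_content T' p + a p \<le> a p * tab_content T p"
    using mult_le_mono2[of "Suc (tab_content T' p)" "tab_content T p" "a p"] by simp
  then have bp: "a p \<le> b p" using mon_key_degree[OF key, of p] pq(2) by linarith
  \<comment> \<open>remove the factor \<open>x\<^sub>p ^ a p\<close>; the relation puts \<open>x\<^sub>j ^ a j\<close> in its place\<close>
  define b0 where "b0 = b(p := b p - a p)"
  have b0: "b0(p := b0 p + a p) = b" using bp by (auto simp: b0_def)
  define js where "js = [0..<p] @ [Suc p..<q] @ R"
  have s_split: "s = [0..<p] @ p # [Suc p..<q] @ R"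
    using pq(1) s(2) by (metis append.assoc append_Cons less_imp_le_nat upt_add_eq_append upt_conv_Cons le_add_diff_inverse zero_le)
  have js: "sorted_wrt (<) js" "set s = insert p (set js)" "p \<notin> set js" "length js = length s - 1"
  proof -
    show "p \<notin> set js" using s(3)[of p] pq(1) by (auto simp: js_def)
    have "sorted_wrt (<) R" using inc s(2) by (simp add: sorted_wrt_append)
    then show "sorted_wrt (<) js"
      using s(3) pq(1) unfolding js_def by (fastforce simp: sorted_wrt_append)
    show "set s = insert p (set js)"
      unfolding s_split js_def by (simp only: set_append list.set) blast
    show "length js = length s - 1" unfolding s_split js_def by simp
  qed
  have js_n: "set js \<subseteq> {0..n}" using col js(2) by (auto simp: column_def)
  have "card (set js) \<le> n - 2"
  proof -
    have "card (set js) = length s - 1" using distinct_card[of js] js(1,4) by (simp add: strict_sorted_iff)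
    moreover have "length s \<le> n - 1" using col by (simp add: column_def)
    ultimately show ?thesis by linarith
  qed
  moreover have sl: "sorted_list_of_set (set js) = js" by (rule sorted_list_of_set_increasing[OF js(1)])
  ultimately have "(\<Sum>j\<in>{0..n} - set js. var (XVar j) ^ a j * bracket (j # js)) \<in> linear_relations n a"
    unfolding linear_relations_def using js_n by (intro CollectI exI[of _ "set js"]) simp
  then have "(\<Sum>j\<in>{0..n} - set js. var (XVar j) ^ a j * bracket (j # js)) \<in> rel_ideal n a"
    using relations_in_rel_ideal[OF n2] by blast
  moreover have "xprod n b0 * tab_prod (U @ V) \<in> source n"
    using tUV by (intro source_closed xprod_closed tab_prod_closed[OF n2]) simp
  ultimately have "xprod n b0 * tab_prod (U @ V) * (\<Sum>j\<in>{0..n} - set js. var (XVar j) ^ a j * bracket (j # js)) \<in> rel_ideal n a"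
    by (rule rel_ideal_mult[OF n2])
  then have I0: "(\<Sum>j\<in>{0..n} - set js. xprod n b0 * tab_prod (U @ V) * (var (XVar j) ^ a j * bracket (j # js))) \<in> rel_ideal n a"
    by (simp only: sum_distrib_left)
  define sg where "sg j = ((- 1) ^ inversions (j # js) :: complex)" for j
  define t where "t j = sorted_list_of_set (insert j (set js))" for j
  define m where "m j = cox_mon n (b0(j := b0 j + a j), U @ t j # V)" for j
  have tj: "sorted_wrt (<) (t j)" "set (t j) = insert j (set js)" for j
  proof -
    have "sorted_wrt (<) (sorted_list_of_set A) \<and> set (sorted_list_of_set A) = A"
      if "finite A" for A :: "nat set" using that by simp
    from this[of "insert j (set js)"] show "sorted_wrt (<) (t j)" "set (t j) = insert j (set js)"
      unfolding t_def by blast+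
  qed
  have terms: "xprod n b0 * tab_prod (U @ V) * (var (XVar j) ^ a j * bracket (j # js)) = const (sg j) * m j"
    if "j \<in> {0..n} - set js" for j
    unfolding sg_def m_def by (rule linear_relation_terms(1)) (use that tj js in auto)
  have keys: "mon_key n a (b0(j := b0 j + a j), U @ t j # V)
       = xkey n b0 + (\<Sum>s\<leftarrow>U @ V. ckey a s) + (\<Sum>i\<in>set js. Poly_Mapping.single i (int (a i)), ykey (t j))"
    if "j \<in> {0..n} - set js" for j
    by (rule linear_relation_terms(2)) (use that tj js in auto)
  have I: "(\<Sum>j\<in>{0..n} - set js. const (sg j) * m j) \<in> rel_ideal n a"
    using I0 by (simp only: terms cong: sum.cong)
  have tp: "t p = s" unfolding t_def using sorted_list_of_set_increasing[OF inc] js(2) by simp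
  have mp: "m p = cox_mon n (b, T)" by (simp only: m_def b0 tp UV)
  have "q \<le> length s" "length s \<le> n - 1" using col s(2) by (simp_all add: column_def)
  then have q_n: "q \<le> n" by linarith
  have q_js: "q \<notin> set js" using s(3)[of q] pq(1) by (auto simp: js_def)
  have pJ: "p \<in> {0..n} - set js" and qJ: "q \<in> {0..n} - set js - {p}"
    using pq q_n q_js js(3) by auto
  define tq where "tq = [0..<p] @ [Suc p..<Suc q] @ R"
  note sh = shifted_run[OF inc[unfolded s(2)] s(3) pq(1), folded tq_def s(2)]
  have js_s: "set js = set s - {p}" using js(2,3) by auto
  have tq: "t q = tq" unfolding t_def js_s using sorted_list_of_set_increasing[OF sh(1)] sh(3) by simp
  have ykq: "ykey tq = ykey s"
  proof -
    have "seqkey (length s) (hat tq) = seqkey (length s) (hat s)"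
      by (rule seqkey_cong) (use sh(2,4) in auto)
    then show ?thesis using sh(2) by (simp only: ykey_def)
  qed
  let ?b1 = "b0(q := b0 q + a q)" and ?T1 = "U @ tq # V"
  have "column n tq" using col sh(1,2,3) q_n by (auto simp: column_def)
  then have T1: "tableau n ?T1" using tUV by simp
  have key_p: "mon_key n a (b, T) = xkey n b0 + (\<Sum>s\<leftarrow>U @ V. ckey a s) + (\<Sum>i\<in>set js. Poly_Mapping.single i (int (a i)), ykey s)"
    using keys[OF pJ] unfolding b0 tp UV by simp
  have key1: "mon_key n a (?b1, ?T1) = mon_key n a (b, T)"
    using keys[of q] qJ unfolding tq ykq key_p by simp
  have run: "tq ! r = r \<longrightarrow> s ! r = r" if "r < length s" for r
  proof (cases "r < q")
    case True
    then show ?thesis by (simp add: s(2) nth_append)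
  next
    case False
    have "tq ! r = s ! r"
    proof -
      have "tq = ([0..<p] @ [Suc p..<Suc q]) @ R" by (simp add: tq_def)
      moreover have "length ([0..<p] @ [Suc p..<Suc q]) = q" using pq(1) by simp
      ultimately have "tq ! r = R ! (r - q)" using False by (metis nth_append)
      then show ?thesis using False by (simp add: s(2) nth_append)
    qed
    then show ?thesis by simp
  qed
  have len_p: "p < length s" using s(2) pq(1) by simp
  have "(\<Sum>r<n. entries ?T1 r r) < (\<Sum>r<n. entries T r r)"
  proof (rule sum_strict_mono_ex1)
    show "\<forall>r\<in>{..<n}. entries ?T1 r r \<le> entries T r r"
      using run sh(2) by (auto simp: UV of_bool_def)
    have "tq ! p = Suc p" using pq(1) by (simp add: tq_def nth_append del: upt_Suc)
    moreover have "s ! p = p" using pq(1) by (simp add: s(2) nth_append)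
    ultimately have "entries ?T1 p p < entries T p p" using len_p by (simp add: UV)
    then show "\<exists>r\<in>{..<n}. entries ?T1 r r < entries T r r" using pq(2) by blast
  qed simp
  moreover have "cox_mon n (b, T) - const (- (sg p * sg q)) * cox_mon n (?b1, ?T1)
       \<in> mod_span n a (cox_mon n) (low n a ?w)"
  proof -
    let ?J = "{0..n} - set js - {p} - {q}"
    let ?rest = "\<Sum>j\<in>?J. const (sg j) * m j"
    have lows: "(b0(j := b0 j + a j), U @ t j # V) \<in> low n a ?w" if j: "j \<in> ?J" for j
    proof -
      have j': "q < j" "j \<notin> set R" "j \<le> n"
        using j unfolding js_def by auto
      note ra = raised_run[OF inc[unfolded s(2)] s(3) pq(1) j'(1,2), folded s(2)]
      note w = raised_run_weight[OF col[unfolded s(2)] s(3) pq(1) j', folded s(2)]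
      have tjj: "t j = [0..<p] @ [Suc p..<q] @ insort j R"
        unfolding t_def js_s using sorted_list_of_set_increasing[OF ra(1)] ra(3) by simp
      have "column n (t j)" using w(1) tjj by simp
      moreover have "key_weight n (0, ykey (t j)) < key_weight n (0, ykey s)" using w(2) tjj by simp
      ultimately show ?thesis using tUV by (simp add: low_def key_weight_mon_key UV)
    qed
    have sum_eq: "(\<Sum>j\<in>{0..n} - set js. const (sg j) * m j)
        = const (sg p) * m p + (const (sg q) * m q + ?rest)"
      using pJ qJ by (simp add: sum.remove[of "{0..n} - set js" p] sum.remove[of "{0..n} - set js - {p}" q])
    have sgp: "const (sg p) * const (sg p) = (1 :: cox_poly)"
      by (simp add: sg_def const_1 flip: const_mult power_mult_distrib)
    have "const (sg p) * (const (sg p) * m p + (const (sg q) * m q + ?rest))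
        = m p - const (- (sg p * sg q)) * m q - (- (const (sg p) * ?rest))"
    proof -
      have "const (- (sg p * sg q)) = - (const (sg p) * const (sg q) :: cox_poly)"
        by (simp add: const_def single_uminus mult_single)
      then show ?thesis by (simp add: distrib_left mult.assoc[symmetric] sgp)
    qed
    then have "m p - const (- (sg p * sg q)) * m q - (- (const (sg p) * ?rest)) \<in> rel_ideal n a"
      using rel_ideal_scale[OF n2 I[unfolded sum_eq], of "sg p"] by simp
    moreover have "- (const (sg p) * ?rest) \<in> mod_span n a (cox_mon n) (low n a ?w)"
    proof (intro mod_span_uminus[OF n2] mod_span_scale[OF n2] mod_span_sum[OF n2])
      fix j assume "j \<in> ?J"
      then show "m j \<in> mod_span n a (cox_mon n) (low n a ?w)"
        unfolding m_def by (intro mod_span_lspan[OF n2] lspan_base lows)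
    qed
    ultimately have "m p - const (- (sg p * sg q)) * m q \<in> mod_span n a (cox_mon n) (low n a ?w)"
      using mod_span_congruent[OF n2] by blast
    then show ?thesis unfolding mp by (simp only: m_def tq)
  qed
  ultimately show ?thesis using that[OF T1 key1] by blast
qed

section \<open>The kernel\<close>

lemma cox_mon_cong: "(\<And>j. j \<le> n \<Longrightarrow> b j = b' j) \<Longrightarrow> cox_mon n (b, T) = cox_mon n (b', T)"
proof -
  assume "\<And>j. j \<le> n \<Longrightarrow> b j = b' j"
  then have "xprod n b = xprod n b'" unfolding xprod_def by (intro prod.cong) auto
  then show ?thesis by (simp add: cox_mon_def)
qed

text \<open>
  The representative \<open>(b0, T0)\<close> is standard with least sum of diagonal numbers. Straighten \<open>T\<close>, which
  changes neither key nor content and thus no diagonal number. If some diagonal number then exceeds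
  that of \<open>T0\<close>, a linear step lowers the sum; otherwise all are equal by minimality, and the standard
  tableau is \<open>T0\<close> itself.
\<close>

lemma reduce_to_representative:
  assumes n2: "n \<ge> 2" and rep: "standard n T0"
    and minimal: "\<And>b T. standard n T \<Longrightarrow> mon_key n a (b, T) = mon_key n a (b0, T0) \<Longrightarrow>
      (\<Sum>r<n. entries T0 r r) \<le> (\<Sum>r<n. entries T r r)"
    and T: "tableau n T" "mon_key n a (b, T) = mon_key n a (b0, T0)"
  shows "\<exists>c. cox_mon n (b, T) - const c * cox_mon n (b0, T0)
       \<in> mod_span n a (cox_mon n) (low n a (key_weight n (mon_key n a (b0, T0))))"
  using T
proof (induction "\<Sum>r<n. entries T r r" arbitrary: b T rule: less_induct)
  case less
  let ?M = "mod_span n a (cox_mon n) (low n a (key_weight n (mon_key n a (b0, T0))))"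
  have trans: "\<exists>c. x - const c * z \<in> ?M" if "x - const c1 * y \<in> ?M" "y - const c2 * z \<in> ?M" for x y z c1 c2
  proof -
    have "(x - const c1 * y) + const c1 * (y - const c2 * z) \<in> ?M"
      using that by (intro mod_span_add[OF n2] mod_span_scale[OF n2])
    then have "x - const (c1 * c2) * z \<in> ?M" by (simp add: algebra_simps const_mult)
    then show ?thesis by blast
  qed
  obtain T1 c1 where T1: "standard n T1" "mon_key n a (b, T1) = mon_key n a (b, T)"
    "\<And>v. tab_content T1 v = tab_content T v" "cox_mon n (b, T) - const c1 * cox_mon n (b, T1) \<in> ?M"
    using standard_reduction[OF n2 less.prems(1), of a b] less.prems(2) by metis
  have tab: "tableau n T1" "tableau n T0" using T1(1) rep by (simp_all add: standard_def)
  have key: "mon_key n a (b, T1) = mon_key n a (b0, T0)" using T1(2) less.prems(2) by simp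
  have hats: "hat_entries T1 r v = hat_entries T r v" for r v using T1(2) by (rule mon_key_hat_entries)
  have "entries T1 r r = entries T r r" for r
    by (rule diagonal_eqI[OF tab(1) less.prems(1) hats T1(3)])
  then have diag_sum: "(\<Sum>r<n. entries T1 r r) = (\<Sum>r<n. entries T r r)" by simp
  show ?case
  proof (cases "\<exists>r. entries T0 r r < entries T1 r r")
    case True
    then obtain r where r: "entries T0 r r < entries T1 r r" by blast
    obtain b2 T2 c2 where T2: "tableau n T2" "mon_key n a (b2, T2) = mon_key n a (b0, T0)"
      "(\<Sum>r<n. entries T2 r r) < (\<Sum>r<n. entries T1 r r)"
      "cox_mon n (b, T1) - const c2 * cox_mon n (b2, T2) \<in> ?M"
      by (rule linear_step[OF n2 tab key r, unfolded key]) blast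
    then obtain c3 where "cox_mon n (b2, T2) - const c3 * cox_mon n (b0, T0) \<in> ?M"
      using less.hyps[of T2 b2] diag_sum key by auto
    then show ?thesis using trans[OF T1(4)] trans[OF T2(4)] by blast
  next
    case False
    then have le: "entries T1 r r \<le> entries T0 r r" for r by (simp add: not_less)
    have diag: "entries T1 r r = entries T0 r r" for r
    proof (cases "r < n")
      case True
      show ?thesis
      proof (rule ccontr)
        assume "entries T1 r r \<noteq> entries T0 r r"
        then have "(\<Sum>r<n. entries T1 r r) < (\<Sum>r<n. entries T0 r r)"
          using True le by (intro sum_strict_mono_ex1) (auto simp: le_less)
        then show False using minimal[OF T1(1) key] by simp
      qed
    next
      case False
      then show ?thesis using entries_beyond[OF tab(1), of r r] entries_beyond[OF tab(2), of r r] by simp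
    qed
    have hats0: "hat_entries T1 r v = hat_entries T0 r v" for r v using key by (rule mon_key_hat_entries)
    have eq: "T1 = T0"
      by (rule standard_eqI[OF T1(1) rep]) (rule entries_eqI[OF tab hats0 diag])
    have "b j = b0 j" if "j \<le> n" for j
      using mon_key_degree[OF key that] eq by simp
    then have "cox_mon n (b, T1) = cox_mon n (b0, T0)" unfolding eq by (rule cox_mon_cong)
    then show ?thesis using T1(4) by auto
  qed
qed

text \<open>
  Among the standard monomials with the given key, choose one with least sum of diagonal numbers.
\<close>

lemma representative_exists:
  assumes n2: "n \<ge> 2" and ex: "tableau n T" "mon_key n a (b, T) = \<kappa>"
  shows "\<exists>b0 T0. tableau n T0 \<and> mon_key n a (b0, T0) = \<kappa> \<and>
    (\<forall>b T. tableau n T \<longrightarrow> mon_key n a (b, T) = \<kappa> \<longrightarrow>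
      (\<exists>c. cox_mon n (b, T) - const c * cox_mon n (b0, T0)
        \<in> mod_span n a (cox_mon n) (low n a (key_weight n \<kappa>))))"
proof -
  let ?P = "\<lambda>(b, T). standard n T \<and> mon_key n a (b, T) = \<kappa>"
  let ?m = "\<lambda>(b, T). \<Sum>r<n. entries T r r"
  obtain T1 c where "standard n T1" "mon_key n a (b, T1) = mon_key n a (b, T)"
    by (rule standard_reduction[OF n2 ex(1), of a b])
  then have "?P (b, T1)" using ex by simp
  then obtain i where i: "?P i" "\<forall>j. ?P j \<longrightarrow> ?m i \<le> ?m j"
    using ex_has_least_nat[of ?P "(b, T1)" ?m] by blast
  obtain b0 T0 where "i = (b0, T0)" by (cases i)
  with i have rep: "standard n T0" "mon_key n a (b0, T0) = \<kappa>"
    "\<And>b T. standard n T \<Longrightarrow> mon_key n a (b, T) = \<kappa> \<Longrightarrow> (\<Sum>r<n. entries T0 r r) \<le> (\<Sum>r<n. entries T r r)"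
    by auto
  have "\<exists>c. cox_mon n (b, T) - const c * cox_mon n (b0, T0)
        \<in> mod_span n a (cox_mon n) (low n a (key_weight n \<kappa>))"
    if "tableau n T" "mon_key n a (b, T) = \<kappa>" for b T
    using reduce_to_representative[OF n2 rep(1), of a b0 T b] rep(2,3) that by blast
  then show ?thesis using rep by (intro exI[of _ b0] exI[of _ T0]) (auto simp: standard_def)
qed

text \<open>
  Each monomial of weight \<open>w\<close> is replaced by a multiple of the representative of its key. The keys of
  the representatives are distinct and heavier than the remaining monomials, so no representative can
  occur in an element of the kernel.
\<close>

lemma kernel_low_subset:
  assumes n2: "n \<ge> 2"
  shows "f \<in> lspan (cox_mon n) (low n a w) \<Longrightarrow> Psi n a f = 0 \<Longrightarrow> f \<in> rel_ideal n a"
proof (induction w arbitrary: f)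
  case 0
  then have "f = 0" by (auto simp: lspan_def low_def lincomb_def)
  then show ?case using rel_ideal_zero[OF n2] by simp
next
  case (Suc w)
  let ?key = "mon_key n a" and ?L = "low n a w"
  define K where "K = ?key ` {i \<in> low n a (Suc w). key_weight n (?key i) = w}"
  have "\<forall>\<kappa>\<in>K. \<exists>i. tableau n (snd i) \<and> ?key i = \<kappa> \<and>
    (\<forall>b T. tableau n T \<longrightarrow> ?key (b, T) = \<kappa> \<longrightarrow>
      (\<exists>c. cox_mon n (b, T) - const c * cox_mon n i \<in> mod_span n a (cox_mon n) ?L))"
  proof
    fix \<kappa> assume "\<kappa> \<in> K"
    then obtain b T where "tableau n T" "?key (b, T) = \<kappa>" "key_weight n \<kappa> = w"
      by (auto simp: K_def low_def)
    then show "\<exists>i. tableau n (snd i) \<and> ?key i = \<kappa> \<and>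
      (\<forall>b T. tableau n T \<longrightarrow> ?key (b, T) = \<kappa> \<longrightarrow>
        (\<exists>c. cox_mon n (b, T) - const c * cox_mon n i \<in> mod_span n a (cox_mon n) ?L))"
      using representative_exists[OF n2, of T a b \<kappa>] by fastforce
  qed
  then obtain rep where rep: "\<And>\<kappa>. \<kappa> \<in> K \<Longrightarrow> tableau n (snd (rep \<kappa>)) \<and> ?key (rep \<kappa>) = \<kappa>"
    "\<And>\<kappa> b T. \<kappa> \<in> K \<Longrightarrow> tableau n T \<Longrightarrow> ?key (b, T) = \<kappa> \<Longrightarrow>
      \<exists>c. cox_mon n (b, T) - const c * cox_mon n (rep \<kappa>) \<in> mod_span n a (cox_mon n) ?L"
    by metis
  \<comment> \<open>\<open>f\<close> is first rewritten in terms of light monomials and representatives\<close>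
  let ?X = "?L \<union> rep ` K"
  have mono: "mod_span n a (cox_mon n) ?L \<subseteq> mod_span n a (cox_mon n) ?X"
    unfolding mod_span_def using lspan_mono[of ?L ?X "cox_mon n"] by blast
  have base: "cox_mon n i \<in> mod_span n a (cox_mon n) ?X" if i: "i \<in> low n a (Suc w)" for i
  proof (cases "i \<in> ?L")
    case True
    then show ?thesis by (intro mod_span_lspan[OF n2] lspan_base) simp
  next
    case False
    obtain b T where bT: "i = (b, T)" by (cases i)
    have tT: "tableau n T" using i by (simp add: low_def bT)
    have "key_weight n (?key i) = w" using i False by (auto simp: low_def bT)
    then have K: "?key i \<in> K" using i by (auto simp: K_def)
    then obtain c where "cox_mon n i - const c * cox_mon n (rep (?key i)) \<in> mod_span n a (cox_mon n) ?L"
      using rep(2)[OF K, of T b] tT unfolding bT by blast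
    moreover have "const c * cox_mon n (rep (?key i)) \<in> mod_span n a (cox_mon n) ?X"
      using K by (intro mod_span_lspan[OF n2] lspan_scaled_base) blast
    ultimately show ?thesis using mono mod_span_add[OF n2, of "cox_mon n i - const c * cox_mon n (rep (?key i))"] by fastforce
  qed
  obtain C where C: "f = lincomb (cox_mon n) C" "Poly_Mapping.keys C \<subseteq> low n a (Suc w)"
    using Suc.prems(1) unfolding lspan_def by blast
  have "f \<in> mod_span n a (cox_mon n) ?X"
    unfolding C(1) lincomb_def using C(2) base
    by (intro mod_span_sum[OF n2] mod_span_scale[OF n2]) blast
  then obtain D where D: "Poly_Mapping.keys D \<subseteq> ?X" "f - lincomb (cox_mon n) D \<in> rel_ideal n a"
    unfolding mod_span_def lspan_def by blast
  then have zero: "Psi n a (lincomb (cox_mon n) D) = 0"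
    using Psi_rel_ideal[OF n2 D(2)] Suc.prems(2) by (simp add: Psi_diff)
  have lead: "leads n (Psi n a (cox_mon n i)) (?key i)" if "tableau n (snd i)" for i
    using leads_Psi_mon[OF that, of a "fst i"] by simp
  have weights: "tableau n (snd i) \<and> (i \<in> ?L \<or> (\<exists>\<kappa>\<in>K. i = rep \<kappa> \<and> ?key i = \<kappa> \<and> key_weight n (?key i) = w))"
    if i: "i \<in> ?X" for i
  proof (cases "i \<in> ?L")
    case True
    then show ?thesis by (auto simp: low_def)
  next
    case False
    then obtain \<kappa> where "\<kappa> \<in> K" "i = rep \<kappa>" using i by blast
    moreover have "key_weight n \<kappa> = w" using \<open>\<kappa> \<in> K\<close> unfolding K_def by blast
    ultimately show ?thesis using rep(1) by metis
  qed
  have Lw: "key_weight n (?key i) < w" if "i \<in> ?L" for i using that by (auto simp: low_def)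
  have "Poly_Mapping.keys D \<subseteq> ?L"
  proof (rule ccontr)
    assume "\<not> ?thesis"
    then obtain i where i: "i \<in> Poly_Mapping.keys D" "i \<notin> ?L" by blast
    then obtain \<kappa> where \<kappa>: "\<kappa> \<in> K" "i = rep \<kappa>" "?key i = \<kappa>" "key_weight n (?key i) = w"
      using weights[of i] D(1) by blast
    have "?key i \<in> Poly_Mapping.keys (lincomb (\<lambda>i. Psi n a (cox_mon n i)) D)"
    proof (rule leading_key_survives[where n = n])
      show "i \<in> Poly_Mapping.keys D" by (rule i(1))
      show "leads n (Psi n a (cox_mon n i)) (?key i)" using lead weights[of i] D(1) i(1) by blast
      fix j assume j: "j \<in> Poly_Mapping.keys D" "j \<noteq> i"
      then have jX: "j \<in> ?X" using D(1) by blast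
      have "?key j \<noteq> ?key i \<and> key_weight n (?key j) \<le> key_weight n (?key i)"
      proof (cases "j \<in> ?L")
        case True
        then show ?thesis using Lw[of j] \<kappa>(4) by auto
      next
        case False
        then show ?thesis using weights[OF jX] j(2) \<kappa> by auto
      qed
      then show "leads n (Psi n a (cox_mon n j)) (?key j) \<and> ?key j \<noteq> ?key i \<and>
          key_weight n (?key j) \<le> key_weight n (?key i)"
        using lead weights[OF jX] by blast
    qed
    then show False using zero by (simp add: Psi_lincomb)
  qed
  then have "lincomb (cox_mon n) D \<in> lspan (cox_mon n) ?L" unfolding lspan_def by blast
  then have "lincomb (cox_mon n) D \<in> rel_ideal n a" using Suc.IH zero by blast
  then show ?case using rel_ideal_add[OF n2 D(2)] by fastforce
qed

lemma cox_mon_mult: "cox_mon n (b, T) * cox_mon n (b', T') = cox_mon n (\<lambda>j. b j + b' j, T @ T')"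
  by (simp add: cox_mon_def tab_prod_append xprod_def power_add prod.distrib mult_ac)

lemma var_power_cox_mon:
  assumes n2: "n \<ge> 2" and v: "v \<in> cox_vars n"
  shows "\<exists>b T. tableau n T \<and> var v ^ k = cox_mon n (b, T)"
proof -
  have P: "\<exists>b T. tableau n T \<and> var (PVar \<sigma>) ^ k = cox_mon n (b, T)"
    if \<sigma>: "\<sigma> \<subseteq> {0..n}" "1 \<le> card \<sigma>" "card \<sigma> \<le> n - 1" for \<sigma>
  proof -
    let ?s = "sorted_list_of_set \<sigma>"
    have fin: "finite \<sigma>" using \<sigma>(1) finite_subset by blast
    then have "column n ?s" using \<sigma> by (simp add: column_def)
    then have "tableau n (replicate k ?s)" by (simp add: tableau_def)
    moreover have "var (PVar \<sigma>) ^ k = cox_mon n (\<lambda>_. 0, replicate k ?s)"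
      using fin by (simp add: cox_mon_def xprod_def tab_prod_def prod_list_replicate)
    ultimately show ?thesis by blast
  qed
  consider j where "v = XVar j" "j \<le> n"
    | \<tau> where "v = PVar \<tau>" "\<tau> \<subseteq> {1..n}" "1 \<le> card \<tau>" "card \<tau> \<le> n - 1"
    | \<tau> where "v = PVar (insert 0 \<tau>)" "\<tau> \<subseteq> {1..n}" "card \<tau> \<le> n - 2"
    using v unfolding cox_vars_def by blast
  then show ?thesis
  proof cases
    case 1
    have "xprod n ((\<lambda>_. 0)(j := 0 + k)) = var (XVar j) ^ k"
      using xprod_update[OF 1(2), of "\<lambda>_. 0" k] by (simp add: xprod_def)
    then show ?thesis
      using 1 by (intro exI[of _ "(\<lambda>_. 0)(j := 0 + k)"] exI[of _ "[]"]) (simp add: cox_mon_def tab_prod_def)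
  next
    case 2
    then show ?thesis using P[of \<tau>] by (auto simp: subset_iff)
  next
    case 3
    have "finite \<tau>" "0 \<notin> \<tau>" using 3 by (auto intro: finite_subset)
    then show ?thesis using P[of "insert 0 \<tau>"] 3 n2 by (auto simp: subset_iff)
  qed
qed

lemma exponent_eq_sum_single:
  "m = (\<Sum>v\<in>Poly_Mapping.keys m. Poly_Mapping.single v (Poly_Mapping.lookup m v :: nat))"
  by (rule poly_mapping_eqI) (simp add: lookup_sum lookup_single when_def in_keys_iff)

lemma single_cox_mon:
  assumes n2: "n \<ge> 2" and m: "Poly_Mapping.keys m \<subseteq> cox_vars n"
  shows "\<exists>b T. tableau n T \<and> Poly_Mapping.single m 1 = cox_mon n (b, T)"
proof -
  have one: "1 = cox_mon n (\<lambda>_. 0, [])" by (simp add: cox_mon_def xprod_def tab_prod_def)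
  have prods: "\<exists>b T. tableau n T \<and> (\<Prod>v\<in>A. var v ^ k v) = cox_mon n (b, T)"
    if "finite A" "A \<subseteq> cox_vars n" for A k
    using that
  proof (induction A rule: finite_induct)
    case empty
    then show ?case using one by (intro exI[of _ "\<lambda>_. 0"] exI[of _ "[]"]) simp
  next
    case (insert v A)
    then obtain b T where "tableau n T" "(\<Prod>v\<in>A. var v ^ k v) = cox_mon n (b, T)" by auto
    moreover obtain b' T' where "tableau n T'" "var v ^ k v = cox_mon n (b', T')"
      using var_power_cox_mon[OF n2, of v "k v"] insert.prems by auto
    ultimately show ?case
      using insert.hyps
      by (intro exI[of _ "\<lambda>j. b' j + b j"] exI[of _ "T' @ T"]) (simp add: cox_mon_mult)
  qed
  have power: "var v ^ k = Poly_Mapping.single (Poly_Mapping.single v k) 1" for v k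
  proof (induction k)
    case (Suc k)
    then show ?case by (simp add: var_def mult_single flip: single_add)
  qed simp
  have "(\<Prod>v\<in>A. var v ^ Poly_Mapping.lookup m v)
      = Poly_Mapping.single (\<Sum>v\<in>A. Poly_Mapping.single v (Poly_Mapping.lookup m v)) 1" for A
    by (induction A rule: infinite_finite_induct) (simp_all add: power mult_single)
  then have "Poly_Mapping.single m 1 = (\<Prod>v\<in>Poly_Mapping.keys m. var v ^ Poly_Mapping.lookup m v)"
    using exponent_eq_sum_single[of m] by simp
  then show ?thesis using prods[of "Poly_Mapping.keys m"] m by simp
qed

lemma source_in_low_span:
  assumes n2: "n \<ge> 2" and f: "f \<in> source n"
  obtains w where "f \<in> lspan (cox_mon n) (low n a w)"
proof -
  let ?X = "{(b, T). tableau n T} :: ((nat \<Rightarrow> nat) \<times> nat list list) set"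
  have "f = (\<Sum>m\<in>Poly_Mapping.keys f. const (Poly_Mapping.lookup f m) * Poly_Mapping.single m 1)"
    by (subst poly_mapping_eq_sum_single[of f]) (simp add: const_def mult_single)
  also have "\<dots> \<in> lspan (cox_mon n) ?X"
  proof (rule lspan_sum)
    fix m assume "m \<in> Poly_Mapping.keys f"
    then have "Poly_Mapping.keys m \<subseteq> cox_vars n" using f by (auto simp: source_ring_def monoid_algebra_def)
    then obtain b T where "tableau n T" "Poly_Mapping.single m 1 = cox_mon n (b, T)"
      using single_cox_mon[OF n2] by blast
    then show "const (Poly_Mapping.lookup f m) * Poly_Mapping.single m 1 \<in> lspan (cox_mon n) ?X"
      using lspan_scaled_base[of "(b, T)" ?X _ "cox_mon n"] by simp
  qed
  finally obtain C where C: "f = lincomb (cox_mon n) C" "Poly_Mapping.keys C \<subseteq> ?X"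
    unfolding lspan_def by blast
  let ?W = "(\<lambda>i. key_weight n (mon_key n a i)) ` Poly_Mapping.keys C"
  have "key_weight n (mon_key n a i) < Suc (Max ?W)" if "i \<in> Poly_Mapping.keys C" for i
    using that by (simp add: le_imp_less_Suc)
  then have "Poly_Mapping.keys C \<subseteq> low n a (Suc (Max ?W))" using C(2) by (auto simp: low_def)
  then have "f \<in> lspan (cox_mon n) (low n a (Suc (Max ?W)))" using C(1) unfolding lspan_def by blast
  then show ?thesis by (rule that)
qed

theorem theorem3p5:
  fixes n :: nat and a :: "nat \<Rightarrow> nat"
  assumes "n \<ge> 2"
    and "\<And>j. j \<le> n \<Longrightarrow> a j > 0"
  shows "a_kernel (source_ring n) (target_ring n) (Psi n a) =
         genideal (source_ring n) (pluecker_relations n \<union> linear_relations n a)"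
proof
  show "a_kernel (source_ring n) (target_ring n) (Psi n a)
      \<subseteq> genideal (source_ring n) (pluecker_relations n \<union> linear_relations n a)"
  proof
    fix f assume "f \<in> a_kernel (source_ring n) (target_ring n) (Psi n a)"
    then have f: "f \<in> source n" "Psi n a f = 0"
      by (simp_all add: a_kernel_def' target_ring_def monoid_algebra_def)
    obtain w where "f \<in> lspan (cox_mon n) (low n a w)"
      by (rule source_in_low_span[OF assms(1) f(1)])
    then have "f \<in> rel_ideal n a" using f(2) by (rule kernel_low_subset[OF assms(1)])
    then show "f \<in> genideal (source_ring n) (pluecker_relations n \<union> linear_relations n a)"
      by (simp only: rel_ideal_def)
  qed
  show "genideal (source_ring n) (pluecker_relations n \<union> linear_relations n a)
      \<subseteq> a_kernel (source_ring n) (target_ring n) (Psi n a)"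
    using rel_ideal_subset_kernel[OF assms(1)] by (simp only: rel_ideal_def)
qed

end
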